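(* Let $\mu$ be a probability measure on the unit circle $\mathbb{T}$ supported on an infinite set. Suppose that $\xi_0 \in \mathbb{T}$ is such that, for some constant $c$, $$\frac{1}{n}\sum_{k=0}^{n}|\chi_k(\xi_0)|^2 \le \frac{c}{\mathcal{P}(\mu, z_n)}, \qquad z_n = \left(1 - \tfrac{1}{n}\right)\xi_0,$$ for all $n \ge 1$. Assume, moreover, that $\xi_0$ is a Lebesgue point of $f \in L^2(\mu)$. Then $$\lim_{n \to +\infty}\frac{1}{n}\sum_{k=0}^{n-1}|\mathbf{S}_k(f, \xi_0) - f(\xi_0)| = 0.$$ In particular, if $\mu = w\,dm + \mu_s$ (with $w\in L^1(\mathbb{T})$ and $\mu_s$ singular with respect to $m$) is such that $\log w \in L^1(\mathbb{T})$, then for every $f\in L^2(\mu)$ the Fourier series of $f$ with respect to $\{\chi_k\}_{k\ge0}$ is strongly Cesàro summable Lebesgue almost everywhere on $\mathbb{T}$, that is, $\lim_{n \to +\infty}\frac{1}{n}\sum_{k=0}^{n-1}|\mathbf{S}_k(f, \xi) - f(\xi)| = 0$ for $m$-almost every $\xi\in\mathbb{T}$.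
   Context: $\mathbb{T}=\{z\in\mathbb{C}:|z|=1\}$; $m$ is Lebesgue measure on $\mathbb{T}$ with $m(\mathbb{T})=1$, $L^1(\mathbb{T})=L^1(m)$. The CMV basis $\{\chi_n\}_{n\ge0}$ of $L^2(\mu)$ is the orthonormal sequence obtained by Gram–Schmidt orthogonalization in $L^2(\mu)$ of the harmonics $1, z, \bar z, z^2, \bar z^2,\dots$ in this order. Equivalently, $\chi_{2k}=\bar z^{k}\phi_{2k}^*$ and $\chi_{2k+1}=\bar z^k\phi_{2k+1}$ on $\mathbb{T}$, where $\phi_n$ are the orthonormal polynomials in $L^2(\mu)$ obtained by Gram–Schmidt from $1,z,z^2,\dots$, and $\phi_n^*(z)=z^n\overline{\phi_n(1/\bar z)}$ are the reflected polynomials (normalized so that $\phi_n^*(0)>0$). The partial sums of the Fourier series of $f\in L^2(\mu)$ are $\mathbf{S}_k(f,\xi)=\sum_{j=0}^k c_j\chi_j(\xi)$, $c_j=(f,\chi_j)_{L^2(\mu)}$, $\xi\in\mathbb{T}$. The Poisson extension of $\mu$ is $\mathcal{P}(\mu,z)=\int_{\mathbb{T}}\frac{1-|z|^2}{|1-\bar\xi z|^2}\,d\mu(\xi)$, $|z|<1$. A point $\xi_0\in\operatorname{supp}\mu$ is a Lebesgue point of $f\in L^2(\mu)$ if there is a representative of $f$ (denoted by the same letter) such that $\lim_{\varepsilon\to0}\frac{1}{\mu(I_{\xi_0,\varepsilon})}\int_{I_{\xi_0,\varepsilon}}|f-f(\xi_0)|^2\,d\mu=0$, where $I_{\xi_0,\varepsilon}=\{\xi\in\mathbb{C}:|\xi-\xi_0|<\varepsilon\}$;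 $f(\xi_0)$ is the corresponding value. *)

theory Defs
  imports "HOL-Probability.Probability"
begin

text \<open>Measures on the unit circle are Borel measures on the complex plane that vanish off
  \<open>sphere 0 1\<close>. Functions are honest pointwise functions, not equivalence classes.\<close>

definition circle_prob :: "complex measure \<Rightarrow> bool" where
  "circle_prob M \<longleftrightarrow> prob_space M \<and> sets M = sets borel \<and> emeasure M (- sphere 0 1) = 0"

definition circle_lebesgue :: "complex measure" where
  "circle_lebesgue = distr (uniform_measure lborel {0..2 * pi}) borel cis"

definition msupport :: "'a::metric_space measure \<Rightarrow> 'a set" where
  "msupport M = {x. \<forall>\<epsilon>>0. emeasure M (ball x \<epsilon>) > 0}"

definition L2_fun :: "'a measure \<Rightarrow> ('a \<Rightarrow> complex) \<Rightarrow> bool" where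
  "L2_fun M f \<longleftrightarrow> f \<in> borel_measurable M \<and> integrable M (\<lambda>x. (norm (f x))\<^sup>2)"

definition L2_inner :: "'a measure \<Rightarrow> ('a \<Rightarrow> complex) \<Rightarrow> ('a \<Rightarrow> complex) \<Rightarrow> complex" where
  "L2_inner M f g = (LINT x|M. f x * cnj (g x))"

definition L2_nrm :: "'a measure \<Rightarrow> ('a \<Rightarrow> complex) \<Rightarrow> real" where
  "L2_nrm M f = sqrt (LINT x|M. (norm (f x))\<^sup>2)"

text \<open>Gram-Schmidt is carried out on pointwise functions, so that its output can be evaluated at
  every point, including points of measure zero.\<close>

fun gram_schmidt_fun :: "'a measure \<Rightarrow> (nat \<Rightarrow> 'a \<Rightarrow> complex) \<Rightarrow> nat \<Rightarrow> 'a \<Rightarrow> complex" where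
  "gram_schmidt_fun M h n =
     (let g = (\<lambda>x. h n x - (\<Sum>j<n. L2_inner M (h n) (gram_schmidt_fun M h j)
                                      * gram_schmidt_fun M h j x))
      in (\<lambda>x. g x / of_real (L2_nrm M g)))"

declare gram_schmidt_fun.simps [simp del]

text \<open>The ordering \<open>1, z, cnj z, z^2, (cnj z)^2, \<dots>\<close>.\<close>

definition cmv_harmonic :: "nat \<Rightarrow> complex \<Rightarrow> complex" where
  "cmv_harmonic n z = (if even n then cnj z ^ (n div 2) else z ^ Suc (n div 2))"

definition cmv_basis :: "complex measure \<Rightarrow> nat \<Rightarrow> complex \<Rightarrow> complex" where
  "cmv_basis M = gram_schmidt_fun M cmv_harmonic"

definition cmv_partial_sum :: "complex measure \<Rightarrow> nat \<Rightarrow> (complex \<Rightarrow> complex) \<Rightarrow> complex \<Rightarrow> complex" where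
  "cmv_partial_sum M k f \<xi> = (\<Sum>j\<le>k. L2_inner M f (cmv_basis M j) * cmv_basis M j \<xi>)"

definition poisson_ext :: "complex measure \<Rightarrow> complex \<Rightarrow> real" where
  "poisson_ext M z = (LINT \<xi>|M. (1 - (norm z)\<^sup>2) / (norm (1 - cnj \<xi> * z))\<^sup>2)"

text \<open>\<open>\<xi>\<^sub>0\<close> is a Lebesgue point of (the class of) \<open>f\<close>, and \<open>v\<close> is the value \<open>f \<xi>\<^sub>0\<close> of a
  representative witnessing this.\<close>

definition lebesgue_point_value ::
    "complex measure \<Rightarrow> (complex \<Rightarrow> complex) \<Rightarrow> complex \<Rightarrow> complex \<Rightarrow> bool" where
  "lebesgue_point_value M f \<xi>\<^sub>0 v \<longleftrightarrow>
     \<xi>\<^sub>0 \<in> msupport M \<and>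
     (\<exists>g. L2_fun M g \<and> (AE \<xi> in M. g \<xi> = f \<xi>) \<and> g \<xi>\<^sub>0 = v \<and>
       ((\<lambda>\<epsilon>. (LINT \<xi>:ball \<xi>\<^sub>0 \<epsilon>|M. (norm (g \<xi> - g \<xi>\<^sub>0))\<^sup>2) / measure M (ball \<xi>\<^sub>0 \<epsilon>))
          \<longlongrightarrow> 0) (at_right 0))"

definition strong_cesaro_at ::
    "complex measure \<Rightarrow> (complex \<Rightarrow> complex) \<Rightarrow> complex \<Rightarrow> complex \<Rightarrow> bool" where
  "strong_cesaro_at M f \<xi> v \<longleftrightarrow>
     (\<lambda>n. (1 / real n) * (\<Sum>k<n. norm (cmv_partial_sum M k f \<xi> - v))) \<longlonglongrightarrow> 0"

definition mutually_singular :: "'a measure \<Rightarrow> 'a measure \<Rightarrow> bool" where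
  "mutually_singular M N \<longleftrightarrow>
     sets M = sets N \<and> (\<exists>A\<in>sets M. emeasure M A = 0 \<and> emeasure N (space N - A) = 0)"

text \<open>\<open>\<mu> = w dm + \<mu>\<^sub>s\<close>. Nonnegativity of \<open>w\<close> is made explicit because \<open>ennreal\<close> truncates
  negative values.\<close>

definition lebesgue_decomp ::
    "complex measure \<Rightarrow> (complex \<Rightarrow> real) \<Rightarrow> complex measure \<Rightarrow> bool" where
  "lebesgue_decomp M w M\<^sub>s \<longleftrightarrow>
     integrable circle_lebesgue w \<and> (AE \<xi> in circle_lebesgue. w \<xi> \<ge> 0) \<and>
     mutually_singular M\<^sub>s circle_lebesgue \<and>
     (\<forall>A\<in>sets borel. emeasure M A =
        emeasure (density circle_lebesgue (\<lambda>\<xi>. ennreal (w \<xi>))) A + emeasure M\<^sub>s A)"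

text \<open>Positivity is part of the condition: \<open>log 0 = -\<infinity>\<close> in the mathematics, but \<open>ln 0 = 0\<close> here.\<close>

definition log_integrable :: "(complex \<Rightarrow> real) \<Rightarrow> bool" where
  "log_integrable w \<longleftrightarrow>
     (AE \<xi> in circle_lebesgue. w \<xi> > 0) \<and> integrable circle_lebesgue (\<lambda>\<xi>. ln (w \<xi>))"

end

theory Submission
  imports Defs "HOL-Complex_Analysis.Complex_Analysis" "HOL-Real_Asymp.Real_Asymp"
    "HOL-Computational_Algebra.Fundamental_Theorem_Algebra"
begin

text \<open>Subtracting a constant, assume that \<open>f\<close> vanishes at \<open>\<xi>\<close>. Multiplication by \<open>z\<close> is a banded
  matrix in the CMV basis, so \<open>S\<^sub>k((z - \<xi>) F, \<xi>)\<close> only involves the coefficients of \<open>F\<close> and the values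
  \<open>\<chi>\<^sub>j(\<xi>)\<close> with index near \<open>k\<close>, and its absolute values sum to at most a constant times
  \<open>\<parallel>F\<parallel> (\<Sum> |\<chi>\<^sub>j(\<xi>)|\<^sup>2)\<^bsup>1/2\<^esup>\<close>. Applied to \<open>F = f / (z - \<xi>)\<close> off the disc of radius \<open>1/n\<close> (inside it the
  Bessel inequality suffices), this is controlled because the Lebesgue point condition, a comparison of
  two measures on all small discs, passes to integrals of the radially decreasing Poisson kernel.

  For the almost everywhere statement the hypothesis on \<open>\<chi>\<^sub>k\<close> is checked through the extremal property
  of the reproducing kernel: \<open>|Q(\<xi>)|\<^sup>2 \<le> 8 n exp (\<integral> |log w| P\<^sub>n dm) \<integral> |Q|\<^sup>2 d\<mu>\<close> for polynomials of degree
  at most \<open>n\<close>. This follows from Jensen's inequality and \<open>log |Q(\<xi>)| \<le> \<integral> log |Q| P\<^sub>n dm + log 2\<close>, where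
  \<open>P\<^sub>n\<close> is the Poisson kernel at \<open>(1 - 1/n) \<xi>\<close>; the latter is proved one linear factor at a time.\<close>

section \<open>Orthonormal sequences and Gram-Schmidt\<close>

text \<open>Up to constants the Poisson kernel at (1 - 1/n) \<xi> is at least n on |z - \<xi>| \<le>
  1/n and at least 1/(n |z - \<xi>|^2) beyond. A single Poisson integral of |f|^2 thus controls both
  f on the small disc and f/(z - \<xi>) outside it, and the Poisson extension of \<mu> that it
  produces cancels the one in the hypothesis. The Lebesgue point condition is available only within
  a fixed radius \<epsilon>, and f is not small beyond it. There the quotient is a fixed square
  integrable function, so a tail of its coefficients is small; this compensates a kernel sum for
  which only order n^2 is used. For the second statement one Vitali maximal inequality serves three
  purposes: linear upper bounds for discs under \<mu>, the same under |log w| dm (and from it, by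
  Jensen, linear lower bounds under \<mu>), and sublinear growth at points of null sets. Lebesgue
  points then come without a separate differentiation theorem for \<mu>.\<close>

lemma borel_measurable_cnj [measurable (raw)]:
  "f \<in> borel_measurable M \<Longrightarrow> (\<lambda>x. cnj (f x)) \<in> borel_measurable M"
  by (rule measurable_compose[of f M borel cnj])
     (auto intro!: borel_measurable_continuous_onI continuous_intros)

lemma norm_add_sq_le: "(norm (a + b))\<^sup>2 \<le> 2 * (norm a)\<^sup>2 + 2 * (norm b)\<^sup>2"
  for a b :: "'a::real_normed_vector"
proof -
  have "(norm (a + b))\<^sup>2 \<le> (norm a + norm b)\<^sup>2"
    by (intro power_mono norm_triangle_ineq) auto
  also have "\<dots> \<le> 2 * (norm a)\<^sup>2 + 2 * (norm b)\<^sup>2"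
    using sum_squares_bound[of "norm a" "norm b"] by (simp add: power2_sum)
  finally show ?thesis .
qed

lemma L2_fun_add:
  assumes "L2_fun M f" "L2_fun M g"
  shows "L2_fun M (\<lambda>x. f x + g x)"
proof -
  have [measurable]: "f \<in> borel_measurable M" "g \<in> borel_measurable M"
    using assms by (auto simp: L2_fun_def)
  have "integrable M (\<lambda>x. (norm (f x + g x))\<^sup>2)"
    by (rule Bochner_Integration.integrable_bound
        [of M "\<lambda>x. 2 * (norm (f x))\<^sup>2 + 2 * (norm (g x))\<^sup>2"])
       (use assms in \<open>auto simp: L2_fun_def norm_add_sq_le\<close>)
  then show ?thesis by (simp add: L2_fun_def)
qed

lemma L2_fun_cmult: "L2_fun M f \<Longrightarrow> L2_fun M (\<lambda>x. c * f x)"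
  by (auto simp: L2_fun_def norm_mult power_mult_distrib)

lemma L2_fun_zero: "L2_fun M (\<lambda>x. 0)"
  by (auto simp: L2_fun_def)

lemma L2_fun_diff:
  assumes "L2_fun M f" "L2_fun M g"
  shows "L2_fun M (\<lambda>x. f x - g x)"
  using L2_fun_add[OF assms(1) L2_fun_cmult[OF assms(2), of "-1"]] by simp

lemma L2_fun_sum:
  "(\<And>i. i \<in> I \<Longrightarrow> L2_fun M (f i)) \<Longrightarrow> L2_fun M (\<lambda>x. \<Sum>i\<in>I. f i x)"
  by (induction I rule: infinite_finite_induct) (auto intro: L2_fun_add L2_fun_zero)

lemma L2_fun_bound:
  assumes "L2_fun M f" "g \<in> borel_measurable M" "AE x in M. norm (g x) \<le> C * norm (f x)"
  shows "L2_fun M g"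
proof -
  have [measurable]: "f \<in> borel_measurable M" "g \<in> borel_measurable M"
    using assms by (auto simp: L2_fun_def)
  have "integrable M (\<lambda>x. C\<^sup>2 * (norm (f x))\<^sup>2)"
    using assms(1) by (auto simp: L2_fun_def)
  moreover have "AE x in M. norm ((norm (g x))\<^sup>2) \<le> norm (C\<^sup>2 * (norm (f x))\<^sup>2)"
    using assms(3)
    by eventually_elim (use power_mono[OF _ norm_ge_zero, of _ _ 2] in \<open>force simp: power_mult_distrib\<close>)
  ultimately have "integrable M (\<lambda>x. (norm (g x))\<^sup>2)"
    using Bochner_Integration.integrable_bound[of M "\<lambda>x. C\<^sup>2 * (norm (f x))\<^sup>2" "\<lambda>x. (norm (g x))\<^sup>2"] by auto
  then show ?thesis by (simp add: L2_fun_def)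
qed

lemma two_mult_norm_le: "2 * norm (a * cnj b) \<le> (norm a)\<^sup>2 + (norm b)\<^sup>2"
  using sum_squares_bound[of "norm a" "norm b"] by (simp add: norm_mult)

lemma L2_inner_integrable:
  assumes "L2_fun M f" "L2_fun M g"
  shows "integrable M (\<lambda>x. f x * cnj (g x))"
proof -
  have [measurable]: "f \<in> borel_measurable M" "g \<in> borel_measurable M"
    using assms by (auto simp: L2_fun_def)
  show ?thesis
  proof (rule Bochner_Integration.integrable_bound)
    show "integrable M (\<lambda>x. (norm (f x))\<^sup>2 + (norm (g x))\<^sup>2)"
      using assms by (auto simp: L2_fun_def)
    have "norm (f x * cnj (g x)) \<le> (norm (f x))\<^sup>2 + (norm (g x))\<^sup>2" for x
      using two_mult_norm_le[of "f x" "g x"] norm_ge_zero[of "f x * cnj (g x)"] by linarith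
    then show "AE x in M. norm (f x * cnj (g x)) \<le> norm ((norm (f x))\<^sup>2 + (norm (g x))\<^sup>2)"
      by (auto intro!: AE_I2)
  qed measurable
qed

lemma L2_inner_commute: "L2_inner M f g = cnj (L2_inner M g f)"
  unfolding L2_inner_def Bochner_Integration.integral_cnj[symmetric] by (simp add: mult.commute)

lemma L2_inner_add_left:
  assumes "L2_fun M f" "L2_fun M g" "L2_fun M h"
  shows "L2_inner M (\<lambda>x. f x + g x) h = L2_inner M f h + L2_inner M g h"
  using assms by (simp add: L2_inner_def distrib_right L2_inner_integrable)

lemma L2_inner_diff_left:
  assumes "L2_fun M f" "L2_fun M g" "L2_fun M h"
  shows "L2_inner M (\<lambda>x. f x - g x) h = L2_inner M f h - L2_inner M g h"
  using assms by (simp add: L2_inner_def left_diff_distrib L2_inner_integrable)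

lemma L2_inner_cmult_left: "L2_inner M (\<lambda>x. c * f x) g = c * L2_inner M f g"
  by (simp add: L2_inner_def mult.assoc)

lemma L2_inner_sum_left:
  assumes "\<And>i. i \<in> I \<Longrightarrow> L2_fun M (f i)" "L2_fun M g"
  shows "L2_inner M (\<lambda>x. \<Sum>i\<in>I. f i x) g = (\<Sum>i\<in>I. L2_inner M (f i) g)"
  using assms by (simp add: L2_inner_def sum_distrib_right L2_inner_integrable)

lemma L2_inner_lincomb_left:
  assumes "\<And>i. i \<in> I \<Longrightarrow> L2_fun M (f i)" "L2_fun M g"
  shows "L2_inner M (\<lambda>x. \<Sum>i\<in>I. c i * f i x) g = (\<Sum>i\<in>I. c i * L2_inner M (f i) g)"
  by (simp add: L2_inner_sum_left L2_inner_cmult_left L2_fun_cmult assms)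

lemma L2_inner_lincomb_right:
  assumes "\<And>i. i \<in> I \<Longrightarrow> L2_fun M (f i)" "L2_fun M g"
  shows "L2_inner M g (\<lambda>x. \<Sum>i\<in>I. c i * f i x) = (\<Sum>i\<in>I. cnj (c i) * L2_inner M g (f i))"
  by (subst L2_inner_commute, subst L2_inner_lincomb_left[OF assms])
     (auto intro!: sum.cong simp: L2_inner_commute[of M g])

lemma L2_inner_cong_AE:
  assumes "f \<in> borel_measurable M" "g \<in> borel_measurable M" "f' \<in> borel_measurable M"
    "g' \<in> borel_measurable M" "AE x in M. f x = f' x" "AE x in M. g x = g' x"
  shows "L2_inner M f g = L2_inner M f' g'"
  unfolding L2_inner_def
  by (rule integral_cong_AE) (use assms in auto)

lemma L2_inner_self: "L2_inner M f f = of_real (LINT x|M. (norm (f x))\<^sup>2)"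
  unfolding L2_inner_def
  by (simp add: complex_norm_square[symmetric] flip: of_real_power)

lemma L2_nrm_sq: "(L2_nrm M f)\<^sup>2 = (LINT x|M. (norm (f x))\<^sup>2)"
  unfolding L2_nrm_def by (rule real_sqrt_pow2) simp

text \<open>Integrating 2|ab| \<le> |a|^2 + |b|^2 stands in for Cauchy-Schwarz: for two functions of
  norm one it gives the same bound, and this is the case needed for the entries of
  \<open>cmv_matrix\<close>.\<close>

lemma two_norm_L2_inner_le:
  assumes "L2_fun M f" "L2_fun M g"
  shows "2 * norm (L2_inner M f g) \<le> (LINT x|M. (norm (f x))\<^sup>2) + (LINT x|M. (norm (g x))\<^sup>2)"
proof -
  have "2 * norm (L2_inner M f g) \<le> 2 * (LINT x|M. norm (f x * cnj (g x)))"
    unfolding L2_inner_def by (simp add: integral_norm_bound)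
  also have "\<dots> = (LINT x|M. 2 * norm (f x * cnj (g x)))"
    by simp
  also have "\<dots> \<le> (LINT x|M. (norm (f x))\<^sup>2 + (norm (g x))\<^sup>2)"
    using L2_inner_integrable[OF assms] assms two_mult_norm_le
    by (intro integral_mono) (auto simp: L2_fun_def)
  also have "\<dots> = (LINT x|M. (norm (f x))\<^sup>2) + (LINT x|M. (norm (g x))\<^sup>2)"
    using assms by (auto simp: L2_fun_def)
  finally show ?thesis .
qed


text \<open>Agreement is pointwise on a set: reductions such as \<open>z * cnj z = 1\<close> hold on
  the circle only, and almost everywhere equality would lose the values at a \<mu>-null point
  \<xi>.\<close>

definition lin_combs :: "'a set \<Rightarrow> (nat \<Rightarrow> 'a \<Rightarrow> complex) \<Rightarrow> nat \<Rightarrow> ('a \<Rightarrow> complex) set" where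
  "lin_combs S h n = {f. \<exists>c. \<forall>x\<in>S. f x = (\<Sum>j<n. c j * h j x)}"

lemma lin_combsI: "(\<And>x. x \<in> S \<Longrightarrow> f x = (\<Sum>j<n. c j * h j x)) \<Longrightarrow> f \<in> lin_combs S h n"
  by (auto simp: lin_combs_def)

lemma lin_combs_mono: 
  assumes "f \<in> lin_combs S h n" "n \<le> m" shows "f \<in> lin_combs S h m"
proof -
  obtain c where c: "\<And>x. x \<in> S \<Longrightarrow> f x = (\<Sum>j<n. c j * h j x)"
    using assms by (auto simp: lin_combs_def)
  show ?thesis
  proof (rule lin_combsI[where c = "\<lambda>j. if j < n then c j else 0"])
    fix x assume "x \<in> S"
    then show "f x = (\<Sum>j<m. (if j < n then c j else 0) * h j x)"
      unfolding c[OF \<open>x \<in> S\<close>] using assms(2)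
      by (intro sum.mono_neutral_cong_left) auto
  qed
qed

lemma lin_combs_subset: "f \<in> lin_combs T h n \<Longrightarrow> S \<subseteq> T \<Longrightarrow> f \<in> lin_combs S h n"
  by (auto simp: lin_combs_def)

lemma lin_combs_base: "i < n \<Longrightarrow> h i \<in> lin_combs S h n"
  by (rule lin_combsI[where c = "\<lambda>j. if j = i then 1 else 0"])
     (simp add: if_distrib[of "\<lambda>a. a * _"] sum.delta cong: if_cong)

lemma lin_combs_add:
  assumes "f \<in> lin_combs S h n" "g \<in> lin_combs S h n"
  shows "(\<lambda>x. f x + g x) \<in> lin_combs S h n"
proof -
  obtain c d where "\<And>x. x \<in> S \<Longrightarrow> f x = (\<Sum>j<n. c j * h j x)" 
      "\<And>x. x \<in> S \<Longrightarrow> g x = (\<Sum>j<n. d j * h j x)"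
    using assms by (auto simp: lin_combs_def)
  then show ?thesis
    by (intro lin_combsI[where c = "\<lambda>j. c j + d j"]) (simp add: sum.distrib distrib_right)
qed

lemma lin_combs_cmult:
  assumes "f \<in> lin_combs S h n"
  shows "(\<lambda>x. a * f x) \<in> lin_combs S h n"
proof -
  obtain c where "\<And>x. x \<in> S \<Longrightarrow> f x = (\<Sum>j<n. c j * h j x)" 
    using assms by (auto simp: lin_combs_def)
  then show ?thesis
    by (intro lin_combsI[where c = "\<lambda>j. a * c j"]) (simp add: sum_distrib_left mult.assoc)
qed

lemma lin_combs_cong: "f \<in> lin_combs S h n \<Longrightarrow> (\<And>x. x \<in> S \<Longrightarrow> g x = f x) \<Longrightarrow> g \<in> lin_combs S h n"
  by (auto simp: lin_combs_def)

lemma lin_combs_sum: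
  "(\<And>i. i \<in> I \<Longrightarrow> f i \<in> lin_combs S h n) \<Longrightarrow> (\<lambda>x. \<Sum>i\<in>I. a i * f i x) \<in> lin_combs S h n"
  by (induction I rule: infinite_finite_induct)
     (auto intro!: lin_combs_add lin_combs_cmult intro: lin_combsI[where c = "\<lambda>_. 0"])

section \<open>Orthonormal systems, Bessel inequality and finite expansions\<close>

locale orthonormal_seq =
  fixes M :: "'a measure" and \<psi> :: "nat \<Rightarrow> 'a \<Rightarrow> complex"
  assumes L2_basis: "L2_fun M (\<psi> n)"
    and orthonormal: "L2_inner M (\<psi> i) (\<psi> j) = (if i = j then 1 else 0)"
begin

lemma sq_norm_basis: "(LINT x|M. (norm (\<psi> i x))\<^sup>2) = 1"
  using orthonormal[of i i] unfolding L2_inner_self by simp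

lemma L2_fun_lincomb: "L2_fun M (\<lambda>x. \<Sum>j<n. c j * \<psi> j x)"
  by (intro L2_fun_sum L2_fun_cmult L2_basis)

lemma coeff_lincomb: "L2_inner M (\<lambda>x. \<Sum>j<n. c j * \<psi> j x) (\<psi> i) = (if i < n then c i else 0)"
  by (simp add: L2_inner_lincomb_left L2_basis orthonormal if_distrib sum.delta cong: if_cong)

lemma sq_norm_lincomb:
  "(LINT x|M. (norm (\<Sum>j<n. c j * \<psi> j x))\<^sup>2) = (\<Sum>j<n. (norm (c j))\<^sup>2)"
proof -
  have "complex_of_real (LINT x|M. (norm (\<Sum>j<n. c j * \<psi> j x))\<^sup>2) =
      L2_inner M (\<lambda>x. \<Sum>j<n. c j * \<psi> j x) (\<lambda>x. \<Sum>j<n. c j * \<psi> j x)"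
    by (rule L2_inner_self[symmetric])
  also have "\<dots> = (\<Sum>i<n. cnj (c i) * (if i < n then c i else 0))"
    by (subst L2_inner_lincomb_right)
       (simp_all add: L2_basis L2_fun_lincomb coeff_lincomb del: mult_if_delta)
  also have "\<dots> = of_real (\<Sum>j<n. (norm (c j))\<^sup>2)"
    by (simp add: mult.commute complex_norm_square flip: of_real_power)
  finally show ?thesis by (simp only: of_real_eq_iff)
qed

text \<open>With g the partial sum over j < n, the integral of |f - g|^2 equals the integral of
  |f|^2 minus the coefficient sum, and it is nonnegative.\<close>

lemma Bessel:
  assumes "L2_fun M f"
  shows "(\<Sum>j<n. (norm (L2_inner M f (\<psi> j)))\<^sup>2) \<le> (LINT x|M. (norm (f x))\<^sup>2)"
proof -
  define c where "c j = L2_inner M f (\<psi> j)" for j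
  define g where "g x = (\<Sum>j<n. c j * \<psi> j x)" for x
  define s where "s = (\<Sum>j<n. (norm (c j))\<^sup>2)"
  have g: "L2_fun M g" unfolding g_def by (rule L2_fun_lincomb)
  have fg: "L2_inner M f g = of_real s"
    unfolding g_def s_def
    by (subst L2_inner_lincomb_right)
       (simp_all add: L2_basis assms c_def[symmetric] mult.commute complex_norm_square flip: of_real_power)
  have gf: "L2_inner M g f = of_real s"
    by (subst L2_inner_commute) (simp add: fg)
  have gg: "L2_inner M g g = of_real s"
    unfolding L2_inner_self unfolding g_def s_def sq_norm_lincomb ..
  have fgL: "L2_fun M (\<lambda>x. f x - g x)"
    by (rule L2_fun_diff[OF assms g])
  have "complex_of_real (LINT x|M. (norm (f x - g x))\<^sup>2) = L2_inner M (\<lambda>x. f x - g x) (\<lambda>x. f x - g x)"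
    by (rule L2_inner_self[symmetric])
  also have "\<dots> = L2_inner M f (\<lambda>x. f x - g x) - L2_inner M g (\<lambda>x. f x - g x)"
    by (rule L2_inner_diff_left[OF assms g fgL])
  also have "\<dots> = cnj (L2_inner M f f - L2_inner M g f) - cnj (L2_inner M f g - L2_inner M g g)"
    by (subst (1 2) L2_inner_commute) (simp only: L2_inner_diff_left[OF assms g] assms g)
  also have "\<dots> = complex_of_real ((LINT x|M. (norm (f x))\<^sup>2) - s)"
    unfolding fg gf gg by (simp add: L2_inner_self)
  finally have "(LINT x|M. (norm (f x - g x))\<^sup>2) = (LINT x|M. (norm (f x))\<^sup>2) - s"
    by (simp only: of_real_eq_iff)
  moreover have "(LINT x|M. (norm (f x - g x))\<^sup>2) \<ge> 0" by simp
  ultimately show ?thesis by (simp add: s_def c_def)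
qed

text \<open>Coefficients computed by integration see f only almost everywhere, yet they reproduce it
  at every point of S, because they coincide with those of the given pointwise combination.\<close>

lemma lin_combs_expansion:
  assumes "f \<in> lin_combs S \<psi> n" "AE x in M. x \<in> S" "f \<in> borel_measurable M" "x \<in> S"
  shows "f x = (\<Sum>j<n. L2_inner M f (\<psi> j) * \<psi> j x)"
    and "j \<ge> n \<Longrightarrow> L2_inner M f (\<psi> j) = 0"
proof -
  obtain c where c: "\<And>x. x \<in> S \<Longrightarrow> f x = (\<Sum>j<n. c j * \<psi> j x)" 
    using assms by (auto simp: lin_combs_def)
  have *: "L2_inner M f (\<psi> j) = (if j < n then c j else 0)" for j
  proof -
    have "L2_inner M f (\<psi> j) = L2_inner M (\<lambda>x. \<Sum>j<n. c j * \<psi> j x) (\<psi> j)"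
      by (rule L2_inner_cong_AE)
         (use assms L2_fun_lincomb L2_basis c in \<open>auto simp: L2_fun_def\<close>)
    then show ?thesis by (simp add: coeff_lincomb)
  qed
  show "f x = (\<Sum>j<n. L2_inner M f (\<psi> j) * \<psi> j x)"
    by (simp add: * c[OF \<open>x \<in> S\<close>])
  show "j \<ge> n \<Longrightarrow> L2_inner M f (\<psi> j) = 0" by (simp add: *)
qed

end

section \<open>Gram-Schmidt orthogonalization\<close>

text \<open>Independence is imposed modulo null functions: the seminorm of each
  \<open>residual\<close> is a divisor in the recursion and has to be nonzero.\<close>

locale gram_schmidt =
  fixes M :: "'a measure" and h :: "nat \<Rightarrow> 'a \<Rightarrow> complex"
  assumes L2_h: "L2_fun M (h n)"
    and independent: "L2_nrm M (\<lambda>x. h n x - (\<Sum>j<n. c j * h j x)) \<noteq> 0"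
begin

abbreviation "\<psi> \<equiv> gram_schmidt_fun M h"

definition residual :: "nat \<Rightarrow> 'a \<Rightarrow> complex" where
  "residual n x = h n x - (\<Sum>j<n. L2_inner M (h n) (\<psi> j) * \<psi> j x)"

lemma gram_schmidt_rec: "\<psi> n x = (1 / of_real (L2_nrm M (residual n))) * residual n x"
  by (subst gram_schmidt_fun.simps) (simp add: residual_def[abs_def] Let_def)

lemma basis_in_lin_combs: "\<psi> n \<in> lin_combs UNIV h (Suc n)"
proof (induction n rule: less_induct)
  case (less n)
  have "(\<lambda>x. \<Sum>j<n. L2_inner M (h n) (\<psi> j) * \<psi> j x) \<in> lin_combs UNIV h (Suc n)"
    by (intro lin_combs_sum) (use less lin_combs_mono[OF less] in auto)
  then have "(\<lambda>x. (-1) * (\<Sum>j<n. L2_inner M (h n) (\<psi> j) * \<psi> j x)) \<in> lin_combs UNIV h (Suc n)"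
    by (rule lin_combs_cmult)
  then have "(\<lambda>x. h n x + (-1) * (\<Sum>j<n. L2_inner M (h n) (\<psi> j) * \<psi> j x)) \<in> lin_combs UNIV h (Suc n)"
    by (intro lin_combs_add lin_combs_base) auto
  then have "residual n \<in> lin_combs UNIV h (Suc n)"
    by (simp add: residual_def[abs_def])
  then show ?case
    by (subst gram_schmidt_rec[abs_def]) (rule lin_combs_cmult)
qed

lemma L2_gram_schmidt: "L2_fun M (\<psi> n)"
proof -
  obtain c where "\<And>x. \<psi> n x = (\<Sum>j<Suc n. c j * h j x)"
    using basis_in_lin_combs[of n] by (auto simp: lin_combs_def)
  then have "\<psi> n = (\<lambda>x. \<Sum>j<Suc n. c j * h j x)" by auto
  then show ?thesis
    by (auto intro!: L2_fun_sum L2_fun_cmult L2_h simp del: sum.lessThan_Suc)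
qed

lemma residual_nonzero: "L2_nrm M (residual n) \<noteq> 0"
proof -
  have "(\<lambda>x. \<Sum>j<n. L2_inner M (h n) (\<psi> j) * \<psi> j x) \<in> lin_combs UNIV h n"
    by (intro lin_combs_sum) (use lin_combs_mono[OF basis_in_lin_combs] in auto)
  then obtain c where c: "\<And>x. (\<Sum>j<n. L2_inner M (h n) (\<psi> j) * \<psi> j x) = (\<Sum>j<n. c j * h j x)"
    by (auto simp: lin_combs_def)
  show ?thesis
    unfolding residual_def[abs_def] c by (rule independent)
qed

lemma harmonic_in_lin_combs: "h n \<in> lin_combs UNIV \<psi> (Suc n)"
proof (rule lin_combsI)
  fix x
  show "h n x = (\<Sum>j<Suc n. (if j = n then of_real (L2_nrm M (residual n)) else L2_inner M (h n) (\<psi> j)) * \<psi> j x)"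
    using residual_nonzero[of n] by (simp add: gram_schmidt_rec[of n]) (simp add: residual_def)
qed

text \<open>Strong induction: orthogonality of the n-th residual to an earlier function needs the
  orthonormality of all earlier pairs; conjugation supplies the pairs in the other order.\<close>

lemma gram_schmidt_orthonormal:
  "(\<forall>j<n. L2_inner M (\<psi> n) (\<psi> j) = 0) \<and> L2_inner M (\<psi> n) (\<psi> n) = 1"
proof (induction n rule: less_induct)
  case (less n)
  have *: "L2_inner M (\<psi> i) (\<psi> j) = (if i = j then 1 else 0)" if "i < n" "j < n" for i j
  proof (cases i j rule: linorder_cases)
    case less
    have "L2_inner M (\<psi> i) (\<psi> j) = cnj (L2_inner M (\<psi> j) (\<psi> i))"
      by (rule L2_inner_commute)
    then show ?thesis using less.IH[OF \<open>j < n\<close>] less by simp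
  qed (use less.IH that in auto)
  have "L2_inner M (residual n) (\<psi> j) = 0" if "j < n" for j
    unfolding residual_def[abs_def]
    by (subst L2_inner_diff_left)
       (simp_all add: L2_h L2_gram_schmidt L2_fun_sum L2_fun_cmult L2_inner_lincomb_left * that
          if_distrib sum.delta cong: if_cong)
  moreover have "L2_inner M (\<psi> n) (\<psi> n) = 1"
  proof -
    have "(norm (\<psi> n x))\<^sup>2 = (norm (residual n x))\<^sup>2 / (L2_nrm M (residual n))\<^sup>2" for x
      by (simp add: gram_schmidt_rec[of n] norm_divide power_divide)
    then show ?thesis
      using residual_nonzero[of n] unfolding L2_inner_self by (simp flip: L2_nrm_sq)
  qed
  moreover have "L2_inner M (\<psi> n) (\<psi> j) = 
      (1 / of_real (L2_nrm M (residual n))) * L2_inner M (residual n) (\<psi> j)" for j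
    by (subst gram_schmidt_rec[of n, abs_def]) (rule L2_inner_cmult_left)
  ultimately show ?case by simp
qed

sublocale orthonormal_seq M \<psi>
proof
  show "L2_fun M (\<psi> n)" for n by (rule L2_gram_schmidt)
  show "L2_inner M (\<psi> i) (\<psi> j) = (if i = j then 1 else 0)" for i j
    using gram_schmidt_orthonormal[of i] gram_schmidt_orthonormal[of j] L2_inner_commute[of M "\<psi> i" "\<psi> j"]
    by (cases i j rule: linorder_cases) auto
qed

end

section \<open>The CMV basis\<close>

text \<open>Multiplication by z^m with m = n div 2 turns the harmonics of index at most n into the
  monomials 1, ..., z^n in another order; this is the exponent that index j receives. Questions on
  the CMV span become questions on polynomials of degree at most n.\<close>

definition cmv_exponent :: "nat \<Rightarrow> nat \<Rightarrow> nat" where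
  "cmv_exponent m j = (if even j then m - j div 2 else m + Suc (j div 2))"

definition cmv_poly :: "nat \<Rightarrow> (nat \<Rightarrow> complex) \<Rightarrow> complex poly" where
  "cmv_poly n c = (\<Sum>j\<le>n. monom (c j) (cmv_exponent (n div 2) j))"

lemma unit_circle_cnj: "norm z = 1 \<Longrightarrow> z * cnj z = 1"
  by (simp add: complex_norm_square[symmetric])

lemma power_mult_cmv_harmonic:
  assumes "norm z = 1" "j \<le> n"
  shows "z ^ (n div 2) * cmv_harmonic j z = z ^ cmv_exponent (n div 2) j"
proof (cases "even j")
  case True
  have "z ^ (n div 2) = z ^ (n div 2 - j div 2) * z ^ (j div 2)"
    using assms by (subst power_add[symmetric]) (simp add: div_le_mono)
  then show ?thesis
    using True unit_circle_cnj[OF assms(1)]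
    by (simp add: cmv_harmonic_def cmv_exponent_def mult.assoc flip: power_mult_distrib)
next
  case False
  then show ?thesis
    by (simp add: cmv_harmonic_def cmv_exponent_def power_add)
qed

lemma poly_cmv_poly:
  "norm z = 1 \<Longrightarrow> poly (cmv_poly n c) z = z ^ (n div 2) * (\<Sum>j\<le>n. c j * cmv_harmonic j z)"
  by (auto simp: cmv_poly_def poly_sum poly_monom sum_distrib_left mult.left_commute[of _ "c _"]
        power_mult_cmv_harmonic intro!: sum.cong)

lemma degree_cmv_poly: "degree (cmv_poly n c) \<le> n"
  unfolding cmv_poly_def
proof (rule degree_sum_le)
  fix j assume "j \<in> {..n}"
  moreover from this have "cmv_exponent (n div 2) j \<le> n"
    unfolding cmv_exponent_def by (auto elim!: oddE)
  ultimately show "degree (monom (c j) (cmv_exponent (n div 2) j)) \<le> n"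
    using degree_monom_le order_trans by blast
qed auto

text \<open>Comparison with the last index is enough: it identifies \<open>c n\<close> as a
  coefficient of \<open>cmv_poly n c\<close>, which is therefore nonzero when \<open>c n\<close>
  is.\<close>

lemma cmv_exponent_inj:
  assumes "j \<le> n" "cmv_exponent (n div 2) j = cmv_exponent (n div 2) n"
  shows "j = n"
  using assms unfolding cmv_exponent_def
  by (auto split: if_splits elim!: oddE evenE)

lemma coeff_cmv_poly: "coeff (cmv_poly n c) (cmv_exponent (n div 2) n) = c n"
proof -
  have "coeff (cmv_poly n c) (cmv_exponent (n div 2) n) = 
      (\<Sum>j\<le>n. if j = n then c j else 0)"
    unfolding cmv_poly_def coeff_sum
    by (intro sum.cong) (use cmv_exponent_inj in \<open>auto\<close>)
  then show ?thesis by simp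
qed

lemma norm_cmv_harmonic: "norm z = 1 \<Longrightarrow> norm (cmv_harmonic n z) = 1"
  by (simp add: cmv_harmonic_def norm_power norm_mult)

lemma continuous_cmv_harmonic: "continuous_on A (cmv_harmonic n)"
  unfolding cmv_harmonic_def by (cases "even n") (auto intro!: continuous_intros)

text \<open>In terms of exponents: z^(-k) with k > 0 moves from index 2k to 2k - 2, the constant
  from 0 to 1, and z^(k+1) from 2k + 1 to 2k + 3. The largest shift is 2, the origin of the
  bandwidth.\<close>

lemma circle_mult_cmv_harmonic: "\<exists>j\<le>i + 2. \<forall>z\<in>sphere 0 1. z * cmv_harmonic i z = cmv_harmonic j z"
proof (cases "even i")
  case True
  then obtain k where k: "i = 2 * k" by (elim evenE)
  show ?thesis
  proof (cases k)
    case 0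
    then show ?thesis using k by (auto intro!: exI[of _ 1] simp: cmv_harmonic_def)
  next
    case (Suc l)
    then show ?thesis using k
      by (auto intro!: exI[of _ "2 * l"] simp: cmv_harmonic_def unit_circle_cnj simp flip: mult.assoc)
  qed
next
  case False
  then show ?thesis
    by (intro exI[of _ "i + 2"]) (auto simp: cmv_harmonic_def)
qed

lemma circle_cnj_mult_cmv_harmonic:
  "\<exists>j\<le>i + 2. \<forall>z\<in>sphere 0 1. cnj z * cmv_harmonic i z = cmv_harmonic j z"
proof (cases "even i")
  case True
  then show ?thesis
    by (intro exI[of _ "i + 2"]) (auto simp: cmv_harmonic_def)
next
  case False
  then obtain k where k: "i = Suc (2 * k)" by (elim oddE) auto
  have *: "cnj z * z = 1" if "cmod z = 1" for z
    using unit_circle_cnj[OF that] by (simp add: mult.commute)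
  show ?thesis
  proof (cases k)
    case 0
    then show ?thesis using k by (auto intro!: exI[of _ 0] simp: cmv_harmonic_def *)
  next
    case (Suc l)
    then show ?thesis using k
      by (auto intro!: exI[of _ "Suc (2 * l)"] simp: cmv_harmonic_def * simp flip: mult.assoc)
  qed
qed

lemma L2_fun_bounded:
  assumes "prob_space M" "f \<in> borel_measurable M" "AE x in M. norm (f x) \<le> B"
  shows "L2_fun M f"
proof -
  interpret prob_space M by fact
  have "L2_fun M (\<lambda>x. 1)" by (auto simp: L2_fun_def)
  from L2_fun_bound[OF this assms(2), of B] show ?thesis using assms(3) by simp
qed

locale cmv_measure =
  fixes \<mu> :: "complex measure"
  assumes circle_prob: "circle_prob \<mu>" and infinite_support: "infinite (msupport \<mu>)"
begin

lemma prob_space_mu: "prob_space \<mu>"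
  and sets_mu [measurable_cong, simp]: "sets \<mu> = sets borel"
  using circle_prob by (auto simp: circle_prob_def)

sublocale prob_space \<mu> by (rule prob_space_mu)

lemma space_mu [simp]: "space \<mu> = UNIV"
  using sets_eq_imp_space_eq[OF sets_mu] by simp

lemma AE_circle: "AE z in \<mu>. z \<in> sphere 0 1"
  by (rule AE_I[of _ _ "- sphere 0 1"]) (use circle_prob in \<open>auto simp: circle_prob_def\<close>)

lemma msupport_eqI:
  assumes "AE z in \<mu>. z \<in> C" "closed C"
  shows "msupport \<mu> \<subseteq> C"
proof
  fix p assume p: "p \<in> msupport \<mu>"
  show "p \<in> C"
  proof (rule ccontr)
    assume "p \<notin> C"
    then obtain e where e: "e > 0" "ball p e \<subseteq> - C"
      using assms(2) open_contains_ball[of "-C"] by (auto simp: closed_def)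
    have "AE z in \<mu>. z \<notin> ball p e"
      using assms(1) by eventually_elim (use e in auto)
    then have "emeasure \<mu> (ball p e) = 0"
      by (subst (asm) AE_iff_measurable[of "ball p e"]) auto
    with p e show False by (auto simp: msupport_def)
  qed
qed

lemma L2_harmonic: "L2_fun \<mu> (cmv_harmonic n)"
proof (rule L2_fun_bounded[where B = 1])
  show "cmv_harmonic n \<in> borel_measurable \<mu>"
    using borel_measurable_continuous_onI[OF continuous_cmv_harmonic] by (simp cong: measurable_cong_sets)
  show "AE x in \<mu>. cmod (cmv_harmonic n x) \<le> 1"
    using AE_circle by eventually_elim (auto simp: norm_cmv_harmonic)
qed (rule prob_space_mu)

text \<open>The root set is finite and closed, so a nonzero polynomial vanishing almost everywhere
  would confine the infinite support to it.\<close>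

lemma poly_not_AE_zero: assumes "Q \<noteq> 0" shows "\<not> (AE z in \<mu>. poly Q z = 0)"
proof
  assume "AE z in \<mu>. poly Q z = 0"
  then have "msupport \<mu> \<subseteq> {z. poly Q z = 0}"
    using poly_roots_finite[OF assms] by (intro msupport_eqI) (auto intro: finite_imp_closed)
  with poly_roots_finite[OF assms] infinite_support show False
    using finite_subset by blast
qed

text \<open>Multiplied by z^(n div 2), a null combination becomes a polynomial that vanishes
  \<mu>-almost everywhere although one of its coefficients is 1.\<close>

lemma harmonics_independent:
  "L2_nrm \<mu> (\<lambda>x. cmv_harmonic n x - (\<Sum>j<n. c j * cmv_harmonic j x)) \<noteq> 0"
proof
  let ?g = "\<lambda>x. cmv_harmonic n x - (\<Sum>j<n. c j * cmv_harmonic j x)"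
  define d where "d j = (if j = n then 1 else - c j)" for j
  assume "L2_nrm \<mu> ?g = 0"
  then have "(LINT x|\<mu>. (norm (?g x))\<^sup>2) = 0"
    using L2_nrm_sq[of \<mu> ?g] by simp
  moreover have "L2_fun \<mu> ?g"
    by (intro L2_fun_diff L2_fun_sum L2_fun_cmult L2_harmonic)
  ultimately have *: "AE x in \<mu>. ?g x = 0"
    by (subst (asm) integral_nonneg_eq_0_iff_AE) (auto simp: L2_fun_def)
  have "AE x in \<mu>. poly (cmv_poly n d) x = 0"
    using AE_circle *
  proof eventually_elim
    case (elim x)
    have "(\<Sum>j\<le>n. d j * cmv_harmonic j x) = ?g x"
      by (simp add: d_def sum_negf lessThan_Suc_atMost[symmetric])
    then show ?case using elim by (simp add: poly_cmv_poly)
  qed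
  moreover have "cmv_poly n d \<noteq> 0"
    using coeff_cmv_poly[of n d] by (auto simp: d_def)
  ultimately show False using poly_not_AE_zero by blast
qed

sublocale gs: gram_schmidt \<mu> cmv_harmonic
  by standard (rule L2_harmonic harmonics_independent)+

abbreviation e :: "nat \<Rightarrow> complex \<Rightarrow> complex" where "e \<equiv> cmv_basis \<mu>"

sublocale orthonormal_seq \<mu> e
  unfolding cmv_basis_def by (rule gs.orthonormal_seq_axioms)

lemma basis_in_harmonics: "e n \<in> lin_combs S cmv_harmonic (Suc n)"
  unfolding cmv_basis_def by (rule lin_combs_subset[OF gs.basis_in_lin_combs]) auto

lemma harmonic_in_basis: "cmv_harmonic n \<in> lin_combs S e (Suc n)"
  unfolding cmv_basis_def by (rule lin_combs_subset[OF gs.harmonic_in_lin_combs]) auto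

lemma basis_meas [measurable]: "e n \<in> borel_measurable borel"
  using L2_basis[of n] by (simp add: L2_fun_def cong: measurable_cong_sets)

text \<open>Both changes of basis are triangular, so a shift of the harmonics by at most 2 remains a
  shift by at most 2 in the orthonormal basis.\<close>

lemma mult_in_lin_combs:
  assumes "\<And>i. \<exists>j\<le>i + 2. \<forall>z\<in>sphere 0 1. m z * cmv_harmonic i z = cmv_harmonic j z"
  shows "(\<lambda>z. m z * e i z) \<in> lin_combs (sphere 0 1) e (i + 3)"
proof -
  obtain c where c: "\<And>z. z \<in> sphere 0 1 \<Longrightarrow> e i z = (\<Sum>j<Suc i. c j * cmv_harmonic j z)"
    using basis_in_harmonics[of i "sphere 0 1"] by (auto simp: lin_combs_def)
  have "(\<lambda>z. \<Sum>j<Suc i. c j * (m z * cmv_harmonic j z)) \<in> lin_combs (sphere 0 1) e (i + 3)"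
  proof (rule lin_combs_sum)
    fix j assume j: "j \<in> {..<Suc i}"
    obtain l where "l \<le> j + 2" "\<forall>z\<in>sphere 0 1. m z * cmv_harmonic j z = cmv_harmonic l z"
      using assms by blast
    with j show "(\<lambda>z. m z * cmv_harmonic j z) \<in> lin_combs (sphere 0 1) e (i + 3)"
      by (intro lin_combs_cong[OF lin_combs_mono[OF harmonic_in_basis[of l]]]) auto
  qed
  then show ?thesis
    by (rule lin_combs_cong) (simp add: c sum_distrib_left mult_ac del: sum.lessThan_Suc)
qed

text \<open>The factor z^(n div 2) is unimodular on the circle, so extremal problems for CMV sums
  are extremal problems for polynomials.\<close>

lemma partial_sum_poly:
  obtains Q where "degree Q \<le> n" 
    "\<And>z. norm z = 1 \<Longrightarrow> norm (poly Q z) = norm (\<Sum>j\<le>n. c j * e j z)"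
proof -
  have "(\<lambda>z. \<Sum>j\<le>n. c j * e j z) \<in> lin_combs UNIV cmv_harmonic (Suc n)"
    by (rule lin_combs_sum) (use lin_combs_mono[OF basis_in_harmonics] in auto)
  then obtain d where "\<And>z. (\<Sum>j\<le>n. c j * e j z) = (\<Sum>j<Suc n. d j * cmv_harmonic j z)"
    by (auto simp: lin_combs_def)
  then show thesis
    using that[of "cmv_poly n d"]
    by (simp add: degree_cmv_poly poly_cmv_poly norm_mult norm_power lessThan_Suc_atMost del: sum.lessThan_Suc)
qed

lemma L2_circle_mult:
  assumes "L2_fun \<mu> f" "m \<in> borel_measurable borel" "\<And>z. norm z = 1 \<Longrightarrow> norm (m z) \<le> B"
  shows "L2_fun \<mu> (\<lambda>z. m z * f z)"
proof (rule L2_fun_bound[OF assms(1)])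
  have [measurable]: "f \<in> borel_measurable borel" "m \<in> borel_measurable borel"
    using assms by (auto simp: L2_fun_def cong: measurable_cong_sets)
  show "(\<lambda>z. m z * f z) \<in> borel_measurable \<mu>" by measurable
  show "AE x in \<mu>. cmod (m x * f x) \<le> B * cmod (f x)"
    using AE_circle by eventually_elim (auto simp: norm_mult assms intro!: mult_right_mono)
qed

section \<open>Multiplication by z as a five-diagonal matrix\<close>

text \<open>Row i holds the coefficients of z times \<open>e i\<close>, so this is the transpose of
  the usual matrix of the multiplication operator.\<close>

definition cmv_matrix :: "nat \<Rightarrow> nat \<Rightarrow> complex" where
  "cmv_matrix i j = L2_inner \<mu> (\<lambda>z. z * e i z) (e j)"

lemma L2_mult_id: "L2_fun \<mu> f \<Longrightarrow> L2_fun \<mu> (\<lambda>z. z * f z)"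
  by (rule L2_circle_mult[where B = 1]) auto

text \<open>Multiplication by \<open>cnj z\<close> is the adjoint of multiplication by z; its own
  shift by at most 2 yields the band on the other side of the diagonal.\<close>

lemma cmv_matrix_adjoint: "cmv_matrix i j = cnj (L2_inner \<mu> (\<lambda>z. cnj z * e j z) (e i))"
  unfolding cmv_matrix_def by (subst L2_inner_commute) (simp add: L2_inner_def mult_ac)

lemma norm_cmv_matrix_le: "norm (cmv_matrix i j) \<le> 1"
proof -
  have "(LINT z|\<mu>. (norm (z * e i z))\<^sup>2) = (LINT z|\<mu>. (norm (e i z))\<^sup>2)"
  proof (rule integral_cong_AE)
    show "AE z in \<mu>. (norm (z * e i z))\<^sup>2 = (norm (e i z))\<^sup>2"
      using AE_circle by eventually_elim (auto simp: norm_mult)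
  qed auto
  then show ?thesis
    using two_norm_L2_inner_le[OF L2_mult_id[OF L2_basis[of i]] L2_basis[of j]]
    unfolding cmv_matrix_def sq_norm_basis by simp
qed

lemma z_basis_in_lin_combs: "(\<lambda>z. z * e i z) \<in> lin_combs (sphere 0 1) e (i + 3)"
  by (rule mult_in_lin_combs) (rule circle_mult_cmv_harmonic)

lemma cnj_basis_in_lin_combs: "(\<lambda>z. cnj z * e i z) \<in> lin_combs (sphere 0 1) e (i + 3)"
  by (rule mult_in_lin_combs) (rule circle_cnj_mult_cmv_harmonic)

lemma cmv_matrix_band: "j \<ge> i + 3 \<or> i \<ge> j + 3 \<Longrightarrow> cmv_matrix i j = 0"
proof (elim disjE)
  assume "j \<ge> i + 3"
  then show ?thesis unfolding cmv_matrix_def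
    by (intro lin_combs_expansion(2)[OF z_basis_in_lin_combs AE_circle, where x = 1]) auto
next
  assume "i \<ge> j + 3"
  then have "L2_inner \<mu> (\<lambda>z. cnj z * e j z) (e i) = 0"
    by (intro lin_combs_expansion(2)[OF cnj_basis_in_lin_combs AE_circle, where x = 1]) auto
  then show ?thesis by (simp add: cmv_matrix_adjoint)
qed

text \<open>The values at \<xi> form a formal eigenvector, whether or not \<xi> carries mass.
  Leaving \<open>N\<close> free beyond the band allows rows of different index to be cut at the same
  place.\<close>

lemma cmv_matrix_eigenvector:
  assumes "norm \<xi> = 1" "N \<ge> i + 3"
  shows "\<xi> * e i \<xi> = (\<Sum>j<N. cmv_matrix i j * e j \<xi>)"
proof -
  have "\<xi> * e i \<xi> = (\<Sum>j<i+3. cmv_matrix i j * e j \<xi>)"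
    unfolding cmv_matrix_def
    by (intro lin_combs_expansion(1)[OF z_basis_in_lin_combs AE_circle]) (use assms in auto)
  also have "\<dots> = (\<Sum>j<N. cmv_matrix i j * e j \<xi>)"
    by (intro sum.mono_neutral_left) (use assms cmv_matrix_band in auto)
  finally show ?thesis .
qed

text \<open>Moving z to the other factor leaves a finite combination of basis functions, so the sum
  is finite and completeness of the basis is never invoked.\<close>

lemma coeff_mult_id:
  assumes F: "L2_fun \<mu> F" and "N \<ge> j + 3"
  shows "L2_inner \<mu> (\<lambda>z. z * F z) (e j) = (\<Sum>i<N. cmv_matrix i j * L2_inner \<mu> F (e i))"
proof -
  have meas [measurable]: "F \<in> borel_measurable borel"
    using F by (auto simp: L2_fun_def cong: measurable_cong_sets)
  have "L2_inner \<mu> (\<lambda>z. z * F z) (e j) = L2_inner \<mu> F (\<lambda>z. cnj z * e j z)"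
    by (simp add: L2_inner_def mult_ac)
  also have "\<dots> = L2_inner \<mu> F (\<lambda>z. \<Sum>i<j+3. L2_inner \<mu> (\<lambda>z. cnj z * e j z) (e i) * e i z)"
  proof (rule L2_inner_cong_AE)
    show "AE z in \<mu>. cnj z * e j z = (\<Sum>i<j+3. L2_inner \<mu> (\<lambda>z. cnj z * e j z) (e i) * e i z)"
      using AE_circle 
      by eventually_elim (intro lin_combs_expansion(1)[OF cnj_basis_in_lin_combs AE_circle], auto)
  qed auto
  also have "\<dots> = (\<Sum>i<j+3. cmv_matrix i j * L2_inner \<mu> F (e i))"
    by (subst L2_inner_lincomb_right) (simp_all add: L2_basis F cmv_matrix_adjoint)
  also have "\<dots> = (\<Sum>i<N. cmv_matrix i j * L2_inner \<mu> F (e i))"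
    by (intro sum.mono_neutral_left) (use assms cmv_matrix_band in auto)
  finally show ?thesis .
qed

text \<open>The partial sum is a commutator of the matrix with truncation at k: a sum over columns
  up to k minus a sum over rows up to k. The common square block cancels, and the band leaves two
  corners where one index lies in {k-1, k} and the other in {k+1, k+2}. For k = 0 truncated
  subtraction reduces the first pair to {0}.\<close>

lemma norm_partial_sum_commutator_le:
  assumes F: "L2_fun \<mu> F" and \<xi>: "norm \<xi> = 1"
  shows "norm (cmv_partial_sum \<mu> k (\<lambda>z. (z - \<xi>) * F z) \<xi>) \<le>
    (\<Sum>i=k-1..k+2. norm (L2_inner \<mu> F (e i))) * (\<Sum>i=k-1..k+2. norm (e i \<xi>))"
proof -
  define a where "a i = L2_inner \<mu> F (e i)" for i
  define u where "u i = e i \<xi>" for i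
  define A where "A i j = cmv_matrix i j * a i * u j" for i j
  \<comment> \<open>The cut k + 3 lies beyond the band of every row and column with index at most
    k.\<close>
  have split: "{..<k+3} = {..k} \<union> {k+1..k+2}" by auto
  have join: "(\<Sum>i=k-1..k. c i) + (\<Sum>i=k+1..k+2. c i) = (\<Sum>i=k-1..k+2. c i)" for c :: "nat \<Rightarrow> real"
  proof -
    have "{k-1..k+2} = {k-1..k} \<union> {k+1..k+2}" by auto
    then show ?thesis by (simp only:) (rule sum.union_disjoint[symmetric], auto)
  qed
  have "cmv_partial_sum \<mu> k (\<lambda>z. (z - \<xi>) * F z) \<xi>
      = (\<Sum>j\<le>k. (L2_inner \<mu> (\<lambda>z. z * F z) (e j) - \<xi> * a j) * u j)"
    unfolding cmv_partial_sum_def left_diff_distrib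
    by (subst L2_inner_diff_left)
       (simp_all add: L2_mult_id F L2_fun_cmult L2_basis L2_inner_cmult_left left_diff_distrib a_def u_def)
  also have "\<dots> = (\<Sum>j\<le>k. (\<Sum>i<k+3. A i j)) - (\<Sum>i\<le>k. (\<Sum>j<k+3. A i j))"
  proof -
    have 1: "L2_inner \<mu> (\<lambda>z. z * F z) (e j) * u j = (\<Sum>i<k+3. A i j)" if "j \<le> k" for j
      using that by (subst coeff_mult_id[OF F, of _ "k+3"]) (auto simp: A_def a_def sum_distrib_right)
    have 2: "\<xi> * a i * u i = (\<Sum>j<k+3. A i j)" if "i \<le> k" for i
    proof -
      have "\<xi> * a i * u i = a i * (\<xi> * u i)" by simp
      also have "\<xi> * u i = (\<Sum>j<k+3. cmv_matrix i j * u j)"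
        unfolding u_def by (rule cmv_matrix_eigenvector[OF \<xi>]) (use that in auto)
      finally show ?thesis by (simp add: A_def sum_distrib_left mult_ac)
    qed
    show ?thesis by (simp add: left_diff_distrib sum_subtractf 1 2)
  qed
  also have "\<dots> = ((\<Sum>j\<le>k. \<Sum>i\<le>k. A i j) + (\<Sum>j\<le>k. \<Sum>i=k+1..k+2. A i j))
       - ((\<Sum>i\<le>k. \<Sum>j\<le>k. A i j) + (\<Sum>i\<le>k. \<Sum>j=k+1..k+2. A i j))"
    unfolding split by (subst (1 2) sum.union_disjoint) (auto simp: sum.distrib)
  also have "\<dots> = (\<Sum>j\<le>k. \<Sum>i=k+1..k+2. A i j) - (\<Sum>i\<le>k. \<Sum>j=k+1..k+2. A i j)"
    by (subst sum.swap) simp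
  \<comment> \<open>An entry with j < k - 1 and i > k is at distance at least 3 from the
    diagonal.\<close>
  also have "(\<Sum>j\<le>k. \<Sum>i=k+1..k+2. A i j) = (\<Sum>j=k-1..k. \<Sum>i=k+1..k+2. A i j)"
    by (intro sum.mono_neutral_right) (auto intro!: sum.neutral simp: A_def cmv_matrix_band)
  also have "(\<Sum>i\<le>k. \<Sum>j=k+1..k+2. A i j) = (\<Sum>i=k-1..k. \<Sum>j=k+1..k+2. A i j)"
    by (intro sum.mono_neutral_right) (auto intro!: sum.neutral simp: A_def cmv_matrix_band)
  finally have "norm (cmv_partial_sum \<mu> k (\<lambda>z. (z - \<xi>) * F z) \<xi>) \<le>
     (\<Sum>j=k-1..k. \<Sum>i=k+1..k+2. norm (A i j)) + (\<Sum>i=k-1..k. \<Sum>j=k+1..k+2. norm (A i j))"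
    by (simp only:) (intro order_trans[OF norm_triangle_ineq4] add_mono sum_norm_le norm_sum)
  also have "\<dots> \<le> (\<Sum>j=k-1..k. \<Sum>i=k+1..k+2. norm (a i) * norm (u j)) 
               + (\<Sum>i=k-1..k. \<Sum>j=k+1..k+2. norm (a i) * norm (u j))"
    using mult_right_mono[OF norm_cmv_matrix_le, of "norm (a i) * norm (u j)" for i j]
    by (intro add_mono sum_mono) (auto simp: A_def norm_mult mult.assoc)
  also have "\<dots> = (\<Sum>i=k+1..k+2. norm (a i)) * (\<Sum>j=k-1..k. norm (u j)) + 
       (\<Sum>i=k-1..k. norm (a i)) * (\<Sum>j=k+1..k+2. norm (u j))"
    by (subst sum.swap) (simp only: sum_product)
  \<comment> \<open>The two mixed products are among the four nonnegative terms of the expanded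
    product.\<close>
  also have "\<dots> \<le> ((\<Sum>i=k-1..k. norm (a i)) + (\<Sum>i=k+1..k+2. norm (a i))) * 
      ((\<Sum>j=k-1..k. norm (u j)) + (\<Sum>j=k+1..k+2. norm (u j)))"
    by (simp add: distrib_left distrib_right sum_nonneg)
  finally show ?thesis unfolding join by (simp add: a_def u_def del: sum.cl_ivl_Suc)
qed

end

section \<open>Summation over overlapping windows\<close>

text \<open>After exchanging the sums, an index i is met only by windows with k between i - 2 and i
  + 1, hence by at most four.\<close>

lemma sum_windows_le:
  fixes a :: "nat \<Rightarrow> real"
  assumes "\<And>i. a i \<ge> 0"
  shows "(\<Sum>k=N..<n. \<Sum>i=k-1..k+2. a i) \<le> 4 * (\<Sum>i=N-1..<n+2. a i)"
proof -
  have "(\<Sum>k=N..<n. \<Sum>i=k-1..k+2. a i) = (\<Sum>k=N..<n. \<Sum>i=N-1..<n+2. if i \<in> {k-1..k+2} then a i else 0)"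
    by (intro sum.cong refl sum.mono_neutral_cong_left) auto
  also have "\<dots> = (\<Sum>i=N-1..<n+2. \<Sum>k=N..<n. if i \<in> {k-1..k+2} then a i else 0)"
    by (rule sum.swap)
  also have "\<dots> \<le> (\<Sum>i=N-1..<n+2. 4 * a i)"
  proof (rule sum_mono)
    fix i
    have "(\<Sum>k=N..<n. if i \<in> {k-1..k+2} then a i else 0) = real (card {k\<in>{N..<n}. i \<in> {k-1..k+2}}) * a i"
      by (subst sum.inter_filter[symmetric]) auto
    also have "card {k\<in>{N..<n}. i \<in> {k-1..k+2}} \<le> card {i-2..i+1}"
      by (intro card_mono) auto
    then have "real (card {k\<in>{N..<n}. i \<in> {k-1..k+2}}) * a i \<le> 4 * a i"
      using assms by (intro mult_right_mono) auto
    finally show "(\<Sum>k=N..<n. if i \<in> {k-1..k+2} then a i else 0) \<le> 4 * a i" .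
  qed
  finally show ?thesis unfolding sum_distrib_left .
qed

text \<open>Cauchy-Schwarz is applied to the sum over k and again inside each window. At most four
  terms per window and fourfold overlap give a factor 16 under each root, thus 4 for each sequence
  and 16 in total.\<close>

lemma sum_window_products_le:
  fixes a b :: "nat \<Rightarrow> real"
  assumes "\<And>i. a i \<ge> 0" "\<And>i. b i \<ge> 0"
  shows "(\<Sum>k=N..<n. (\<Sum>i=k-1..k+2. a i) * (\<Sum>i=k-1..k+2. b i)) 
    \<le> 16 * sqrt (\<Sum>i=N-1..<n+2. (a i)\<^sup>2) * sqrt (\<Sum>i=N-1..<n+2. (b i)\<^sup>2)"
proof -
  have *: "sqrt (\<Sum>k=N..<n. (\<Sum>i=k-1..k+2. c i)\<^sup>2) \<le> 4 * sqrt (\<Sum>i=N-1..<n+2. (c i)\<^sup>2)" for c :: "nat \<Rightarrow> real"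
  proof -
    have "(\<Sum>k=N..<n. (\<Sum>i=k-1..k+2. c i)\<^sup>2) \<le> (\<Sum>k=N..<n. 4 * (\<Sum>i=k-1..k+2. (c i)\<^sup>2))"
    proof (rule sum_mono)
      fix k
      have "(\<Sum>i=k-1..k+2. c i)\<^sup>2 \<le> (\<Sum>i=k-1..k+2. (c i)\<^sup>2) * card {k-1..k+2}"
        by (rule sum_squared_le_sum_of_squares)
      also have "\<dots> \<le> (\<Sum>i=k-1..k+2. (c i)\<^sup>2) * 4"
        by (intro mult_left_mono sum_nonneg) auto
      finally show "(\<Sum>i=k-1..k+2. c i)\<^sup>2 \<le> 4 * (\<Sum>i=k-1..k+2. (c i)\<^sup>2)" by simp
    qed
    also have "\<dots> \<le> 4 * (4 * (\<Sum>i=N-1..<n+2. (c i)\<^sup>2))"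
      using sum_windows_le[of "\<lambda>i. (c i)\<^sup>2" N n] by (simp add: sum_distrib_left[symmetric])
    finally have "sqrt (\<Sum>k=N..<n. (\<Sum>i=k-1..k+2. c i)\<^sup>2) \<le> sqrt (16 * (\<Sum>i=N-1..<n+2. (c i)\<^sup>2))"
      by simp
    then show ?thesis by (simp only: real_sqrt_mult) simp
  qed
  have "(\<Sum>k=N..<n. (\<Sum>i=k-1..k+2. a i) * (\<Sum>i=k-1..k+2. b i))
     \<le> sqrt (\<Sum>k=N..<n. (\<Sum>i=k-1..k+2. a i)\<^sup>2) * sqrt (\<Sum>k=N..<n. (\<Sum>i=k-1..k+2. b i)\<^sup>2)"
    using L2_set_mult_ineq[of "\<lambda>k. \<Sum>i=k-1..k+2. a i" "\<lambda>k. \<Sum>i=k-1..k+2. b i" "{N..<n}"] assms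
    by (simp add: L2_set_def sum_nonneg)
  also have "\<dots> \<le> (4 * sqrt (\<Sum>i=N-1..<n+2. (a i)\<^sup>2)) * (4 * sqrt (\<Sum>i=N-1..<n+2. (b i)\<^sup>2))"
    by (intro mult_mono *) (auto intro!: sum_nonneg simp del: sum.op_ivl_Suc)
  finally show ?thesis by simp
qed

context cmv_measure
begin

text \<open>The lower limit \<open>N\<close> survives in the factor with the coefficients of F, so
  that late blocks of k see only a tail of the Bessel sum.\<close>

lemma sum_partial_sum_commutator_le:
  assumes F: "L2_fun \<mu> F" and \<xi>: "norm \<xi> = 1"
  shows "(\<Sum>k=N..<n. norm (cmv_partial_sum \<mu> k (\<lambda>z. (z - \<xi>) * F z) \<xi>)) \<le>
    16 * sqrt (\<Sum>i=N-1..<n+2. (norm (L2_inner \<mu> F (e i)))\<^sup>2) * sqrt (\<Sum>i\<le>n+2. (norm (e i \<xi>))\<^sup>2)"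
proof -
  have "(\<Sum>k=N..<n. norm (cmv_partial_sum \<mu> k (\<lambda>z. (z - \<xi>) * F z) \<xi>)) \<le>
     (\<Sum>k=N..<n. (\<Sum>i=k-1..k+2. norm (L2_inner \<mu> F (e i))) * (\<Sum>i=k-1..k+2. norm (e i \<xi>)))"
    by (intro sum_mono norm_partial_sum_commutator_le assms)
  also have "\<dots> \<le> 16 * sqrt (\<Sum>i=N-1..<n+2. (norm (L2_inner \<mu> F (e i)))\<^sup>2) * 
      sqrt (\<Sum>i=N-1..<n+2. (norm (e i \<xi>))\<^sup>2)"
    by (rule sum_window_products_le) auto
  also have "\<dots> \<le> 16 * sqrt (\<Sum>i=N-1..<n+2. (norm (L2_inner \<mu> F (e i)))\<^sup>2) * 
      sqrt (\<Sum>i\<le>n+2. (norm (e i \<xi>))\<^sup>2)"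
    by (intro mult_left_mono real_sqrt_le_mono sum_mono2)
       (auto intro!: sum_nonneg mult_nonneg_nonneg simp del: sum.op_ivl_Suc)
  finally show ?thesis .
qed

lemma norm_partial_sum_le:
  assumes f: "L2_fun \<mu> f" and "k \<le> n"
  shows "norm (cmv_partial_sum \<mu> k f \<xi>) \<le>
    sqrt (LINT z|\<mu>. (norm (f z))\<^sup>2) * sqrt (\<Sum>i\<le>n. (norm (e i \<xi>))\<^sup>2)"
proof -
  have "norm (cmv_partial_sum \<mu> k f \<xi>) \<le> (\<Sum>i\<le>k. norm (L2_inner \<mu> f (e i)) * norm (e i \<xi>))"
    unfolding cmv_partial_sum_def by (rule sum_norm_le) (simp add: norm_mult)
  also have "\<dots> \<le> sqrt (\<Sum>i\<le>k. (norm (L2_inner \<mu> f (e i)))\<^sup>2) * sqrt (\<Sum>i\<le>k. (norm (e i \<xi>))\<^sup>2)"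
    using L2_set_mult_ineq[of "\<lambda>i. norm (L2_inner \<mu> f (e i))" "\<lambda>i. norm (e i \<xi>)" "{..k}"]
    by (simp add: L2_set_def)
  also have "\<dots> \<le> sqrt (LINT z|\<mu>. (norm (f z))\<^sup>2) * sqrt (\<Sum>i\<le>n. (norm (e i \<xi>))\<^sup>2)"
    using Bessel[OF f, of "Suc k"] \<open>k \<le> n\<close>
    by (intro mult_mono real_sqrt_le_mono sum_mono2)
       (auto intro!: sum_nonneg simp: lessThan_Suc_atMost)
  finally show ?thesis .
qed

lemma partial_sum_add:
  assumes "L2_fun \<mu> f" "L2_fun \<mu> g"
  shows "cmv_partial_sum \<mu> k (\<lambda>z. f z + g z) \<xi> = cmv_partial_sum \<mu> k f \<xi> + cmv_partial_sum \<mu> k g \<xi>"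
  unfolding cmv_partial_sum_def
  by (simp add: L2_inner_add_left assms L2_basis distrib_right sum.distrib)

text \<open>Constants are multiples of the harmonic of index 0, so every partial sum reproduces them
  at every point; the reduction to a function vanishing at \<xi> rests on this.\<close>

lemma partial_sum_const: "cmv_partial_sum \<mu> k (\<lambda>z. v) \<xi> = v"
proof -
  have "cmv_harmonic 0 \<in> lin_combs UNIV e (Suc 0)"
    by (rule harmonic_in_basis)
  then have *: "(\<lambda>z. v * cmv_harmonic 0 z) \<in> lin_combs UNIV e (Suc k)"
    by (intro lin_combs_cmult) (auto intro: lin_combs_mono)
  have "(\<lambda>z. v) \<in> lin_combs UNIV e (Suc k)"
    by (rule lin_combs_cong[OF *]) (simp add: cmv_harmonic_def)
  from lin_combs_expansion(1)[OF this _ _ UNIV_I[of \<xi>]] show ?thesis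
    unfolding cmv_partial_sum_def by (simp only: lessThan_Suc_atMost) auto
qed

lemma partial_sum_cong_AE:
  assumes "f \<in> borel_measurable \<mu>" "g \<in> borel_measurable \<mu>" "AE z in \<mu>. f z = g z"
  shows "cmv_partial_sum \<mu> k f \<xi> = cmv_partial_sum \<mu> k g \<xi>"
  unfolding cmv_partial_sum_def
  by (intro sum.cong refl arg_cong2[where f = "(*)"] L2_inner_cong_AE)
     (use assms L2_basis in \<open>auto simp: L2_fun_def\<close>)

end

section \<open>Radial comparison and the Poisson kernel\<close>

text \<open>Monotonicity turns the superlevel set into a disc about \<xi>; continuity shows that the
  supremum of the admissible distances is not attained, so the disc is open. Hence information on
  open discs of radius at most \<epsilon> is all that a comparison requires.\<close>

lemma superlevel_set_ball:
  fixes \<phi> :: "real \<Rightarrow> real" and \<xi> :: "'a::metric_space"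
  assumes cont: "continuous_on UNIV \<phi>" and anti: "\<And>s t. 0 \<le> s \<Longrightarrow> s \<le> t \<Longrightarrow> \<phi> t \<le> \<phi> s"
    and ne: "{z\<in>ball \<xi> \<epsilon>. s < \<phi> (dist \<xi> z)} \<noteq> {}"
  obtains \<rho> where "0 < \<rho>" "\<rho> \<le> \<epsilon>" "{z\<in>ball \<xi> \<epsilon>. s < \<phi> (dist \<xi> z)} = ball \<xi> \<rho>"
proof
  define D where "D = {t. 0 \<le> t \<and> t < \<epsilon> \<and> s < \<phi> t}"
  have bdd: "bdd_above D" by (auto simp: D_def intro!: bdd_aboveI[of _ \<epsilon>])
  have less: "d < Sup D" if "d \<in> D" for d
  proof -
    have "open {t. s < \<phi> t}"
      using cont by (intro open_Collect_less) auto
    moreover have "d \<in> {t. s < \<phi> t}" using that by (auto simp: D_def)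
    ultimately obtain \<delta> where \<delta>: "\<delta> > 0" "ball d \<delta> \<subseteq> {t. s < \<phi> t}"
      unfolding open_contains_ball by blast
    \<comment> \<open>The step \<delta>/2 stays above the level s, the midpoint towards \<epsilon>
      stays inside the disc.\<close>
    define d' where "d' = min (d + \<delta> / 2) ((d + \<epsilon>) / 2)"
    have "d < d'" "d' < \<epsilon>" "d' \<in> ball d \<delta>"
      using that \<delta>(1) by (auto simp: D_def d'_def dist_real_def min_def)
    then have "d' \<in> D" using \<delta> that by (auto simp: D_def)
    with \<open>d < d'\<close> bdd show ?thesis
      using cSup_upper by fastforce
  qed
  obtain z where z: "z \<in> ball \<xi> \<epsilon>" "s < \<phi> (dist \<xi> z)" using ne by auto
  then have zD: "dist \<xi> z \<in> D" by (auto simp: D_def)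
  show "0 < Sup D" using less[OF zD] zero_le_dist[of \<xi> z] by linarith
  show "Sup D \<le> \<epsilon>" using zD by (intro cSup_least) (auto simp: D_def)
  show "{z\<in>ball \<xi> \<epsilon>. s < \<phi> (dist \<xi> z)} = ball \<xi> (Sup D)"
  proof (intro equalityI subsetI)
    fix x assume "x \<in> {z\<in>ball \<xi> \<epsilon>. s < \<phi> (dist \<xi> z)}"
    then have "dist \<xi> x \<in> D" by (auto simp: D_def)
    then show "x \<in> ball \<xi> (Sup D)" using less by auto
  next
    fix x assume "x \<in> ball \<xi> (Sup D)"
    then obtain t where "t \<in> D" "dist \<xi> x < t"
      using zD less_cSup_iff[of D "dist \<xi> x"] bdd by auto
    then show "x \<in> {z\<in>ball \<xi> \<epsilon>. s < \<phi> (dist \<xi> z)}"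
      using anti[of "dist \<xi> x" t] by (auto simp: D_def)
  qed
qed

text \<open>A nonnegative value is the length of the interval of positive levels below it, and
  Fubini integrates over the levels. Negative values of \<phi> contribute zero on both sides, since
  \<open>ennreal\<close> truncates them.\<close>

lemma layer_cake_ball:
  fixes \<phi> :: "real \<Rightarrow> real" and \<xi> :: "'a::{second_countable_topology,metric_space}"
  assumes cont: "continuous_on UNIV \<phi>" and "finite_measure N" and sets: "sets N = sets borel"
  shows "(\<integral>\<^sup>+z\<in>ball \<xi> \<epsilon>. ennreal (\<phi> (dist \<xi> z)) \<partial>N) =
    (\<integral>\<^sup>+s\<in>{0<..}. emeasure N {z\<in>ball \<xi> \<epsilon>. s < \<phi> (dist \<xi> z)} \<partial>lborel)"
proof -
  interpret finite_measure N by fact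
  interpret pair_sigma_finite N lborel ..
  note [measurable_cong] = sets
  have [measurable]: "\<phi> \<in> borel_measurable borel"
    using cont by (rule borel_measurable_continuous_onI)
  have *: "ennreal a = (\<integral>\<^sup>+s\<in>{0<..}. indicator {..<a} s \<partial>lborel)" for a :: real
  proof -
    have "(\<integral>\<^sup>+s\<in>{0<..}. indicator {..<a} s \<partial>lborel) = (\<integral>\<^sup>+s. indicator {0<..<a} s \<partial>lborel)"
      by (intro nn_integral_cong) (auto split: split_indicator)
    also have "\<dots> = ennreal a"
      by (cases "a \<ge> 0") (auto simp: ennreal_neg)
    finally show ?thesis ..
  qed
  have "(\<integral>\<^sup>+z\<in>ball \<xi> \<epsilon>. ennreal (\<phi> (dist \<xi> z)) \<partial>N) = 
      (\<integral>\<^sup>+z. (\<integral>\<^sup>+s. indicator (ball \<xi> \<epsilon>) z * (indicator {..<\<phi> (dist \<xi> z)} s * indicator {0<..} s) \<partial>lborel) \<partial>N)"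
    unfolding * by (intro nn_integral_cong) (simp add: nn_integral_cmult mult.commute)
  also have "\<dots> = (\<integral>\<^sup>+s. (\<integral>\<^sup>+z. indicator (ball \<xi> \<epsilon>) z * (indicator {..<\<phi> (dist \<xi> z)} s * indicator {0<..} s) \<partial>N) \<partial>lborel)"
    unfolding indicator_def mem_ball lessThan_iff greaterThan_iff by (intro Fubini'[symmetric]) measurable
  also have "\<dots> = (\<integral>\<^sup>+s\<in>{0<..}. (\<integral>\<^sup>+z. indicator {z\<in>ball \<xi> \<epsilon>. s < \<phi> (dist \<xi> z)} z \<partial>N) \<partial>lborel)"
    by (intro nn_integral_cong)
       (auto intro!: nn_integral_cong split: split_indicator simp del: nn_integral_indicator)
  also have "\<dots> = (\<integral>\<^sup>+s\<in>{0<..}. emeasure N {z\<in>ball \<xi> \<epsilon>. s < \<phi> (dist \<xi> z)} \<partial>lborel)"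
    by (intro nn_integral_cong, subst nn_integral_indicator) (auto simp: sets)
  finally show ?thesis .
qed

text \<open>A radially decreasing weight is a superposition of indicators of discs, so a comparison
  of all small discs passes to weighted integrals. It serves for |h|^2 d\<mu> against \<mu> and
  again for a measure with linearly growing discs against Lebesgue measure.\<close>

lemma radial_comparison:
  fixes \<phi> :: "real \<Rightarrow> real" and \<xi> :: "'a::{second_countable_topology,metric_space}"
  assumes "finite_measure N1" "sets N1 = sets borel" "finite_measure N2" "sets N2 = sets borel"
    and balls: "\<And>\<rho>. 0 < \<rho> \<Longrightarrow> \<rho> \<le> \<epsilon> \<Longrightarrow> emeasure N1 (ball \<xi> \<rho>) \<le> \<eta> * emeasure N2 (ball \<xi> \<rho>)"
    and \<phi>: "continuous_on UNIV \<phi>" "\<And>s t. 0 \<le> s \<Longrightarrow> s \<le> t \<Longrightarrow> \<phi> t \<le> \<phi> s"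
  shows "(\<integral>\<^sup>+z\<in>ball \<xi> \<epsilon>. ennreal (\<phi> (dist \<xi> z)) \<partial>N1) \<le> \<eta> * (\<integral>\<^sup>+z\<in>ball \<xi> \<epsilon>. ennreal (\<phi> (dist \<xi> z)) \<partial>N2)"
proof -
  interpret N2: finite_measure N2 by fact
  interpret pair_sigma_finite N2 lborel ..
  note [measurable_cong] = assms(4)
  have [measurable]: "\<phi> \<in> borel_measurable borel"
    using \<phi>(1) by (rule borel_measurable_continuous_onI)
  have *: "emeasure N1 {z\<in>ball \<xi> \<epsilon>. s < \<phi> (dist \<xi> z)} \<le> \<eta> * emeasure N2 {z\<in>ball \<xi> \<epsilon>. s < \<phi> (dist \<xi> z)}" for s
  proof (cases "{z\<in>ball \<xi> \<epsilon>. s < \<phi> (dist \<xi> z)} = {}")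
    case True
    then show ?thesis by (simp only: emeasure_empty) simp
  next
    case False
    obtain \<rho> where \<rho>: "0 < \<rho>" "\<rho> \<le> \<epsilon>" "{z\<in>ball \<xi> \<epsilon>. s < \<phi> (dist \<xi> z)} = ball \<xi> \<rho>"
      by (rule superlevel_set_ball[OF \<phi> False])
    show ?thesis unfolding \<rho>(3) by (rule balls) fact+
  qed
  \<comment> \<open>Measurability in the level comes from sections of a product set; it permits
    pulling \<eta> out of the integral.\<close>
  have meas: "(\<lambda>s. emeasure N2 {z\<in>ball \<xi> \<epsilon>. s < \<phi> (dist \<xi> z)} * indicator {0<..} s) \<in> borel_measurable lborel"
  proof -
    have "{x \<in> space (lborel \<Otimes>\<^sub>M N2). dist \<xi> (snd x) < \<epsilon> \<and> fst x < \<phi> (dist \<xi> (snd x))} \<in> sets (lborel \<Otimes>\<^sub>M N2)"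
      by measurable
    from N2.measurable_emeasure_Pair[OF this]
    have "(\<lambda>s. emeasure N2 {z\<in>ball \<xi> \<epsilon>. s < \<phi> (dist \<xi> z)}) \<in> borel_measurable lborel"
      using sets_eq_imp_space_eq[OF assms(4)] by (simp add: space_pair_measure vimage_def)
    then show ?thesis by measurable
  qed
  have "(\<integral>\<^sup>+z\<in>ball \<xi> \<epsilon>. ennreal (\<phi> (dist \<xi> z)) \<partial>N1) \<le>
      (\<integral>\<^sup>+s. \<eta> * (emeasure N2 {z\<in>ball \<xi> \<epsilon>. s < \<phi> (dist \<xi> z)} * indicator {0<..} s) \<partial>lborel)"
    unfolding layer_cake_ball[OF \<phi>(1) assms(1,2)]
    unfolding mult.assoc[symmetric] by (intro nn_integral_mono mult_right_mono *) simp
  also have "\<dots> = \<eta> * (\<integral>\<^sup>+z\<in>ball \<xi> \<epsilon>. ennreal (\<phi> (dist \<xi> z)) \<partial>N2)"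
    unfolding layer_cake_ball[OF \<phi>(1) assms(3,4)]
    by (rule nn_integral_cmult[OF meas])
  finally show ?thesis .
qed


section \<open>The Poisson kernel as a function of the chord length\<close>

text \<open>This is the Poisson kernel of the point r \<xi>, evaluated on the circle at chord
  distance t from \<xi>; the denominator is \<open>circle_poisson_denom\<close>. Chord length
  instead of angle makes it radial for discs in the plane.\<close>

definition radial_poisson :: "real \<Rightarrow> real \<Rightarrow> real" where
  "radial_poisson r t = (1 - r\<^sup>2) / ((1 - r)\<^sup>2 + r * t\<^sup>2)"

lemma radial_poisson_denom_pos: "0 \<le> r \<Longrightarrow> r < 1 \<Longrightarrow> (1 - r)\<^sup>2 + r * t\<^sup>2 > 0"
  for r t :: real by (intro add_pos_nonneg) auto

lemma radial_poisson_pos: "0 \<le> r \<Longrightarrow> r < 1 \<Longrightarrow> radial_poisson r t > 0"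
  unfolding radial_poisson_def
  by (intro divide_pos_pos radial_poisson_denom_pos) (auto simp: power_less_one_iff abs_square_less_1)

lemma radial_poisson_antimono:
  assumes "0 \<le> r" "r < 1" "0 \<le> s" "s \<le> t"
  shows "radial_poisson r t \<le> radial_poisson r s"
  unfolding radial_poisson_def
proof (rule divide_left_mono)
  show "(1 - r)\<^sup>2 + r * s\<^sup>2 \<le> (1 - r)\<^sup>2 + r * t\<^sup>2"
    using assms by (intro add_left_mono mult_left_mono power_mono) auto
  show "0 \<le> 1 - r\<^sup>2" using assms by (simp add: power_le_one)
  show "0 < ((1 - r)\<^sup>2 + r * t\<^sup>2) * ((1 - r)\<^sup>2 + r * s\<^sup>2)"
    using assms by (intro mult_pos_pos radial_poisson_denom_pos) auto
qed

lemma continuous_radial_poisson: "0 \<le> r \<Longrightarrow> r < 1 \<Longrightarrow> continuous_on UNIV (radial_poisson r)"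
  unfolding radial_poisson_def[abs_def]
  using radial_poisson_denom_pos by (intro continuous_intros) (auto simp: less_imp_neq[symmetric])

lemma radial_poisson_meas: "0 \<le> r \<Longrightarrow> r < 1 \<Longrightarrow> radial_poisson r \<in> borel_measurable borel"
  by (intro borel_measurable_continuous_onI continuous_radial_poisson)

lemma radial_poisson_0: "r < 1 \<Longrightarrow> radial_poisson r 0 = (1 + r) / (1 - r)"
  unfolding radial_poisson_def by (simp add: power2_eq_square divide_simps) (simp add: algebra_simps)

lemma radial_poisson_le:
  assumes "n \<ge> 1" "t \<ge> 0"
  shows "radial_poisson (1 - 1 / real n) t \<le> 2 * real n"
proof -
  have "radial_poisson (1 - 1 / real n) t \<le> radial_poisson (1 - 1 / real n) 0"
    using assms by (intro radial_poisson_antimono) auto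
  also have "\<dots> \<le> 2 * real n"
    using assms by (subst radial_poisson_0) (auto simp: field_simps)
  finally show ?thesis .
qed

text \<open>With r = 1 - 1/n the numerator (1 - r)(1 + r) is at least 1/n. The near, far and global
  estimates take \<open>D\<close> to be 2/n^2, 2 t^2 and 5.\<close>

lemma radial_poisson_ge:
  assumes "n \<ge> 1" "((1 / real n)\<^sup>2 + (1 - 1 / real n) * t\<^sup>2) \<le> D" "D > 0"
  shows "radial_poisson (1 - 1 / real n) t \<ge> 1 / (n * D)"
proof -
  let ?r = "1 - 1 / real n"
  have "1 / (n * D) = (1 / n) / D" by simp
  also have "\<dots> \<le> (1 - ?r\<^sup>2) / D"
  proof (rule divide_right_mono)
    have "1 - ?r\<^sup>2 = (1 / real n) * (1 + ?r)" by (simp add: power2_eq_square algebra_simps)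
    also have "\<dots> \<ge> (1 / real n) * 1" using assms by (intro mult_left_mono) auto
    finally show "1 / real n \<le> 1 - ?r\<^sup>2" by simp
  qed (use assms in auto)
  also have "\<dots> \<le> radial_poisson ?r t"
    unfolding radial_poisson_def
    by (intro divide_left_mono mult_pos_pos radial_poisson_denom_pos)
       (use assms in \<open>auto simp: power_le_one\<close>)
  finally show ?thesis .
qed

lemma radial_poisson_ge_near:
  assumes "n \<ge> 1" "0 \<le> t" "t \<le> 1 / real n"
  shows "radial_poisson (1 - 1 / real n) t \<ge> n / 2"
proof -
  have "(1 - 1 / real n) * t\<^sup>2 \<le> 1 * (1 / real n)\<^sup>2"
    using assms by (intro mult_mono power_mono) auto
  then have "1 / (n * (2 * (1 / real n)\<^sup>2)) \<le> radial_poisson (1 - 1 / real n) t"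
    using assms by (intro radial_poisson_ge) auto
  then show ?thesis using assms by (simp add: power2_eq_square)
qed

lemma radial_poisson_ge_far:
  assumes "n \<ge> 1" "1 / real n \<le> t"
  shows "radial_poisson (1 - 1 / real n) t \<ge> 1 / (2 * real n * t\<^sup>2)"
proof -
  have "t > 0" using assms by (meson divide_pos_pos less_le_trans of_nat_0_less_iff zero_less_one less_eq_Suc_le One_nat_def)
  have "(1 - 1 / real n) * t\<^sup>2 \<le> 1 * t\<^sup>2"
    using assms \<open>t > 0\<close> by (intro mult_mono power_mono) auto
  moreover have "(1 / real n)\<^sup>2 \<le> t\<^sup>2" using assms by (intro power_mono) auto
  ultimately have "1 / (n * (2 * t\<^sup>2)) \<le> radial_poisson (1 - 1 / real n) t"
    using assms \<open>t > 0\<close> by (intro radial_poisson_ge) (linarith, linarith, simp)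
  then show ?thesis by (simp add: mult_ac)
qed

lemma radial_poisson_ge_circle:
  assumes "n \<ge> 1" "0 \<le> t" "t \<le> 2"
  shows "radial_poisson (1 - 1 / real n) t \<ge> 1 / (5 * real n)"
proof -
  have "(1 - 1 / real n) * t\<^sup>2 \<le> 1 * 2\<^sup>2"
    using assms by (intro mult_mono power_mono) auto
  moreover have "(1 / real n)\<^sup>2 \<le> 1" using assms by (intro power_le_one) auto
  ultimately have "1 / (real n * 5) \<le> radial_poisson (1 - 1 / real n) t"
    using assms by (intro radial_poisson_ge[where D = 5, simplified]) auto
  then show ?thesis by (simp add: mult_ac)
qed

lemma circle_poisson_denom:
  assumes "norm \<xi> = 1" "norm \<zeta> = 1"
  shows "(norm (1 - cnj \<zeta> * (of_real r * \<xi>)))\<^sup>2 = (1 - r)\<^sup>2 + r * (dist \<xi> \<zeta>)\<^sup>2"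
proof -
  have 1: "(Re \<xi>)\<^sup>2 + (Im \<xi>)\<^sup>2 = 1" "(Re \<zeta>)\<^sup>2 + (Im \<zeta>)\<^sup>2 = 1"
    using assms by (auto simp: cmod_def)
  have "(norm (1 - cnj \<zeta> * (of_real r * \<xi>)))\<^sup>2 = 
     1 - 2 * r * (Re \<xi> * Re \<zeta> + Im \<xi> * Im \<zeta>) + r\<^sup>2 * (((Re \<xi>)\<^sup>2 + (Im \<xi>)\<^sup>2) * ((Re \<zeta>)\<^sup>2 + (Im \<zeta>)\<^sup>2))"
    by (simp add: cmod_power2) (simp add: power2_eq_square algebra_simps)
  moreover have "(dist \<xi> \<zeta>)\<^sup>2 = ((Re \<xi>)\<^sup>2 + (Im \<xi>)\<^sup>2) + ((Re \<zeta>)\<^sup>2 + (Im \<zeta>)\<^sup>2) - 2 * (Re \<xi> * Re \<zeta> + Im \<xi> * Im \<zeta>)"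
    by (simp add: dist_norm cmod_power2) (simp add: power2_eq_square algebra_simps)
  ultimately show ?thesis unfolding 1 by algebra
qed

lemma dist_circle_le_2: "norm \<xi> = 1 \<Longrightarrow> norm \<zeta> = 1 \<Longrightarrow> dist \<xi> \<zeta> \<le> 2"
  for \<xi> \<zeta> :: complex using norm_triangle_ineq4[of \<xi> \<zeta>] by (simp add: dist_norm)

lemma radial_poisson_integrable:
  fixes M :: "complex measure"
  assumes "finite_measure M" "sets M = sets borel" "0 \<le> r" "r < 1"
  shows "integrable M (\<lambda>\<zeta>. radial_poisson r (dist \<xi> \<zeta>))"
proof (rule finite_measure.integrable_const_bound[where B = "radial_poisson r 0"])
  note [measurable_cong] = assms(2)
  note [measurable] = radial_poisson_meas[OF assms(3,4)]
  show "(\<lambda>\<zeta>. radial_poisson r (dist \<xi> \<zeta>)) \<in> borel_measurable M" by measurable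
qed (use assms radial_poisson_pos in \<open>auto intro!: AE_I2 radial_poisson_antimono simp: less_imp_le\<close>)

lemma poisson_ext_radial:
  assumes "sets M = sets borel" "AE \<zeta> in M. \<zeta> \<in> sphere 0 1" "norm \<xi> = 1" "0 \<le> r" "r < 1"
  shows "poisson_ext M (of_real r * \<xi>) = (LINT \<zeta>|M. radial_poisson r (dist \<xi> \<zeta>))"
  unfolding poisson_ext_def
proof (rule integral_cong_AE)
  note [measurable_cong] = assms(1)
  note [measurable] = radial_poisson_meas[OF assms(4,5)]
  show "(\<lambda>\<zeta>. radial_poisson r (dist \<xi> \<zeta>)) \<in> borel_measurable M" by measurable
  show "AE \<zeta> in M. (1 - (norm (of_real r * \<xi>))\<^sup>2) / (norm (1 - cnj \<zeta> * (of_real r * \<xi>)))\<^sup>2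
      = radial_poisson r (dist \<xi> \<zeta>)"
    using assms(2) by eventually_elim 
      (use assms in \<open>auto simp: circle_poisson_denom radial_poisson_def norm_mult\<close>)
  show "(\<lambda>\<zeta>. (1 - (norm (of_real r * \<xi>))\<^sup>2) / (norm (1 - cnj \<zeta> * (of_real r * \<xi>)))\<^sup>2) \<in> borel_measurable M"
    by measurable
qed

context cmv_measure
begin

text \<open>The minimum of the kernel on the circle is averaged over a probability measure. This
  gives positivity of the extension and the crude growth bound for the kernel sum.\<close>

lemma poisson_ext_ge:
  assumes "norm \<xi> = 1" "n \<ge> 1"
  shows "poisson_ext \<mu> (of_real (1 - 1 / real n) * \<xi>) \<ge> 1 / (5 * real n)"
proof -
  have "1 / (5 * real n) = (LINT \<zeta>|\<mu>. 1 / (5 * real n))" 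
    using prob_space by simp
  also have "\<dots> \<le> (LINT \<zeta>|\<mu>. radial_poisson (1 - 1 / real n) (dist \<xi> \<zeta>))"
  proof (rule integral_mono_AE)
    show "AE \<zeta> in \<mu>. 1 / (5 * real n) \<le> radial_poisson (1 - 1 / real n) (dist \<xi> \<zeta>)"
      using AE_circle
    proof eventually_elim
      case (elim \<zeta>)
      then show ?case
        using radial_poisson_ge_circle[OF assms(2), of "dist \<xi> \<zeta>"] dist_circle_le_2[OF assms(1), of \<zeta>] by auto
    qed
    show "integrable \<mu> (\<lambda>\<zeta>. radial_poisson (1 - 1 / real n) (dist \<xi> \<zeta>))"
      using assms by (intro radial_poisson_integrable) (auto simp: finite_measure_axioms)
  qed auto
  also have "\<dots> = poisson_ext \<mu> (of_real (1 - 1 / real n) * \<xi>)"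
    by (rule poisson_ext_radial[symmetric]) (use assms AE_circle in auto)
  finally show ?thesis .
qed

text \<open>The hypothesis compares |h|^2 d\<mu> with \<eta> \<mu> on all discs up to radius
  \<epsilon>; \<open>radial_comparison\<close> transfers it to the decreasing Poisson weight, and
  enlarging the domain on the right gives the full Poisson integral.\<close>

lemma weighted_ball_integral_le:
  assumes h: "L2_fun \<mu> h" and \<xi>: "norm \<xi> = 1" and r: "0 \<le> r" "r < 1" and \<eta>: "\<eta> \<ge> 0"
    and avg: "\<And>\<rho>. 0 < \<rho> \<Longrightarrow> \<rho> \<le> \<epsilon> \<Longrightarrow> (LINT z:ball \<xi> \<rho>|\<mu>. (norm (h z))\<^sup>2) \<le> \<eta> * measure \<mu> (ball \<xi> \<rho>)"
  shows "integrable \<mu> (\<lambda>z. indicator (ball \<xi> \<epsilon>) z * ((norm (h z))\<^sup>2 * radial_poisson r (dist \<xi> z)))" (is ?int)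
    and "(LINT z|\<mu>. indicator (ball \<xi> \<epsilon>) z * ((norm (h z))\<^sup>2 * radial_poisson r (dist \<xi> z))) \<le>
      \<eta> * poisson_ext \<mu> (of_real r * \<xi>)" (is "?I \<le> _")
proof -
  have [measurable]: "h \<in> borel_measurable borel"
    using h by (auto simp: L2_fun_def cong: measurable_cong_sets)
  have [measurable]: "ball \<xi> \<rho> \<in> sets borel" for \<rho> by simp
  have hint: "integrable \<mu> (\<lambda>z. (norm (h z))\<^sup>2)" using h by (simp add: L2_fun_def)
  note [measurable] = radial_poisson_meas[OF r]
  note pos = radial_poisson_pos[OF r]
  have P: "poisson_ext \<mu> (of_real r * \<xi>) = (LINT z|\<mu>. radial_poisson r (dist \<xi> z))"
    by (rule poisson_ext_radial[OF sets_mu AE_circle \<xi> r])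
  have Pint: "integrable \<mu> (\<lambda>z. radial_poisson r (dist \<xi> z))"
    by (rule radial_poisson_integrable[OF finite_measure_axioms sets_mu r])
  have P_nonneg: "poisson_ext \<mu> (of_real r * \<xi>) \<ge> 0"
    unfolding P by (intro Bochner_Integration.integral_nonneg) (simp add: less_imp_le[OF pos])
  define N where "N = density \<mu> (\<lambda>z. ennreal ((norm (h z))\<^sup>2))"
  have N: "sets N = sets borel" by (simp add: N_def)
  have finN: "finite_measure N"
  proof
    have "emeasure N (space N) = (\<integral>\<^sup>+z. ennreal ((norm (h z))\<^sup>2) \<partial>\<mu>)"
      by (simp add: N_def emeasure_density)
    also have "\<dots> = ennreal (LINT z|\<mu>. (norm (h z))\<^sup>2)"
      by (intro nn_integral_eq_integral hint) auto
    finally show "emeasure N (space N) \<noteq> \<infinity>" by simp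
  qed
  show int: ?int
  proof (rule Bochner_Integration.integrable_bound[of \<mu> "\<lambda>z. radial_poisson r 0 * (norm (h z))\<^sup>2"])
    show "AE z in \<mu>. norm (indicat_real (ball \<xi> \<epsilon>) z * ((norm (h z))\<^sup>2 * radial_poisson r (dist \<xi> z)))
       \<le> norm (radial_poisson r 0 * (norm (h z))\<^sup>2)"
      using pos r by (intro AE_I2)
        (auto simp: abs_mult less_imp_le mult.commute indicator_def intro!: mult_right_mono radial_poisson_antimono)
    show "(\<lambda>z. indicat_real (ball \<xi> \<epsilon>) z * ((norm (h z))\<^sup>2 * radial_poisson r (dist \<xi> z))) \<in> borel_measurable \<mu>"
      by measurable
  qed (use hint in auto)
  have "ennreal ?I = (\<integral>\<^sup>+z. ennreal (indicator (ball \<xi> \<epsilon>) z * ((norm (h z))\<^sup>2 * radial_poisson r (dist \<xi> z))) \<partial>\<mu>)"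
    using pos by (intro nn_integral_eq_integral[symmetric] int) (auto simp: less_imp_le)
  also have "\<dots> = (\<integral>\<^sup>+z. ennreal ((norm (h z))\<^sup>2) * (ennreal (radial_poisson r (dist \<xi> z)) * indicator (ball \<xi> \<epsilon>) z) \<partial>\<mu>)"
    using pos by (intro nn_integral_cong) (auto split: split_indicator simp: ennreal_mult' less_imp_le)
  also have "\<dots> = (\<integral>\<^sup>+z\<in>ball \<xi> \<epsilon>. ennreal (radial_poisson r (dist \<xi> z)) \<partial>N)"
    unfolding N_def by (subst nn_integral_density) (auto simp: mult_ac)
  also have "\<dots> \<le> ennreal \<eta> * (\<integral>\<^sup>+z\<in>ball \<xi> \<epsilon>. ennreal (radial_poisson r (dist \<xi> z)) \<partial>\<mu>)"
  proof (rule radial_comparison[OF finN N finite_measure_axioms sets_mu])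
    fix \<rho> :: real assume \<rho>: "0 < \<rho>" "\<rho> \<le> \<epsilon>"
    have int: "integrable \<mu> (\<lambda>z. indicat_real (ball \<xi> \<rho>) z * (norm (h z))\<^sup>2)"
      by (rule Bochner_Integration.integrable_bound[OF hint]) (auto intro!: AE_I2 split: split_indicator)
    have "emeasure N (ball \<xi> \<rho>) = (\<integral>\<^sup>+z. ennreal (indicat_real (ball \<xi> \<rho>) z * (norm (h z))\<^sup>2) \<partial>\<mu>)"
      unfolding N_def by (subst emeasure_density) (auto intro!: nn_integral_cong split: split_indicator)
    also have "\<dots> = ennreal (LINT z:ball \<xi> \<rho>|\<mu>. (norm (h z))\<^sup>2)"
      using int by (subst nn_integral_eq_integral) (auto simp: set_lebesgue_integral_def)
    also have "\<dots> \<le> ennreal (\<eta> * measure \<mu> (ball \<xi> \<rho>))"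
      by (intro ennreal_leI avg \<rho>)
    also have "\<dots> = ennreal \<eta> * emeasure \<mu> (ball \<xi> \<rho>)"
      using \<eta> by (simp add: ennreal_mult emeasure_eq_measure)
    finally show "emeasure N (ball \<xi> \<rho>) \<le> ennreal \<eta> * emeasure \<mu> (ball \<xi> \<rho>)" .
  qed (use r in \<open>auto intro: continuous_radial_poisson radial_poisson_antimono\<close>)
  also have "\<dots> \<le> ennreal \<eta> * (\<integral>\<^sup>+z. ennreal (radial_poisson r (dist \<xi> z)) \<partial>\<mu>)"
    by (intro mult_left_mono nn_integral_mono) (auto split: split_indicator)
  also have "\<dots> = ennreal \<eta> * ennreal (poisson_ext \<mu> (of_real r * \<xi>))"
    unfolding P by (subst nn_integral_eq_integral[OF Pint]) (auto simp: less_imp_le[OF pos])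
  also have "\<dots> = ennreal (\<eta> * poisson_ext \<mu> (of_real r * \<xi>))"
    using \<eta> by (simp add: ennreal_mult')
  finally show "?I \<le> \<eta> * poisson_ext \<mu> (of_real r * \<xi>)"
    using mult_nonneg_nonneg[OF \<eta> P_nonneg] by (simp only: ennreal_le_iff)
qed

end

section \<open>Summability at Lebesgue points\<close>

context cmv_measure
begin

text \<open>The function is split as \<open>f1 + (z - \<xi>) F2 + (z - \<xi>) F3\<close>, cut at the
  distances 1/M and \<epsilon>. The parts contribute 2, 32 and 64 times
  \<open>sqrt (c * \<eta>) * M\<close>, rounded up to 100; \<open>C\<close> absorbs the finitely
  many partial sums of the last part that precede its small tail.\<close>

lemma strong_sum_bound:
  assumes \<xi>: "norm \<xi> = 1"
    and kernel: "\<And>n::nat. n \<ge> 1 \<Longrightarrow>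
           (1 / real n) * (\<Sum>k\<le>n. (norm (e k \<xi>))\<^sup>2) \<le> c / poisson_ext \<mu> (of_real (1 - 1 / real n) * \<xi>)"
    and h: "L2_fun \<mu> h" and \<eta>: "\<eta> > 0" and \<epsilon>: "\<epsilon> > 0"
    and avg: "\<And>\<rho>. 0 < \<rho> \<Longrightarrow> \<rho> \<le> \<epsilon> \<Longrightarrow> (LINT z:ball \<xi> \<rho>|\<mu>. (norm (h z))\<^sup>2) \<le> \<eta> * measure \<mu> (ball \<xi> \<rho>)"
  obtains C where "\<forall>\<^sub>F n in sequentially. 
    (\<Sum>k<n. norm (cmv_partial_sum \<mu> k h \<xi>)) \<le> C + 100 * sqrt (c * \<eta>) * (real n + 2)"
proof -
  have [measurable]: "h \<in> borel_measurable borel"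
    using h by (auto simp: L2_fun_def cong: measurable_cong_sets)
  have hint: "integrable \<mu> (\<lambda>z. (norm (h z))\<^sup>2)" using h by (simp add: L2_fun_def)
  \<comment> \<open>For n = 1 the Poisson extension is taken at the origin, and a nonnegative left
    side forces the sign needed under the square roots.\<close>
  have c: "c \<ge> 0"
  proof -
    have "0 \<le> c / poisson_ext \<mu> (of_real (1 - 1 / real 1) * \<xi>)"
      by (rule order_trans[OF _ kernel[of 1]]) (auto intro!: mult_nonneg_nonneg sum_nonneg)
    moreover have "poisson_ext \<mu> (of_real (1 - 1 / real 1) * \<xi>) > 0"
      by (rule less_le_trans[OF _ poisson_ext_ge[OF \<xi>, of 1]]) auto
    ultimately show ?thesis by (simp add: zero_le_divide_iff)
  qed
  \<comment> \<open>The far part depends on \<epsilon> but not on n; this makes a fixed tail index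
    \<open>N\<close> possible.\<close>
  define F3 where "F3 z = (if dist \<xi> z < \<epsilon> then 0 else 1 / (z - \<xi>)) * h z" for z
  have F3: "L2_fun \<mu> F3" unfolding F3_def
    by (rule L2_circle_mult[OF h, where B = "1 / \<epsilon>"])
       (use \<epsilon> in \<open>auto simp: norm_divide dist_norm norm_minus_commute intro!: divide_left_mono mult_pos_pos\<close>)
  have "summable (\<lambda>i. (norm (L2_inner \<mu> F3 (e i)))\<^sup>2)"
    using Bessel[OF F3] by (intro summableI_nonneg_bounded) auto
  then obtain N where "\<forall>m\<ge>N. \<forall>n. norm (\<Sum>i=m..<n. (norm (L2_inner \<mu> F3 (e i)))\<^sup>2) < \<eta>"
    using \<eta> unfolding summable_Cauchy by blast
  then have N: "(\<Sum>i=N..<n. (norm (L2_inner \<mu> F3 (e i)))\<^sup>2) < \<eta>" for n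
    by (auto simp: sum_nonneg)
  define S3 where "S3 k = norm (cmv_partial_sum \<mu> k (\<lambda>z. (z - \<xi>) * F3 z) \<xi>)" for k
  \<comment> \<open>A window around k starts at k - 1, so blocks with k \<ge> \<open>Suc N\<close>
    meet only coefficients of index at least \<open>N\<close>.\<close>
  define C where "C = (\<Sum>k<Suc N. S3 k)"
  have "\<forall>\<^sub>F n in sequentially. 1 / real n < \<epsilon>"
    using \<epsilon> by real_asymp
  then have "\<forall>\<^sub>F n in sequentially. 
    (\<Sum>k<n. norm (cmv_partial_sum \<mu> k h \<xi>)) \<le> C + 100 * sqrt (c * \<eta>) * (real n + 2)"
    using eventually_gt_at_top[of "Suc N"]
  proof eventually_elim
    case (elim n)
    \<comment> \<open>The commutator bound involves basis values up to index n + 2, so the kernel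
      hypothesis is applied there.\<close>
    define M where "M = n + 2"
    define r where "r = 1 - 1 / real M"
    have M: "M \<ge> 1" "real M > 0" by (auto simp: M_def)
    have "1 / real M \<le> 1 / real n" using elim(2) by (intro divide_left_mono) (auto simp: M_def)
    then have M\<epsilon>: "1 / real M < \<epsilon>" using elim(1) by linarith
    have r: "0 \<le> r" "r < 1" using M by (auto simp: r_def)
    define P where "P = poisson_ext \<mu> (of_real r * \<xi>)"
    have P_ge: "P \<ge> 1 / (5 * real M)" unfolding P_def r_def by (rule poisson_ext_ge[OF \<xi> M(1)])
    have P: "P > 0" by (rule less_le_trans[OF _ P_ge]) (use M in auto)
    define B where "B = (\<Sum>i\<le>M. (norm (e i \<xi>))\<^sup>2)"
    have B_nonneg: "B \<ge> 0" unfolding B_def by (intro sum_nonneg) auto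
    have B: "B \<le> c * M / P"
      using kernel[OF M(1)] M P unfolding B_def[symmetric] P_def r_def by (simp add: field_simps)
    \<comment> \<open>Inserting the general lower bound for \<open>P\<close> gives quadratic growth,
      which is tolerable only next to the small tail of \<open>F3\<close>.\<close>
    have B': "B \<le> 5 * c * (real M)\<^sup>2"
    proof -
      have "c * M / P \<le> c * M / (1 / (5 * real M))"
        using c M by (intro divide_left_mono P_ge mult_nonneg_nonneg mult_pos_pos P) auto
      with B show ?thesis by (simp add: power2_eq_square mult_ac)
    qed
    define I where "I = (LINT z|\<mu>. indicator (ball \<xi> \<epsilon>) z * ((norm (h z))\<^sup>2 * radial_poisson r (dist \<xi> z)))"
    have I_int: "integrable \<mu> (\<lambda>z. indicator (ball \<xi> \<epsilon>) z * ((norm (h z))\<^sup>2 * radial_poisson r (dist \<xi> z)))"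
      by (rule weighted_ball_integral_le(1)[OF h \<xi> r less_imp_le[OF \<eta>]]) (rule avg)
    have I_le: "I \<le> \<eta> * P"
      unfolding I_def P_def by (rule weighted_ball_integral_le(2)[OF h \<xi> r less_imp_le[OF \<eta>]]) (rule avg)
    have I_nonneg: "I \<ge> 0" unfolding I_def
      by (intro Bochner_Integration.integral_nonneg mult_nonneg_nonneg) 
         (auto simp: less_imp_le[OF radial_poisson_pos[OF r]])
    \<comment> \<open>The Poisson extension cancels here: the bound for \<open>I\<close> carries
      \<open>P\<close>, the bound for \<open>B\<close> carries its inverse.\<close>
    have IB: "I * B \<le> c * \<eta> * M"
    proof -
      have "I * B \<le> (\<eta> * P) * (c * M / P)"
        by (intro mult_mono I_le B B_nonneg mult_nonneg_nonneg) (use \<eta> P in auto)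
      then show ?thesis using P by (simp add: mult_ac)
    qed
    have I_mono: "(LINT z|\<mu>. (norm (g z))\<^sup>2) \<le> a * I"
      if [measurable]: "g \<in> borel_measurable borel" and a: "a \<ge> 0" and
        g: "\<And>z. (norm (g z))\<^sup>2 \<le> a * (indicator (ball \<xi> \<epsilon>) z * ((norm (h z))\<^sup>2 * radial_poisson r (dist \<xi> z)))" for g :: "complex \<Rightarrow> complex" and a
    proof -
      have "(LINT z|\<mu>. (norm (g z))\<^sup>2) \<le> 
          (LINT z|\<mu>. a * (indicator (ball \<xi> \<epsilon>) z * ((norm (h z))\<^sup>2 * radial_poisson r (dist \<xi> z))))"
        using integrable_mult_right[OF I_int, of a] g 
        by (intro integral_mono Bochner_Integration.integrable_bound[OF integrable_mult_right[OF I_int, of a]])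
           (auto intro!: AE_I2 order_trans[OF g])
      then show ?thesis by (simp add: I_def)
    qed
    define f1 where "f1 z = (if dist \<xi> z < 1 / real M then 1 else 0) * h z" for z
    define F2 where "F2 z = (if dist \<xi> z < 1 / real M \<or> dist \<xi> z \<ge> \<epsilon> then 0 else 1 / (z - \<xi>)) * h z" for z
    have f1: "L2_fun \<mu> f1" unfolding f1_def
      by (rule L2_circle_mult[OF h, where B = 1]) auto
    have F2: "L2_fun \<mu> F2" unfolding F2_def
    proof (rule L2_circle_mult[OF h, where B = "M"])
      fix z
      have "1 / dist \<xi> z \<le> M" if "\<not> dist \<xi> z < 1 / real M"
      proof -
        have "0 < 1 / real M" "1 / real M \<le> dist \<xi> z" using that M by auto
        then have "1 / dist \<xi> z \<le> 1 / (1 / real M)" by (intro frac_le) auto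
        then show ?thesis by simp
      qed
      then show "norm (if dist \<xi> z < 1 / real M \<or> \<epsilon> \<le> dist \<xi> z then 0 else 1 / (z - \<xi>)) \<le> real M"
        by (cases "dist \<xi> z < 1 / real M \<or> \<epsilon> \<le> dist \<xi> z")
           (simp_all add: norm_divide dist_commute[of \<xi>] flip: dist_norm)
    qed auto
    have [measurable]: "f1 \<in> borel_measurable borel" "F2 \<in> borel_measurable borel"
      using f1 F2 by (auto simp: L2_fun_def cong: measurable_cong_sets)
    \<comment> \<open>Inside the disc of radius 1/M the kernel is at least M/2.\<close>
    have f1_le: "(LINT z|\<mu>. (norm (f1 z))\<^sup>2) \<le> (2 / M) * I"
    proof (rule I_mono)
      fix z
      show "(norm (f1 z))\<^sup>2 \<le> 2 / M * (indicator (ball \<xi> \<epsilon>) z * ((norm (h z))\<^sup>2 * radial_poisson r (dist \<xi> z)))"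
      proof (cases "dist \<xi> z < 1 / real M")
        case True
        have "1 \<le> 2 / M * radial_poisson r (dist \<xi> z)"
          using radial_poisson_ge_near[OF M(1), of "dist \<xi> z"] True M by (simp add: r_def field_simps)
        from mult_right_mono[OF this, of "(norm (h z))\<^sup>2"] True M\<epsilon> show ?thesis
          by (simp add: f1_def mult_ac)
      next
        case False
        then show ?thesis
          by (auto simp: f1_def less_imp_le[OF radial_poisson_pos[OF r]])
      qed
    qed auto
    \<comment> \<open>At distance t between 1/M and \<epsilon> the kernel is at least 1/(2 M t^2),
      while |F2|^2 = |h|^2 / t^2.\<close>
    have F2_le: "(LINT z|\<mu>. (norm (F2 z))\<^sup>2) \<le> (2 * M) * I"
    proof (rule I_mono)
      fix z
      show "(norm (F2 z))\<^sup>2 \<le> 2 * M * (indicator (ball \<xi> \<epsilon>) z * ((norm (h z))\<^sup>2 * radial_poisson r (dist \<xi> z)))"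
      proof (cases "dist \<xi> z < 1 / real M \<or> dist \<xi> z \<ge> \<epsilon>")
        case True
        then show ?thesis
          by (auto simp: F2_def less_imp_le[OF radial_poisson_pos[OF r]] intro!: mult_nonneg_nonneg)
      next
        case False
        then have "2 * M * (1 / (2 * M * (dist \<xi> z)\<^sup>2)) \<le> 2 * M * radial_poisson r (dist \<xi> z)"
          using radial_poisson_ge_far[OF M(1), of "dist \<xi> z"]
          unfolding r_def by (intro mult_left_mono) auto
        then have "1 / (dist \<xi> z)\<^sup>2 \<le> 2 * M * radial_poisson r (dist \<xi> z)"
          using M by simp
        from mult_right_mono[OF this, of "(norm (h z))\<^sup>2"] False show ?thesis
          by (simp add: F2_def mult_ac norm_mult norm_divide power_mult_distrib power_divide dist_norm norm_minus_commute)
      qed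
    qed auto
    \<comment> \<open>The point \<xi> itself belongs to \<open>f1\<close>, so no division by zero
      enters \<open>F2\<close> or \<open>F3\<close>.\<close>
    have h_eq: "h = (\<lambda>z. f1 z + ((z - \<xi>) * F2 z + (z - \<xi>) * F3 z))"
    proof
      fix z
      have "z \<noteq> \<xi>" if "\<not> dist \<xi> z < 1 / real M"
        using that M by auto
      then show "h z = f1 z + ((z - \<xi>) * F2 z + (z - \<xi>) * F3 z)"
        using M\<epsilon> by (auto simp: f1_def F2_def F3_def)
    qed
    have zF: "L2_fun \<mu> (\<lambda>z. (z - \<xi>) * F2 z)" "L2_fun \<mu> (\<lambda>z. (z - \<xi>) * F3 z)"
      by (rule L2_circle_mult[where B = 2], 
          use F2 F3 dist_circle_le_2[OF \<xi>] in \<open>auto simp: dist_norm norm_minus_commute\<close>)+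
    have decomp: "cmv_partial_sum \<mu> k h \<xi> = cmv_partial_sum \<mu> k f1 \<xi> + 
       (cmv_partial_sum \<mu> k (\<lambda>z. (z - \<xi>) * F2 z) \<xi> + cmv_partial_sum \<mu> k (\<lambda>z. (z - \<xi>) * F3 z) \<xi>)" for k
      by (subst h_eq) (simp only: partial_sum_add[OF f1 L2_fun_add[OF zF]] partial_sum_add[OF zF])
    have "norm (cmv_partial_sum \<mu> k h \<xi>) \<le> norm (cmv_partial_sum \<mu> k f1 \<xi>) + 
       (norm (cmv_partial_sum \<mu> k (\<lambda>z. (z - \<xi>) * F2 z) \<xi>) + S3 k)" for k
      unfolding S3_def decomp by (rule order_trans[OF norm_triangle_ineq add_left_mono[OF norm_triangle_ineq]])
    then have "(\<Sum>k<n. norm (cmv_partial_sum \<mu> k h \<xi>)) \<le> (\<Sum>k<n. norm (cmv_partial_sum \<mu> k f1 \<xi>)) + 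
       ((\<Sum>k<n. norm (cmv_partial_sum \<mu> k (\<lambda>z. (z - \<xi>) * F2 z) \<xi>)) + (\<Sum>k<n. S3 k))"
      unfolding sum.distrib[symmetric] by (rule sum_mono)
    also have "(\<Sum>k<n. norm (cmv_partial_sum \<mu> k f1 \<xi>)) \<le> 2 * sqrt (c * \<eta>) * M"
    proof -
      have "(\<Sum>k<n. norm (cmv_partial_sum \<mu> k f1 \<xi>)) \<le> (\<Sum>k<n. sqrt ((2 / M) * I) * sqrt B)"
      proof (rule sum_mono)
        fix k assume "k \<in> {..<n}"
        then have "norm (cmv_partial_sum \<mu> k f1 \<xi>) \<le> sqrt (LINT z|\<mu>. (norm (f1 z))\<^sup>2) * sqrt B"
          unfolding B_def by (intro norm_partial_sum_le f1) (auto simp: M_def)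
        also have "\<dots> \<le> sqrt ((2 / M) * I) * sqrt B"
          using B_nonneg by (intro mult_right_mono real_sqrt_le_mono f1_le) auto
        finally show "norm (cmv_partial_sum \<mu> k f1 \<xi>) \<le> sqrt ((2 / M) * I) * sqrt B" .
      qed
      also have "\<dots> = n * sqrt ((2 / M) * (I * B))"
        by (simp add: mult.assoc real_sqrt_mult[symmetric])
      also have "\<dots> \<le> M * sqrt ((2 / M) * (c * \<eta> * M))"
      proof (intro mult_mono[OF _ real_sqrt_le_mono])
        show "(2 / M) * (I * B) \<le> (2 / M) * (c * \<eta> * M)" by (intro mult_left_mono IB) auto
      qed (use I_nonneg B_nonneg in \<open>auto simp: M_def\<close>)
      also have "(2 / M) * (c * \<eta> * M) = 2 * (c * \<eta>)" using M by simp
      also have "sqrt (2 * (c * \<eta>)) \<le> sqrt (4 * (c * \<eta>))"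
        using c \<eta> by (intro real_sqrt_le_mono mult_right_mono) auto
      finally show ?thesis using M by (simp add: real_sqrt_mult mult_ac)
    qed
    also have "(\<Sum>k<n. norm (cmv_partial_sum \<mu> k (\<lambda>z. (z - \<xi>) * F2 z) \<xi>)) \<le> 32 * sqrt (c * \<eta>) * M"
    proof -
      have "(\<Sum>k<n. norm (cmv_partial_sum \<mu> k (\<lambda>z. (z - \<xi>) * F2 z) \<xi>)) \<le>
        16 * sqrt (\<Sum>i=0..<n+2. (norm (L2_inner \<mu> F2 (e i)))\<^sup>2) * sqrt B"
        using sum_partial_sum_commutator_le[OF F2 \<xi>, of 0 n]
        unfolding B_def M_def atLeast0LessThan[symmetric] diff_0_eq_0 .
      also have "\<dots> \<le> 16 * sqrt ((2 * M) * I) * sqrt B"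
        using Bessel[OF F2, of "n+2"] F2_le B_nonneg 
        by (intro mult_right_mono mult_left_mono real_sqrt_le_mono) (auto simp: atLeast0LessThan simp del: sum.op_ivl_Suc sum.lessThan_Suc)
      also have "\<dots> = 16 * sqrt ((2 * M) * (I * B))"
        by (simp add: mult.assoc real_sqrt_mult[symmetric])
      also have "\<dots> \<le> 16 * sqrt ((2 * M) * (c * \<eta> * M))"
        by (intro mult_left_mono[OF real_sqrt_le_mono] mult_left_mono[OF IB]) auto
      also have "\<dots> \<le> 16 * sqrt (4 * (c * \<eta>) * (real M)\<^sup>2)"
        using c \<eta> by (intro mult_left_mono real_sqrt_le_mono) (auto simp: power2_eq_square)
      finally show ?thesis using M by (simp add: real_sqrt_mult)
    qed
    also have "(\<Sum>k<n. S3 k) \<le> C + 64 * sqrt (c * \<eta>) * M"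
    proof -
      have "(\<Sum>k<n. S3 k) = C + (\<Sum>k=Suc N..<n. S3 k)"
        unfolding C_def using elim(2) 
        by (subst sum.atLeastLessThan_concat[of 0 "Suc N" n, symmetric, simplified atLeast0LessThan]) (auto simp: atLeast0LessThan)
      \<comment> \<open>The tail from \<open>N\<close> on is below \<eta>, and its root times the
        root of the quadratic bound for \<open>B\<close> is linear in M.\<close>
      also have "(\<Sum>k=Suc N..<n. S3 k) \<le> 16 * sqrt (\<Sum>i=N..<n+2. (norm (L2_inner \<mu> F3 (e i)))\<^sup>2) * sqrt B"
        using sum_partial_sum_commutator_le[OF F3 \<xi>, of "Suc N" n] unfolding B_def M_def S3_def diff_Suc_1 .
      also have "\<dots> \<le> 16 * sqrt \<eta> * sqrt (5 * c * (real M)\<^sup>2)"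
        using B' B_nonneg \<eta> less_imp_le[OF N[of "n+2"]]
        by (intro mult_mono real_sqrt_le_mono) (auto intro!: sum_nonneg simp del: sum.op_ivl_Suc)
      also have "\<dots> \<le> 16 * sqrt \<eta> * sqrt (16 * c * (real M)\<^sup>2)"
        using c \<eta> by (intro mult_left_mono real_sqrt_le_mono mult_right_mono) auto
      also have "\<dots> = 64 * sqrt (c * \<eta>) * M"
        using M by (simp add: real_sqrt_mult)
      finally show ?thesis by simp
    qed
    finally have "(\<Sum>k<n. norm (cmv_partial_sum \<mu> k h \<xi>)) \<le> C + 98 * sqrt (c * \<eta>) * M"
      by (simp add: mult_ac)
    also have "\<dots> \<le> C + 100 * sqrt (c * \<eta>) * M"
      using c \<eta> by (intro add_left_mono mult_right_mono) auto
    finally show ?case by (simp add: M_def add.commute)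
  qed
  then show thesis by (rule that)
qed

theorem strong_cesaro_at_lebesgue_point:
  assumes \<xi>: "norm \<xi> = 1"
    and kernel: "\<And>n::nat. n \<ge> 1 \<Longrightarrow>
           (1 / real n) * (\<Sum>k\<le>n. (norm (e k \<xi>))\<^sup>2) \<le> c / poisson_ext \<mu> (of_real (1 - 1 / real n) * \<xi>)"
    and f: "L2_fun \<mu> f" and leb: "lebesgue_point_value \<mu> f \<xi> v"
  shows "strong_cesaro_at \<mu> f \<xi> v"
proof -
  obtain g where g: "L2_fun \<mu> g" "AE z in \<mu>. g z = f z" "g \<xi> = v"
    and lim: "((\<lambda>\<epsilon>. (LINT z:ball \<xi> \<epsilon>|\<mu>. (norm (g z - g \<xi>))\<^sup>2) / measure \<mu> (ball \<xi> \<epsilon>)) \<longlongrightarrow> 0) (at_right 0)"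
    and supp: "\<xi> \<in> msupport \<mu>"
    using leb unfolding lebesgue_point_value_def by auto
  define h where "h z = g z - v" for z
  have v: "L2_fun \<mu> (\<lambda>z. v)" by (auto simp: L2_fun_def)
  have h: "L2_fun \<mu> h" unfolding h_def by (intro L2_fun_diff g v)
  have S: "cmv_partial_sum \<mu> k f \<xi> - v = cmv_partial_sum \<mu> k h \<xi>" for k
  proof -
    have "cmv_partial_sum \<mu> k f \<xi> = cmv_partial_sum \<mu> k (\<lambda>z. h z + v) \<xi>"
      using f g by (intro partial_sum_cong_AE) (auto simp: L2_fun_def h_def)
    also have "\<dots> = cmv_partial_sum \<mu> k h \<xi> + v"
      by (simp add: partial_sum_add[OF h v] partial_sum_const)
    finally show ?thesis by simp
  qed
  have bound: "\<exists>C. \<forall>\<^sub>F n in sequentially. 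
    (\<Sum>k<n. norm (cmv_partial_sum \<mu> k h \<xi>)) \<le> C + 100 * sqrt (c * \<eta>) * (real n + 2)" if "\<eta> > 0" for \<eta>
  proof -
    from order_tendstoD(2)[OF lim that] obtain b where b: "b > 0"
      "\<And>\<rho>. 0 < \<rho> \<Longrightarrow> \<rho> < b \<Longrightarrow> (LINT z:ball \<xi> \<rho>|\<mu>. (norm (g z - g \<xi>))\<^sup>2) / measure \<mu> (ball \<xi> \<rho>) < \<eta>"
      unfolding eventually_at_right_field by auto
    show ?thesis
    proof (rule strong_sum_bound[OF \<xi> kernel h that, of "b / 2"])
      fix \<rho> :: real assume \<rho>: "0 < \<rho>" "\<rho> \<le> b / 2"
      \<comment> \<open>Membership in the support allows the averaged condition to be multiplied
        out; b / 2 replaces the open range of radii below b by a closed one.\<close>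
      have "measure \<mu> (ball \<xi> \<rho>) > 0"
        using supp \<rho> by (auto simp: msupport_def emeasure_eq_measure)
      then show "(LINT z:ball \<xi> \<rho>|\<mu>. (norm (h z))\<^sup>2) \<le> \<eta> * measure \<mu> (ball \<xi> \<rho>)"
        using b(2)[of \<rho>] \<rho> b(1) g(3) by (simp add: h_def field_simps)
    qed (use b in auto)
  qed
  show ?thesis unfolding strong_cesaro_at_def S
  proof (rule tendstoI)
    fix \<delta> :: real assume \<delta>: "\<delta> > 0"
    \<comment> \<open>With this choice 100 sqrt (c \<eta>) is at most \<delta>/4; the summand 1
      keeps the denominator positive.\<close>
    define \<eta> where "\<eta> = (\<delta> / 400)\<^sup>2 / (\<bar>c\<bar> + 1)"
    have \<eta>: "\<eta> > 0" using \<delta> unfolding \<eta>_def by (intro divide_pos_pos) auto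
    have "c * \<eta> \<le> (\<delta> / 400)\<^sup>2"
    proof -
      have "c * \<eta> \<le> (\<bar>c\<bar> + 1) * \<eta>" using \<eta> by (intro mult_right_mono) auto
      also have "\<dots> = (\<delta> / 400)\<^sup>2" by (simp add: \<eta>_def)
      finally show ?thesis .
    qed
    then have sq: "sqrt (c * \<eta>) \<le> \<delta> / 400"
      using \<delta> by (metis abs_of_pos divide_pos_pos real_sqrt_abs real_sqrt_le_mono zero_less_numeral)
    obtain C where C: "\<forall>\<^sub>F n in sequentially. 
      (\<Sum>k<n. norm (cmv_partial_sum \<mu> k h \<xi>)) \<le> C + 100 * sqrt (c * \<eta>) * (real n + 2)"
      using bound[OF \<eta>] by auto
    have "\<forall>\<^sub>F n in sequentially. (1 / real n) * (C + 100 * (\<delta> / 400) * (real n + 2)) < \<delta>"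
      using \<delta> by real_asymp
    with C eventually_gt_at_top[of 0]
    show "\<forall>\<^sub>F n in sequentially. dist (1 / real n * (\<Sum>k<n. norm (cmv_partial_sum \<mu> k h \<xi>))) 0 < \<delta>"
    proof eventually_elim
      case (elim n)
      have "1 / real n * (\<Sum>k<n. norm (cmv_partial_sum \<mu> k h \<xi>)) \<le> 1 / real n * (C + 100 * (\<delta> / 400) * (real n + 2))"
        using elim(1) sq by (intro mult_left_mono order_trans[OF elim(1)] add_left_mono mult_right_mono) auto
      with elim(3) show ?case by (simp add: sum_nonneg)
    qed
  qed
qed

end

section \<open>Maximal inequality on the circle\<close>

text \<open>The Vitali selection yields a countable set of centre-radius pairs without an
  enumeration; this is subadditivity in the form that fits it.\<close>

lemma emeasure_UN_le_nn_integral: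
  assumes [measurable]: "\<And>i. i \<in> I \<Longrightarrow> X i \<in> sets M" and I [simp]: "countable I"
  shows "emeasure M (\<Union>(X ` I)) \<le> (\<integral>\<^sup>+i. emeasure M (X i) \<partial>count_space I)"
proof -
  note sets.countable_UN'[unfolded subset_eq, measurable]
  have "emeasure M (\<Union>(X ` I)) = (\<integral>\<^sup>+x. indicator (\<Union>(X ` I)) x \<partial>M)"
    by simp
  also have "\<dots> \<le> (\<integral>\<^sup>+x. \<integral>\<^sup>+i. indicator (X i) x \<partial>count_space I \<partial>M)"
  proof (intro nn_integral_mono)
    fix x
    show "indicator (\<Union>(X ` I)) x \<le> (\<integral>\<^sup>+i. (indicator (X i) x::ennreal) \<partial>count_space I)"
    proof (cases "x \<in> \<Union>(X ` I)")
      case True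
      then obtain j where j: "j \<in> I" "x \<in> X j" by auto
      have "indicator (X j) x \<le> (\<integral>\<^sup>+i. (indicator (X i) x::ennreal) \<partial>count_space I)"
        using j(1) by (rule nn_integral_ge_point)
      with True j show ?thesis by simp
    qed simp
  qed
  also have "\<dots> = (\<integral>\<^sup>+i. \<integral>\<^sup>+x. indicator (X i) x \<partial>M \<partial>count_space I)"
    by (simp add: nn_integral_count_space_nn_integral)
  finally show ?thesis
    by (simp cong: nn_integral_cong_simp)
qed

text \<open>The mean value theorem with cos \<ge> 1/2 covers [0, pi/3]; beyond it sin is at least
  1/2 while x/4 stays below that. The constant is not sharp, as only linear growth matters.\<close>

lemma sin_ge_quarter:
  fixes x :: real
  assumes "0 \<le> x" "x \<le> pi / 2"
  shows "x / 4 \<le> sin x"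
proof (cases "x \<le> pi / 3")
  case True
  show ?thesis
  proof (cases "x = 0")
    case False
    then obtain z where z: "0 < z" "z < x" "sin x - sin 0 = (x - 0) * cos z"
      using MVT2[of 0 x sin cos] assms(1) by (auto intro: derivative_eq_intros)
    have "cos z \<ge> cos (pi / 3)"
      using z True by (intro cos_monotone_0_pi_le) auto
    then have "x * (1 / 2) \<le> x * cos z"
      using assms by (intro mult_left_mono) (auto simp: cos_60)
    with z assms show ?thesis by simp
  qed simp
next
  case False
  have "sin (pi / 6) \<le> sin x"
    using False assms pi_gt_zero by (intro sin_monotone_2pi_le) (auto simp: field_simps)
  then show ?thesis using assms pi_less_4 by (simp add: sin_30)
qed

lemma dist_cis: "dist (cis s) (cis t) = 2 * \<bar>sin ((s - t) / 2)\<bar>"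
proof -
  have *: "2 * ((s - t) / 2) = s - t" by simp
  have "(dist (cis s) (cis t))\<^sup>2 = (cos s - cos t)\<^sup>2 + (sin s - sin t)\<^sup>2"
    by (simp add: dist_norm cmod_power2)
  also have "\<dots> = 2 - 2 * cos (s - t)"
    using sin_cos_squared_add3[of s] sin_cos_squared_add3[of t]
    by (simp add: cos_diff power2_eq_square algebra_simps)
  also have "\<dots> = (2 * \<bar>sin ((s - t) / 2)\<bar>)\<^sup>2"
    using cos_double_sin[of "(s - t) / 2"] by (simp only: *) (simp add: power_mult_distrib)
  finally show ?thesis by (rule power2_eq_imp_eq) auto
qed

lemma unit_circle_cis:
  assumes "norm \<xi> = 1"
  obtains s where "0 \<le> s" "s < 2 * pi" "\<xi> = cis s"
  using complex_unimodular_polar[OF assms] unfolding cis_conv_exp[symmetric] cis.code by metis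

lemma sets_circle_lebesgue [measurable_cong, simp]: "sets circle_lebesgue = sets borel"
  by (simp add: circle_lebesgue_def)

lemma space_circle_lebesgue [simp]: "space circle_lebesgue = UNIV"
  by (simp add: circle_lebesgue_def)

lemma cis_measurable [measurable]: "cis \<in> borel_measurable borel"
  unfolding cis_conv_exp[abs_def] by measurable

lemma prob_space_circle_lebesgue: "prob_space circle_lebesgue"
  unfolding circle_lebesgue_def
  by (intro prob_space.prob_space_distr prob_space_uniform_measure)
     (use pi_gt_zero in \<open>auto simp: ennreal_eq_0_iff not_le\<close>)

lemma emeasure_circle_lebesgue:
  assumes "A \<in> sets borel"
  shows "emeasure circle_lebesgue A = emeasure lborel ({0..2 * pi} \<inter> cis -` A) / ennreal (2 * pi)"
  using measurable_sets_borel[OF cis_measurable assms]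
  unfolding circle_lebesgue_def
  by (subst emeasure_distr) (use assms in \<open>auto simp: emeasure_uniform_measure\<close>)

interpretation circle: prob_space circle_lebesgue
  by (rule prob_space_circle_lebesgue)

lemma AE_circle_lebesgue: "AE \<zeta> in circle_lebesgue. \<zeta> \<in> sphere 0 1"
  by (rule AE_I[of _ _ "- sphere 0 1"]) (auto simp: emeasure_circle_lebesgue vimage_def)

lemma circle_lebesgue_ball_le:
  assumes "norm \<xi> = 1" "0 < \<rho>"
  shows "emeasure circle_lebesgue (ball \<xi> \<rho>) \<le> ennreal (3 * \<rho>)"
proof -
  obtain s where s: "0 \<le> s" "s < 2 * pi" "\<xi> = cis s"
    using unit_circle_cis[OF assms(1)] .
  \<comment> \<open>Angles live in [0, 2 pi], so an arc may wrap around and leave pieces at both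
    ends besides the interval about s. The total length 16 \<rho> divided by 2 pi is below 3
    \<rho>.\<close>
  have sub: "{0..2 * pi} \<inter> cis -` ball \<xi> \<rho> \<subseteq> {s - 4 * \<rho>..s + 4 * \<rho>} \<union> {0..4 * \<rho>} \<union> {2 * pi - 4 * \<rho>..2 * pi}"
  proof
    fix t assume t: "t \<in> {0..2 * pi} \<inter> cis -` ball \<xi> \<rho>"
    define x where "x = \<bar>s - t\<bar> / 2"
    have x: "0 \<le> x" "x \<le> pi" using s t by (auto simp: x_def)
    have "\<bar>sin ((s - t) / 2)\<bar> = sin x"
    proof -
      have "sin x \<ge> 0" using x by (rule sin_ge_zero)
      moreover have "(s - t) / 2 = x \<or> (s - t) / 2 = - x"
        by (auto simp: x_def abs_if field_simps)
      ultimately show ?thesis by auto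
    qed
    then have *: "2 * sin x < \<rho>" using t by (simp add: s dist_cis)
    show "t \<in> {s - 4 * \<rho>..s + 4 * \<rho>} \<union> {0..4 * \<rho>} \<union> {2 * pi - 4 * \<rho>..2 * pi}"
    proof (cases "x \<le> pi / 2")
      case True
      with sin_ge_quarter[of x] x * have "x < 2 * \<rho>" by simp
      then show ?thesis by (auto simp: x_def)
    next
      case False
      with sin_ge_quarter[of "pi - x"] x * have "pi - x < 2 * \<rho>" by simp
      then have "\<bar>s - t\<bar> > 2 * pi - 4 * \<rho>" by (simp add: x_def)
      then show ?thesis using s t by (cases "s \<ge> t") auto
    qed
  qed
  have "emeasure lborel ({0..2 * pi} \<inter> cis -` ball \<xi> \<rho>) \<le> 
      emeasure lborel ({s - 4 * \<rho>..s + 4 * \<rho>} \<union> {0..4 * \<rho>} \<union> {2 * pi - 4 * \<rho>..2 * pi})"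
    by (intro emeasure_mono sub) auto
  also have "\<dots> \<le> emeasure lborel {s - 4 * \<rho>..s + 4 * \<rho>} + emeasure lborel {0..4 * \<rho>} + emeasure lborel {2 * pi - 4 * \<rho>..2 * pi}"
    by (intro order_trans[OF emeasure_subadditive] add_right_mono emeasure_subadditive) auto
  also have "\<dots> = ennreal (16 * \<rho>)"
    using assms by (simp flip: ennreal_plus)
  finally have "emeasure circle_lebesgue (ball \<xi> \<rho>) \<le> ennreal (16 * \<rho>) / ennreal (2 * pi)"
    by (simp add: emeasure_circle_lebesgue divide_right_mono_ennreal)
  also have "\<dots> = ennreal (16 * \<rho> / (2 * pi))"
    using assms by (subst divide_ennreal) auto
  also have "\<dots> \<le> ennreal (3 * \<rho>)"
    using assms pi_gt3 by (intro ennreal_leI) (auto simp: field_simps)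
  finally show ?thesis .
qed

lemma circle_lebesgue_ball_ge:
  assumes "norm \<xi> = 1" "0 < \<rho>" "\<rho> \<le> 3"
  shows "emeasure circle_lebesgue (ball \<xi> \<rho>) \<ge> ennreal (\<rho> / 8)"
proof -
  obtain s where s: "0 \<le> s" "s < 2 * pi" "\<xi> = cis s"
    using unit_circle_cis[OF assms(1)] .
  \<comment> \<open>A one-sided interval of length \<rho> pointing away from the nearer end of
    [0, 2 pi]; \<rho> \<le> 3 < pi keeps it inside.\<close>
  define J where "J = (if s \<le> pi then {s..<s + \<rho>} else {s - \<rho><..s})"
  have J: "J \<subseteq> {0..2 * pi} \<inter> cis -` ball \<xi> \<rho>"
  proof
    fix t assume t: "t \<in> J"
    then have "\<bar>s - t\<bar> < \<rho>" by (auto simp: J_def split: if_splits)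
    then have "dist \<xi> (cis t) < \<rho>"
      using abs_sin_x_le_abs_x[of "(s - t) / 2"] by (simp add: s dist_cis)
    moreover have "t \<in> {0..2 * pi}"
      using t s assms pi_gt3 by (auto simp: J_def split: if_splits)
    ultimately show "t \<in> {0..2 * pi} \<inter> cis -` ball \<xi> \<rho>" by simp
  qed
  have "ennreal (\<rho> / 8) \<le> ennreal (\<rho> / (2 * pi))"
    using assms pi_less_4 by (intro ennreal_leI divide_left_mono) auto
  also have "\<dots> = ennreal \<rho> / ennreal (2 * pi)"
    using assms by (subst divide_ennreal) auto
  also have "ennreal \<rho> = emeasure lborel J"
    using assms by (simp add: J_def)
  also have "\<dots> / ennreal (2 * pi) \<le> emeasure lborel ({0..2 * pi} \<inter> cis -` ball \<xi> \<rho>) / ennreal (2 * pi)"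
    using measurable_sets_borel[OF cis_measurable, of "ball \<xi> \<rho>"]
    by (intro divide_right_mono_ennreal emeasure_mono J) auto
  finally show ?thesis by (simp add: emeasure_circle_lebesgue)
qed

text \<open>The discs selected by Vitali are disjoint and lie in U, and each radius is below the
  \<nu>-measure of its disc divided by \<kappa>. Their fivefold enlargements have Lebesgue measure
  at most 3 * 5 times the radius, hence the 15. A Borel superset of the bad points avoids
  measurability questions for the maximal function, and U keeps the bound local.\<close>

lemma weak_type_maximal:
  fixes \<nu> :: "complex measure"
  assumes "finite_measure \<nu>" and sets: "sets \<nu> = sets borel" and U: "open U" and \<kappa>: "\<kappa> > 0"
  obtains B where "B \<in> sets borel" "emeasure circle_lebesgue B \<le> ennreal (15 * measure \<nu> U / \<kappa>)"
    "\<And>\<xi> \<rho>. norm \<xi> = 1 \<Longrightarrow> 0 < \<rho> \<Longrightarrow> ball \<xi> \<rho> \<subseteq> U \<Longrightarrow> measure \<nu> (ball \<xi> \<rho>) > \<kappa> * \<rho> \<Longrightarrow> \<xi> \<in> B"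
proof -
  interpret \<nu>: finite_measure \<nu> by fact
  define K where "K = {(\<xi>, \<rho>). norm \<xi> = 1 \<and> 0 < \<rho> \<and> ball \<xi> \<rho> \<subseteq> U \<and> measure \<nu> (ball \<xi> \<rho>) > \<kappa> * \<rho>}"
  have r: "0 < snd i \<and> snd i \<le> measure \<nu> U / \<kappa>" if "i \<in> K" for i
  proof -
    have "\<kappa> * snd i < measure \<nu> (ball (fst i) (snd i))" "0 < snd i" "ball (fst i) (snd i) \<subseteq> U"
      using that by (auto simp: K_def)
    moreover from this have "measure \<nu> (ball (fst i) (snd i)) \<le> measure \<nu> U"
      using U sets by (intro \<nu>.finite_measure_mono) auto
    ultimately show ?thesis using \<kappa> by (simp add: field_simps)
  qed
  obtain C where C: "countable C" "C \<subseteq> K"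
     "pairwise (\<lambda>i j. disjnt (ball (fst i) (snd i)) (ball (fst j) (snd j))) C"
     "(\<Union>i\<in>K. ball (fst i) (snd i)) \<subseteq> (\<Union>i\<in>C. ball (fst i) (5 * snd i))"
    by (rule Vitali_covering_lemma_balls[OF order_refl, of K snd "measure \<nu> U / \<kappa>" fst]) (use r in auto)
  define B where "B = (\<Union>i\<in>C. ball (fst i) (5 * snd i))"
  show thesis
  proof (rule that)
    show "B \<in> sets borel" unfolding B_def using C(1) by (intro sets.countable_UN') auto
    have "emeasure circle_lebesgue B \<le> (\<integral>\<^sup>+i. emeasure circle_lebesgue (ball (fst i) (5 * snd i)) \<partial>count_space C)"
      unfolding B_def using C(1) by (intro emeasure_UN_le_nn_integral) auto
    also have "\<dots> \<le> (\<integral>\<^sup>+i. ennreal (15 / \<kappa>) * emeasure \<nu> (ball (fst i) (snd i)) \<partial>count_space C)"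
    proof (rule nn_integral_mono)
      fix i assume "i \<in> space (count_space C)"
      then have i: "norm (fst i) = 1" "0 < snd i" "\<kappa> * snd i < measure \<nu> (ball (fst i) (snd i))"
        using C(2) by (auto simp: K_def)
      have "emeasure circle_lebesgue (ball (fst i) (5 * snd i)) \<le> ennreal (3 * (5 * snd i))"
        using i by (intro circle_lebesgue_ball_le) auto
      also have "\<dots> \<le> ennreal ((15 / \<kappa>) * measure \<nu> (ball (fst i) (snd i)))"
        using i \<kappa> by (intro ennreal_leI) (auto simp: field_simps)
      also have "\<dots> = ennreal (15 / \<kappa>) * emeasure \<nu> (ball (fst i) (snd i))"
        using \<kappa> by (simp add: \<nu>.emeasure_eq_measure flip: ennreal_mult)
      finally show "emeasure circle_lebesgue (ball (fst i) (5 * snd i)) \<le> 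
          ennreal (15 / \<kappa>) * emeasure \<nu> (ball (fst i) (snd i))" .
    qed
    also have "\<dots> = ennreal (15 / \<kappa>) * (\<integral>\<^sup>+i. emeasure \<nu> (ball (fst i) (snd i)) \<partial>count_space C)"
      by (rule nn_integral_cmult) simp
    also have "(\<integral>\<^sup>+i. emeasure \<nu> (ball (fst i) (snd i)) \<partial>count_space C) = 
        emeasure \<nu> (\<Union>i\<in>C. ball (fst i) (snd i))"
      using C(1,3) by (intro emeasure_UN_countable[symmetric])
        (auto simp: sets disjoint_family_on_def pairwise_def disjnt_def)
    also have "\<dots> \<le> emeasure \<nu> U"
    proof (intro emeasure_mono UN_least)
      fix i assume "i \<in> C"
      then have "i \<in> K" using C(2) by blast
      then show "ball (fst i) (snd i) \<subseteq> U" by (simp add: K_def case_prod_beta)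
    qed (use U sets in auto)
    also have "ennreal (15 / \<kappa>) * emeasure \<nu> U = ennreal (15 * measure \<nu> U / \<kappa>)"
      using \<kappa> by (simp add: \<nu>.emeasure_eq_measure flip: ennreal_mult)
    finally show "emeasure circle_lebesgue B \<le> ennreal (15 * measure \<nu> U / \<kappa>)"
      by (simp add: mult_left_mono)
  next
    fix \<xi> \<rho> assume "norm \<xi> = 1" "0 < \<rho>" "ball \<xi> \<rho> \<subseteq> U" "measure \<nu> (ball \<xi> \<rho>) > \<kappa> * \<rho>"
    then have "(\<xi>, \<rho>) \<in> K" by (simp add: K_def)
    then have "\<xi> \<in> (\<Union>i\<in>K. ball (fst i) (snd i))" using \<open>0 < \<rho>\<close> by force
    then show "\<xi> \<in> B" using C(4) unfolding B_def by (rule rev_subsetD)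
  qed
qed

text \<open>The intersection of the sets for 1, 1/2, 1/3, ... is null and contains every point where
  P fails, so P may be an arbitrary predicate.\<close>

lemma AE_by_small_exceptional_sets:
  assumes "\<And>\<delta>. \<delta> > 0 \<Longrightarrow> \<exists>B\<in>sets M. emeasure M B \<le> ennreal \<delta> \<and> (\<forall>x\<in>space M. x \<notin> B \<longrightarrow> P x)"
  shows "AE x in M. P x"
proof -
  have "\<exists>B\<in>sets M. emeasure M B \<le> ennreal (1 / real (Suc k)) \<and> (\<forall>x\<in>space M. x \<notin> B \<longrightarrow> P x)" for k
    by (rule assms) auto
  then obtain B where B: "\<And>k. B k \<in> sets M" "\<And>k. emeasure M (B k) \<le> ennreal (1 / real (Suc k))"
    "\<And>k x. x \<in> space M \<Longrightarrow> x \<notin> B k \<Longrightarrow> P x" by metis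
  have "emeasure M (\<Inter>k. B k) \<le> ennreal (1 / real (Suc k))" for k
    using B(1) by (intro order_trans[OF emeasure_mono B(2)]) auto
  moreover have "(\<lambda>k. ennreal (1 / real (Suc k))) \<longlonglongrightarrow> ennreal 0"
    by (intro tendsto_ennrealI) real_asymp
  ultimately have "emeasure M (\<Inter>k. B k) \<le> ennreal 0"
    by (intro LIMSEQ_le_const) auto
  then show ?thesis
    using B by (intro AE_I[of _ _ "\<Inter>k. B k"]) auto
qed

lemma AE_ball_measure_linear_bound:
  fixes \<nu> :: "complex measure"
  assumes fin: "finite_measure \<nu>" and sets: "sets \<nu> = sets borel"
  shows "AE \<xi> in circle_lebesgue. \<exists>A>0. \<forall>\<rho>>0. measure \<nu> (ball \<xi> \<rho>) \<le> A * \<rho>"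
proof -
  have "AE \<xi> in circle_lebesgue. \<xi> \<in> sphere 0 1 \<longrightarrow> (\<exists>A>0. \<forall>\<rho>>0. measure \<nu> (ball \<xi> \<rho>) \<le> A * \<rho>)"
  proof (rule AE_by_small_exceptional_sets)
    fix \<delta> :: real assume \<delta>: "\<delta> > 0"
    \<comment> \<open>This level makes the weak type bound at most \<delta>; the summand 1 keeps it
      positive even for the zero measure.\<close>
    define \<kappa> where "\<kappa> = 15 * (measure \<nu> UNIV + 1) / \<delta>"
    have \<kappa>: "\<kappa> > 0" using \<delta> unfolding \<kappa>_def by (intro divide_pos_pos mult_pos_pos add_nonneg_pos) auto
    obtain B where B: "B \<in> sets borel" "emeasure circle_lebesgue B \<le> ennreal (15 * measure \<nu> UNIV / \<kappa>)"
      "\<And>\<xi> \<rho>. norm \<xi> = 1 \<Longrightarrow> 0 < \<rho> \<Longrightarrow> ball \<xi> \<rho> \<subseteq> UNIV \<Longrightarrow> measure \<nu> (ball \<xi> \<rho>) > \<kappa> * \<rho> \<Longrightarrow> \<xi> \<in> B"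
      using weak_type_maximal[OF fin sets open_UNIV \<kappa>] by metis
    have "15 * measure \<nu> UNIV \<le> \<delta> * \<kappa>" using \<delta> by (simp add: \<kappa>_def)
    then have "15 * measure \<nu> UNIV / \<kappa> \<le> \<delta>" using \<kappa> by (simp add: field_simps)
    then have "emeasure circle_lebesgue B \<le> ennreal \<delta>"
      using B(2) by (meson ennreal_leI order_trans)
    with B(1,3) \<kappa> show "\<exists>B\<in>sets circle_lebesgue. emeasure circle_lebesgue B \<le> ennreal \<delta> \<and>
      (\<forall>\<xi>\<in>space circle_lebesgue. \<xi> \<notin> B \<longrightarrow> \<xi> \<in> sphere 0 1 \<longrightarrow> (\<exists>A>0. \<forall>\<rho>>0. measure \<nu> (ball \<xi> \<rho>) \<le> A * \<rho>))"
      by (intro bexI[of _ B] conjI ballI impI exI[of _ \<kappa>]) (auto simp: not_less[symmetric])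
  qed
  then show ?thesis using AE_circle_lebesgue by eventually_elim auto
qed

text \<open>Outer regularity encloses the null set A in an open U of small \<nu>-measure, and small
  discs about points of A stay in U; the local weak type inequality then bounds the exceptional set.
  In other words, the derivative of \<nu> vanishes almost everywhere on A.\<close>

lemma AE_ball_measure_sublinear:
  fixes \<nu> :: "complex measure"
  assumes fin: "finite_measure \<nu>" and sets: "sets \<nu> = sets borel" and A: "A \<in> sets borel" "emeasure \<nu> A = 0"
  shows "AE \<xi> in circle_lebesgue. \<xi> \<in> A \<longrightarrow> (\<forall>\<kappa>>0. \<exists>\<epsilon>>0. \<forall>\<rho>. 0 < \<rho> \<longrightarrow> \<rho> \<le> \<epsilon> \<longrightarrow> measure \<nu> (ball \<xi> \<rho>) \<le> \<kappa> * \<rho>)"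
proof -
  interpret \<nu>: finite_measure \<nu> by fact
  have *: "AE \<xi> in circle_lebesgue. \<xi> \<in> sphere 0 1 \<longrightarrow> \<xi> \<in> A \<longrightarrow> (\<exists>\<epsilon>>0. \<forall>\<rho>. 0 < \<rho> \<longrightarrow> \<rho> \<le> \<epsilon> \<longrightarrow> measure \<nu> (ball \<xi> \<rho>) \<le> \<kappa> * \<rho>)"
    if \<kappa>: "\<kappa> > 0" for \<kappa>
  proof (rule AE_by_small_exceptional_sets)
    fix \<delta> :: real assume \<delta>: "\<delta> > 0"
    have "(INF U \<in> {U. A \<subseteq> U \<and> open U}. emeasure \<nu> U) < ennreal (\<delta> * \<kappa> / 15)"
      using outer_regular[OF sets _ A(1)] \<nu>.emeasure_finite A(2) \<delta> \<kappa> by simp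
    then obtain U where U: "A \<subseteq> U" "open U" "emeasure \<nu> U < ennreal (\<delta> * \<kappa> / 15)"
      by (auto simp: INF_less_iff)
    then have "measure \<nu> U \<le> \<delta> * \<kappa> / 15"
      using \<delta> \<kappa> by (auto simp: \<nu>.emeasure_eq_measure ennreal_less_iff)
    then have le: "15 * measure \<nu> U / \<kappa> \<le> \<delta>" using \<kappa> by (simp add: field_simps)
    obtain B where B: "B \<in> sets borel" "emeasure circle_lebesgue B \<le> ennreal (15 * measure \<nu> U / \<kappa>)"
      "\<And>\<xi> \<rho>. norm \<xi> = 1 \<Longrightarrow> 0 < \<rho> \<Longrightarrow> ball \<xi> \<rho> \<subseteq> U \<Longrightarrow> measure \<nu> (ball \<xi> \<rho>) > \<kappa> * \<rho> \<Longrightarrow> \<xi> \<in> B"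
      using weak_type_maximal[OF fin sets U(2) \<kappa>] by metis
    show "\<exists>B\<in>sets circle_lebesgue. emeasure circle_lebesgue B \<le> ennreal \<delta> \<and>
      (\<forall>\<xi>\<in>space circle_lebesgue. \<xi> \<notin> B \<longrightarrow> \<xi> \<in> sphere 0 1 \<longrightarrow> \<xi> \<in> A \<longrightarrow> 
        (\<exists>\<epsilon>>0. \<forall>\<rho>. 0 < \<rho> \<longrightarrow> \<rho> \<le> \<epsilon> \<longrightarrow> measure \<nu> (ball \<xi> \<rho>) \<le> \<kappa> * \<rho>))"
    proof (intro bexI[of _ B] conjI ballI impI)
      show "emeasure circle_lebesgue B \<le> ennreal \<delta>"
        using B(2) le by (meson ennreal_leI order_trans)
      fix \<xi> assume \<xi>: "\<xi> \<notin> B" "\<xi> \<in> sphere 0 1" "\<xi> \<in> A"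
      then obtain \<epsilon> where \<epsilon>: "\<epsilon> > 0" "ball \<xi> \<epsilon> \<subseteq> U"
        using U(1,2) open_contains_ball by (metis subsetD)
      have "measure \<nu> (ball \<xi> \<rho>) \<le> \<kappa> * \<rho>" if "0 < \<rho>" "\<rho> \<le> \<epsilon>" for \<rho>
      proof (rule ccontr)
        assume "\<not> measure \<nu> (ball \<xi> \<rho>) \<le> \<kappa> * \<rho>"
        moreover have "ball \<xi> \<rho> \<subseteq> U" using \<epsilon>(2) subset_ball[OF that(2)] by blast
        ultimately have "\<xi> \<in> B" using \<xi>(2) that(1) by (intro B(3)) auto
        with \<xi>(1) show False by simp
      qed
      with \<epsilon>(1) show "\<exists>\<epsilon>>0. \<forall>\<rho>. 0 < \<rho> \<longrightarrow> \<rho> \<le> \<epsilon> \<longrightarrow> measure \<nu> (ball \<xi> \<rho>) \<le> \<kappa> * \<rho>" by blast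
    qed (use B(1) in simp)
  qed
  \<comment> \<open>Countably many levels reach every \<kappa> > 0 and cost a single null
    set.\<close>
  have "AE \<xi> in circle_lebesgue. \<forall>k. \<xi> \<in> sphere 0 1 \<longrightarrow> \<xi> \<in> A \<longrightarrow> 
      (\<exists>\<epsilon>>0. \<forall>\<rho>. 0 < \<rho> \<longrightarrow> \<rho> \<le> \<epsilon> \<longrightarrow> measure \<nu> (ball \<xi> \<rho>) \<le> (1 / real (Suc k)) * \<rho>)"
    unfolding AE_all_countable by (intro allI *) auto
  then show ?thesis
    using AE_circle_lebesgue
  proof eventually_elim
    case (elim \<xi>)
    show ?case
    proof (intro impI allI)
      fix \<kappa> :: real assume "\<xi> \<in> A" "\<kappa> > 0"
      obtain k where k: "1 / real (Suc k) < \<kappa>"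
        using nat_approx_posE[OF \<open>\<kappa> > 0\<close>] by blast
      obtain \<epsilon> where \<epsilon>: "\<epsilon> > 0" "\<And>\<rho>. 0 < \<rho> \<Longrightarrow> \<rho> \<le> \<epsilon> \<Longrightarrow> measure \<nu> (ball \<xi> \<rho>) \<le> (1 / real (Suc k)) * \<rho>"
        using elim \<open>\<xi> \<in> A\<close> by blast
      have "measure \<nu> (ball \<xi> \<rho>) \<le> \<kappa> * \<rho>" if "0 < \<rho>" "\<rho> \<le> \<epsilon>" for \<rho>
      proof -
        have "(1 / real (Suc k)) * \<rho> \<le> \<kappa> * \<rho>" using k that by (intro mult_right_mono) auto
        with \<epsilon>(2)[OF that] show ?thesis by linarith
      qed
      with \<epsilon>(1) show "\<exists>\<epsilon>>0. \<forall>\<rho>. 0 < \<rho> \<longrightarrow> \<rho> \<le> \<epsilon> \<longrightarrow> measure \<nu> (ball \<xi> \<rho>) \<le> \<kappa> * \<rho>" by blast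
    qed
  qed
qed

section \<open>Poisson formula and polynomials\<close>

lemma circle_lebesgue_integral:
  fixes f :: "complex \<Rightarrow> 'b::{banach, second_countable_topology}"
  assumes [measurable]: "f \<in> borel_measurable borel"
  shows "integral\<^sup>L circle_lebesgue f = (LINT t|lborel. (indicator {0..2 * pi} t / (2 * pi)) *\<^sub>R f (cis t))"
proof -
  have *: "uniform_measure lborel {0..2 * pi} = density lborel (\<lambda>t. ennreal (indicator {0..2 * pi} t / (2 * pi)))"
    unfolding uniform_measure_def
    by (intro arg_cong2[where f = density] refl ext) (auto simp: divide_ennreal[of 1 "2 * pi", simplified] split: split_indicator)
  have "integral\<^sup>L circle_lebesgue f = (LINT t|uniform_measure lborel {0..2 * pi}. f (cis t))"
    unfolding circle_lebesgue_def by (rule integral_distr) auto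
  also have "\<dots> = (LINT t|lborel. (indicator {0..2 * pi} t / (2 * pi)) *\<^sub>R f (cis t))"
    unfolding * by (rule integral_density) auto
  finally show ?thesis .
qed

lemma circle_lebesgue_integral_eq:
  fixes u :: "complex \<Rightarrow> real"
  assumes "u \<in> borel_measurable borel" "continuous_on {0..2 * pi} (\<lambda>t. u (cis t))"
    and I: "((\<lambda>t. u (cis t)) has_integral 2 * pi * I) {0..2 * pi}"
  shows "integral\<^sup>L circle_lebesgue u = I"
proof -
  have "integral\<^sup>L circle_lebesgue u = (LINT t|lborel. (1 / (2 * pi)) * (indicator {0..2 * pi} t *\<^sub>R u (cis t)))"
    using circle_lebesgue_integral[OF assms(1)] by simp
  also have "\<dots> = (1 / (2 * pi)) * (LINT t:{0..2 * pi}|lborel. u (cis t))"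
    unfolding set_lebesgue_integral_def by (rule integral_mult_right_zero)
  also have "(LINT t:{0..2 * pi}|lborel. u (cis t)) = integral {0..2 * pi} (\<lambda>t. u (cis t))"
    by (intro set_borel_integral_eq_integral borel_integrable_atLeastAtMost' assms)
  also have "\<dots> = 2 * pi * I" by (rule integral_unique[OF I])
  finally show ?thesis by simp
qed

text \<open>On the circle the denominator splits into a factor holomorphic in \<zeta> and one that
  turns into the Cauchy kernel.\<close>

lemma radial_poisson_kernel_eq:
  assumes "norm \<xi> = 1" "norm \<zeta> = 1"
  shows "complex_of_real (radial_poisson r (dist \<xi> \<zeta>)) = 
    (1 - of_real (r\<^sup>2)) / ((1 - cnj (of_real r * \<xi>) * \<zeta>) * (1 - (of_real r * \<xi>) * cnj \<zeta>))"
proof -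
  have "complex_of_real ((1 - r)\<^sup>2 + r * (dist \<xi> \<zeta>)\<^sup>2) = of_real ((norm (1 - cnj \<zeta> * (of_real r * \<xi>)))\<^sup>2)"
    by (simp only: circle_poisson_denom[OF assms])
  also have "\<dots> = (1 - (of_real r * \<xi>) * cnj \<zeta>) * (1 - cnj (of_real r * \<xi>) * \<zeta>)"
    unfolding complex_norm_square by (simp add: mult_ac)
  finally show ?thesis
    unfolding radial_poisson_def of_real_divide by (simp add: mult.commute)
qed

text \<open>This is Cauchy's formula for \<open>G\<close>, the product of g with the holomorphic
  part of the kernel. The factor \<open>1 - cnj z * u\<close> has no zero in the closed disc and
  equals 1 - r^2 at u = z, so \<open>G z = g z\<close>; on the circle
  \<open>u - z = u * (1 - z * cnj u)\<close> supplies the other factor.\<close>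

lemma Poisson_formula_has_integral:
  fixes g :: "complex \<Rightarrow> complex"
  assumes g: "g holomorphic_on cball 0 1" and \<xi>: "norm \<xi> = 1" and r: "0 \<le> r" "r < 1"
  shows "((\<lambda>t. g (cis t) * of_real (radial_poisson r (dist \<xi> (cis t)))) 
    has_integral 2 * pi * g (of_real r * \<xi>)) {0..2 * pi}"
proof -
  define z where "z = of_real r * \<xi>"
  have z: "norm z = r" using \<xi> r by (simp add: z_def norm_mult)
  define G where "G u = g u * (1 - of_real (r\<^sup>2)) / (1 - cnj z * u)" for u
  have nz: "1 - cnj z * u \<noteq> 0" if "norm u \<le> 1" for u
  proof
    assume "1 - cnj z * u = 0"
    then have "norm (cnj z * u) = 1" by simp
    moreover have "norm (cnj z * u) \<le> r * 1" unfolding norm_mult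
      using z r that by (intro mult_mono) auto
    ultimately show False using r by simp
  qed
  have "G holomorphic_on cball 0 1"
    unfolding G_def using nz by (intro holomorphic_intros g) auto
  then have "((\<lambda>u. G u / (u - z)) has_contour_integral (2 * of_real pi * \<i> * G z)) (circlepath 0 1)"
    by (rule Cauchy_integral_circlepath_simple) (use z r in auto)
  then have *: "((\<lambda>t. G (cis t) / (cis t - z) * \<i> * cis t) has_integral (2 * of_real pi * \<i> * G z)) {0..2 * pi}"
    unfolding circlepath_def by (subst (asm) has_contour_integral_part_circlepath_iff) auto
  have "G z = g z"
  proof -
    have "cnj z * z = of_real (r\<^sup>2)"
      using complex_norm_square[of z] z by (simp add: mult.commute)
    moreover have "(of_real (r\<^sup>2) :: complex) \<noteq> 1" 
      using r by (simp only: of_real_eq_1_iff) (simp add: power2_eq_1_iff)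
    ultimately show ?thesis by (simp add: G_def)
  qed
  with has_integral_mult_right[OF *, of "- \<i>"]
  have "((\<lambda>t. - \<i> * (G (cis t) / (cis t - z) * \<i> * cis t)) has_integral (2 * of_real pi * g z)) {0..2 * pi}"
    by (simp add: algebra_simps)
  moreover have "- \<i> * (G u / (u - z) * \<i> * u) = 
      g u * of_real (radial_poisson r (dist \<xi> u))" if u: "norm u = 1" for u
  proof -
    have "u * cnj u = 1" by (rule unit_circle_cnj[OF u])
    then have "u - z = u * (1 - z * cnj u)" by (simp add: algebra_simps)
    moreover have "u \<noteq> 0" using u by auto
    moreover have "- \<i> * (G u / (u - z) * \<i> * u) = G u * (u / (u - z))"
      by (simp only: mult.assoc mult.left_commute[of _ \<i>]) simp
    ultimately have "- \<i> * (G u / (u - z) * \<i> * u) = G u / (1 - z * cnj u)" by simp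
    then show ?thesis
      by (simp add: radial_poisson_kernel_eq[OF \<xi> u] G_def z_def)
  qed
  ultimately show ?thesis by (simp add: z_def)
qed

lemma continuous_radial_poisson_cis:
  assumes "0 \<le> r" "r < 1"
  shows "continuous_on A (\<lambda>t. radial_poisson r (dist \<xi> (cis t)))"
proof -
  have "continuous_on A (\<lambda>t. dist \<xi> (cis t))"
    unfolding cis_conv_exp by (intro continuous_intros)
  then show ?thesis
    using continuous_on_compose2[OF continuous_radial_poisson[OF assms]] by blast
qed

text \<open>Agreement of u with Re g is asked on the circle only: u can be a globally Borel
  expression, while g is controlled just on the closed disc.\<close>

lemma Poisson_formula_Re:
  fixes g :: "complex \<Rightarrow> complex"
  assumes g: "g holomorphic_on cball 0 1" and \<xi>: "norm \<xi> = 1" and r: "0 \<le> r" "r < 1"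
    and u: "u \<in> borel_measurable borel" "\<And>\<zeta>. norm \<zeta> = 1 \<Longrightarrow> u \<zeta> = Re (g \<zeta>)"
  shows "(LINT \<zeta>|circle_lebesgue. u \<zeta> * radial_poisson r (dist \<xi> \<zeta>)) = Re (g (of_real r * \<xi>))"
proof (rule circle_lebesgue_integral_eq)
  note [measurable] = radial_poisson_meas[OF r] u(1)
  show "(\<lambda>\<zeta>. u \<zeta> * radial_poisson r (dist \<xi> \<zeta>)) \<in> borel_measurable borel" by measurable
  have "continuous_on {0..2 * pi} (\<lambda>t. Re (g (cis t)))"
  proof (rule continuous_on_Re, rule continuous_on_compose2[OF holomorphic_on_imp_continuous_on[OF g]])
    show "continuous_on {0..2 * pi} cis" unfolding cis_conv_exp[abs_def] by (intro continuous_intros)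
  qed auto
  then show "continuous_on {0..2 * pi} (\<lambda>t. u (cis t) * radial_poisson r (dist \<xi> (cis t)))"
    by (subst u(2)) (auto intro!: continuous_intros continuous_radial_poisson_cis r)
  have "((\<lambda>t. Re (g (cis t) * of_real (radial_poisson r (dist \<xi> (cis t))))) 
    has_integral Re (2 * pi * g (of_real r * \<xi>))) {0..2 * pi}"
    using has_integral_linear[OF Poisson_formula_has_integral[OF g \<xi> r] bounded_linear_Re]
    by (simp add: o_def)
  then show "((\<lambda>t. u (cis t) * radial_poisson r (dist \<xi> (cis t))) has_integral 2 * pi * Re (g (of_real r * \<xi>))) {0..2 * pi}"
    by (simp add: u(2))
qed

lemma radial_poisson_integral:
  assumes "norm \<xi> = 1" "0 \<le> r" "r < 1"
  shows "(LINT \<zeta>|circle_lebesgue. radial_poisson r (dist \<xi> \<zeta>)) = 1"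
  using Poisson_formula_Re[of "\<lambda>_. 1" \<xi> r "\<lambda>_. 1"] assms by simp

text \<open>The values 1 - b \<zeta> have positive real part on the closed disc, so the principal
  logarithm is holomorphic there and its real part is the function in question.\<close>

lemma Poisson_formula_log_factor:
  assumes b: "norm b < 1" and \<xi>: "norm \<xi> = 1" and r: "0 \<le> r" "r < 1"
  shows "(LINT \<zeta>|circle_lebesgue. ln (norm (1 - b * \<zeta>)) * radial_poisson r (dist \<xi> \<zeta>)) = 
    ln (norm (1 - b * (of_real r * \<xi>)))"
proof -
  have Re_pos: "Re (1 - b * \<zeta>) > 0" if "norm \<zeta> \<le> 1" for \<zeta>
  proof -
    have "Re (b * \<zeta>) \<le> norm (b * \<zeta>)" by (rule complex_Re_le_cmod)
    also have "\<dots> \<le> norm b * 1" unfolding norm_mult using that by (intro mult_left_mono) auto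
    finally show ?thesis using b by simp
  qed
  have nz: "1 - b * \<zeta> \<noteq> 0" if "norm \<zeta> \<le> 1" for \<zeta>
    using Re_pos[OF that] by (metis less_irrefl zero_complex.simps(1))
  have "(\<lambda>\<zeta>. Ln (1 - b * \<zeta>)) holomorphic_on cball 0 1"
    by (intro holomorphic_intros) (use Re_pos in \<open>auto simp: complex_nonpos_Reals_iff not_le\<close>)
  then have "(LINT \<zeta>|circle_lebesgue. ln (norm (1 - b * \<zeta>)) * radial_poisson r (dist \<xi> \<zeta>)) =
      Re (Ln (1 - b * (of_real r * \<xi>)))"
    by (rule Poisson_formula_Re[OF _ \<xi> r]) (use nz in auto)
  also have "\<dots> = ln (norm (1 - b * (of_real r * \<xi>)))"
    using \<xi> r nz[of "of_real r * \<xi>"] by (intro Re_Ln) (auto simp: norm_mult)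
  finally show ?thesis .
qed

section \<open>Pointwise bound for log |Q| by its Poisson integral\<close>

text \<open>A zero-free linear factor at \<xi> is compared with its value at r \<xi>. The constant
  is attained at w = -1 and tends to 1 as r does; a fixed constant above 1 would be raised to the
  degree and ruin the bound.\<close>

lemma norm_one_minus_le_dilation:
  fixes w :: complex
  assumes "norm w \<le> 1" "0 \<le> r" "r < 1"
  shows "norm (1 - w) \<le> 2 / (1 + r) * norm (1 - of_real r * w)"
proof -
  define x where "x = Re w"
  define s where "s = (norm w)\<^sup>2"
  have s: "0 \<le> s" "s \<le> 1" using assms by (auto simp: s_def power_le_one)
  have x: "- x \<le> 1" "x\<^sup>2 \<le> s"
    using complex_Re_le_cmod[of "-w"] assms by (auto simp: x_def s_def cmod_power2)
  have "2 * - x \<le> x\<^sup>2 + 1" using sum_squares_bound[of "-x" 1] by simp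
  then have x2: "- 2 * x \<le> 1 + s" using x by linarith
  have n1: "(norm (1 - w))\<^sup>2 = 1 - 2 * x + s"
    by (simp add: cmod_power2 x_def s_def) (simp add: power2_eq_square algebra_simps)
  have n2: "(norm (1 - of_real r * w))\<^sup>2 = 1 - 2 * r * x + r\<^sup>2 * s"
    by (simp add: cmod_power2 x_def s_def) (simp add: power2_eq_square algebra_simps)
  \<comment> \<open>With - 2 x \<le> 1 + s the second factor on the right is at least 2 (1 + r)(1 -
    s), hence nonnegative.\<close>
  have "4 * (1 - 2 * r * x + r\<^sup>2 * s) - (1 + r)\<^sup>2 * (1 - 2 * x + s) =
     (1 - r) * ((3 + r) - s * (3 * r + 1) + 2 * x * (1 - r))"
    by (simp add: power2_eq_square algebra_simps)
  moreover have "(3 + r) - s * (3 * r + 1) + 2 * x * (1 - r) \<ge> 0"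
  proof -
    have "(1 - r) * (- 2 * x) \<le> (1 - r) * (1 + s)" using x2 assms by (intro mult_left_mono) auto
    moreover have "(3 + r) - s * (3 * r + 1) - (1 - r) * (1 + s) = 2 * (1 + r) * (1 - s)"
      by (simp add: algebra_simps)
    moreover have "2 * (1 + r) * (1 - s) \<ge> 0" using s assms by auto
    ultimately show ?thesis by (simp add: algebra_simps)
  qed
  ultimately have "(1 + r)\<^sup>2 * (norm (1 - w))\<^sup>2 \<le> 4 * (norm (1 - of_real r * w))\<^sup>2"
    unfolding n1 n2 using assms by (smt (verit) mult_nonneg_nonneg)
  then have "((1 + r) * norm (1 - w))\<^sup>2 \<le> (2 * norm (1 - of_real r * w))\<^sup>2"
    by (simp add: power_mult_distrib)
  then have "(1 + r) * norm (1 - w) \<le> 2 * norm (1 - of_real r * w)"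
    by (rule power2_le_imp_le) auto
  then show ?thesis using assms by (simp add: field_simps)
qed

lemma integrable_circle_bounded:
  fixes u :: "complex \<Rightarrow> real"
  assumes "u \<in> borel_measurable borel" "\<And>\<zeta>. norm \<zeta> = 1 \<Longrightarrow> \<bar>u \<zeta>\<bar> \<le> B"
  shows "integrable circle_lebesgue u"
proof (rule circle.integrable_const_bound)
  show "AE \<zeta> in circle_lebesgue. norm (u \<zeta>) \<le> B"
    using AE_circle_lebesgue by eventually_elim (use assms in auto)
qed (use assms in simp)

lemma poly_measurable [measurable]: "poly Q \<in> borel_measurable borel" for Q :: "complex poly"
  by (intro borel_measurable_continuous_onI continuous_intros)

lemma bounded_ln_norm_poly:
  fixes Q :: "complex poly"
  assumes "\<And>\<zeta>. norm \<zeta> = 1 \<Longrightarrow> poly Q \<zeta> \<noteq> 0"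
  obtains B where "\<And>\<zeta>. norm \<zeta> = 1 \<Longrightarrow> \<bar>ln (norm (poly Q \<zeta>))\<bar> \<le> B"
proof -
  have "compact ((\<lambda>\<zeta>. ln (norm (poly Q \<zeta>))) ` sphere 0 1)"
    using assms by (intro compact_continuous_image continuous_intros) auto
  then obtain B where "\<And>y. y \<in> (\<lambda>\<zeta>. ln (norm (poly Q \<zeta>))) ` sphere 0 1 \<Longrightarrow> norm y \<le> B"
    using compact_imp_bounded bounded_iff by metis
  then show thesis using that[of B] by auto
qed

lemma integrable_ln_norm_poly_mult:
  fixes Q :: "complex poly"
  assumes "\<And>\<zeta>. norm \<zeta> = 1 \<Longrightarrow> poly Q \<zeta> \<noteq> 0" "0 \<le> r" "r < 1"
  shows "integrable circle_lebesgue (\<lambda>\<zeta>. ln (norm (poly Q \<zeta>)) * radial_poisson r (dist \<xi> \<zeta>))"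
proof -
  obtain B where B: "\<And>\<zeta>. norm \<zeta> = 1 \<Longrightarrow> \<bar>ln (norm (poly Q \<zeta>))\<bar> \<le> B"
    using bounded_ln_norm_poly[of Q] assms(1) by blast
  note [measurable] = radial_poisson_meas[OF assms(2,3)]
  show ?thesis
  proof (rule integrable_circle_bounded[where B = "B * radial_poisson r 0"])
    fix \<zeta> :: complex assume \<zeta>: "norm \<zeta> = 1"
    have "\<bar>ln (norm (poly Q \<zeta>))\<bar> * \<bar>radial_poisson r (dist \<xi> \<zeta>)\<bar> \<le> B * radial_poisson r 0"
      using B[OF \<zeta>] radial_poisson_antimono[OF assms(2,3), of 0 "dist \<xi> \<zeta>"] radial_poisson_pos[OF assms(2,3), of "dist \<xi> \<zeta>"]
      by (intro mult_mono) auto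
    then show "\<bar>ln (norm (poly Q \<zeta>)) * radial_poisson r (dist \<xi> \<zeta>)\<bar> \<le> B * radial_poisson r 0"
      by (simp add: abs_mult)
  qed measurable
qed

text \<open>On the circle |\<zeta> - a| equals k |1 - b \<zeta>| with |b| < 1: scaling gives b = 1/a
  for a zero outside, reflection gives b = \<open>cnj a\<close> for one inside. For such a factor
  the Poisson formula is exact at r \<xi>, and the dilation estimate passes from r \<xi> to \<xi> at
  the stated cost.\<close>

lemma ln_norm_linear_factor_le:
  assumes a: "norm a \<noteq> 1" and \<xi>: "norm \<xi> = 1" and r: "0 \<le> r" "r < 1"
  shows "ln (norm (\<xi> - a)) \<le> (LINT \<zeta>|circle_lebesgue. ln (norm (\<zeta> - a)) * radial_poisson r (dist \<xi> \<zeta>))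
     + ln (2 / (1 + r))"
proof -
  obtain b k where b: "norm b < 1" and k: "k > 0" and eq: "\<And>\<zeta>. norm \<zeta> = 1 \<Longrightarrow> norm (\<zeta> - a) = k * norm (1 - b * \<zeta>)"
  proof (cases "norm a > 1")
    case True
    have "norm (\<zeta> - a) = norm a * norm (1 - (1 / a) * \<zeta>)" for \<zeta>
    proof -
      have "\<zeta> - a = - a * (1 - (1 / a) * \<zeta>)" using True by (auto simp: field_simps)
      then show ?thesis by (metis norm_mult norm_minus_cancel)
    qed
    with True show thesis by (intro that[of "1 / a" "norm a"]) (auto simp: norm_divide divide_simps)
  next
    case False
    have "norm (\<zeta> - a) = 1 * norm (1 - cnj a * \<zeta>)" if "norm \<zeta> = 1" for \<zeta>
    proof -
      have "cnj (1 - cnj a * \<zeta>) * \<zeta> = \<zeta> - a * (\<zeta> * cnj \<zeta>)" by (simp add: algebra_simps)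
      also have "\<dots> = \<zeta> - a" by (simp add: unit_circle_cnj[OF that])
      finally show ?thesis using that by (metis complex_mod_cnj mult.right_neutral mult_1 norm_mult)
    qed
    with False a show thesis by (intro that[of "cnj a" 1]) auto
  qed
  have nz: "norm (1 - b * \<zeta>) > 0" if "norm \<zeta> \<le> 1" for \<zeta>
  proof -
    have "norm (b * \<zeta>) \<le> norm b * 1" unfolding norm_mult using that by (intro mult_left_mono) auto
    then show ?thesis using b by auto
  qed
  note [measurable] = radial_poisson_meas[OF r]
  have "ln (norm (1 - b * \<xi>)) \<le> ln (2 / (1 + r) * norm (1 - b * (of_real r * \<xi>)))"
    using norm_one_minus_le_dilation[of "b * \<xi>" r] b \<xi> r nz[of \<xi>] nz[of "of_real r * \<xi>"]
    by (intro ln_mono) (auto simp: norm_mult mult_ac intro!: mult_pos_pos divide_pos_pos)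
  also have "\<dots> = ln (2 / (1 + r)) + ln (norm (1 - b * (of_real r * \<xi>)))"
    using r \<xi> nz[of "of_real r * \<xi>"] by (intro ln_mult_pos) (auto simp: norm_mult)
  finally have 1: "ln (norm (1 - b * \<xi>)) \<le> ln (2 / (1 + r)) + ln (norm (1 - b * (of_real r * \<xi>)))" .
  have "(LINT \<zeta>|circle_lebesgue. ln (norm (\<zeta> - a)) * radial_poisson r (dist \<xi> \<zeta>)) =
     (LINT \<zeta>|circle_lebesgue. ln k * radial_poisson r (dist \<xi> \<zeta>) + ln (norm (1 - b * \<zeta>)) * radial_poisson r (dist \<xi> \<zeta>))"
  proof (rule integral_cong_AE)
    show "AE \<zeta> in circle_lebesgue. ln (norm (\<zeta> - a)) * radial_poisson r (dist \<xi> \<zeta>) =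
      ln k * radial_poisson r (dist \<xi> \<zeta>) + ln (norm (1 - b * \<zeta>)) * radial_poisson r (dist \<xi> \<zeta>)"
      using AE_circle_lebesgue
    proof eventually_elim
      case (elim \<zeta>)
      then show ?case using nz[of \<zeta>] k by (simp add: eq ln_mult distrib_right)
    qed
  qed measurable
  also have "\<dots> = ln k + ln (norm (1 - b * (of_real r * \<xi>)))"
  proof -
    have "integrable circle_lebesgue (\<lambda>\<zeta>. ln (norm (poly [:1, -b:] \<zeta>)) * radial_poisson r (dist \<xi> \<zeta>))"
      by (rule integrable_ln_norm_poly_mult) (use nz r in \<open>auto simp: mult.commute\<close>)
    then have "integrable circle_lebesgue (\<lambda>\<zeta>. ln (norm (1 - b * \<zeta>)) * radial_poisson r (dist \<xi> \<zeta>))"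
      by (simp add: mult.commute[of b])
    then show ?thesis
      using radial_poisson_integrable[OF circle.finite_measure_axioms sets_circle_lebesgue r, of \<xi>]
      by (subst Bochner_Integration.integral_add)
         (simp_all add: radial_poisson_integral[OF \<xi> r] Poisson_formula_log_factor[OF b \<xi> r])
  qed
  finally show ?thesis
    using 1 nz[of \<xi>] k \<xi> by (simp add: eq ln_mult)
qed

text \<open>Roots are split off one at a time, each paying \<open>ln (2 / (1 + r))\<close>.\<close>

lemma ln_norm_poly_le:
  fixes Q :: "complex poly"
  assumes "\<And>\<zeta>. norm \<zeta> = 1 \<Longrightarrow> poly Q \<zeta> \<noteq> 0" and \<xi>: "norm \<xi> = 1" and r: "0 \<le> r" "r < 1"
  shows "ln (norm (poly Q \<xi>)) \<le> (LINT \<zeta>|circle_lebesgue. ln (norm (poly Q \<zeta>)) * radial_poisson r (dist \<xi> \<zeta>))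
     + degree Q * ln (2 / (1 + r))"
  using assms(1)
proof (induction "degree Q" arbitrary: Q)
  case 0
  then obtain c where "Q = [:c:]" using degree_eq_zeroE by metis
  then show ?case using radial_poisson_integral[OF \<xi> r] by simp
next
  case (Suc n)
  have "\<not> constant (poly Q)" using Suc(2) by (simp add: constant_degree)
  then obtain a where "poly Q a = 0" using fundamental_theorem_of_algebra by blast
  then obtain R where R: "Q = [:- a, 1:] * R" by (auto simp: poly_eq_0_iff_dvd)
  have "R \<noteq> 0" using Suc(2) R by auto
  then have deg: "degree R = n" using Suc(2) unfolding R by (subst (asm) degree_mult_eq) auto
  have a: "norm a \<noteq> 1" using Suc(3)[of a] \<open>poly Q a = 0\<close> by auto
  have nzR: "poly R \<zeta> \<noteq> 0" if "norm \<zeta> = 1" for \<zeta> using Suc(3)[OF that] by (auto simp: R)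
  have nza: "\<zeta> \<noteq> a" if "norm \<zeta> = 1" for \<zeta> using that a by auto
  have eq: "ln (norm (poly Q \<zeta>)) = ln (norm (\<zeta> - a)) + ln (norm (poly R \<zeta>))" if "norm \<zeta> = 1" for \<zeta>
  proof -
    have "poly Q \<zeta> = (\<zeta> - a) * poly R \<zeta>" by (simp add: R algebra_simps)
    then show ?thesis using nzR[OF that] nza[OF that] by (simp add: norm_mult ln_mult)
  qed
  note [measurable] = radial_poisson_meas[OF r]
  have "integrable circle_lebesgue (\<lambda>\<zeta>. ln (norm (poly [:-a, 1:] \<zeta>)) * radial_poisson r (dist \<xi> \<zeta>))"
    by (rule integrable_ln_norm_poly_mult) (use nza r in auto)
  then have int: "integrable circle_lebesgue (\<lambda>\<zeta>. ln (norm (\<zeta> - a)) * radial_poisson r (dist \<xi> \<zeta>))"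
    by simp
  have "(LINT \<zeta>|circle_lebesgue. ln (norm (poly Q \<zeta>)) * radial_poisson r (dist \<xi> \<zeta>)) =
     (LINT \<zeta>|circle_lebesgue. ln (norm (\<zeta> - a)) * radial_poisson r (dist \<xi> \<zeta>) + ln (norm (poly R \<zeta>)) * radial_poisson r (dist \<xi> \<zeta>))"
  proof (rule integral_cong_AE)
    show "AE \<zeta> in circle_lebesgue. ln (norm (poly Q \<zeta>)) * radial_poisson r (dist \<xi> \<zeta>) =
      ln (norm (\<zeta> - a)) * radial_poisson r (dist \<xi> \<zeta>) + ln (norm (poly R \<zeta>)) * radial_poisson r (dist \<xi> \<zeta>)"
      using AE_circle_lebesgue by eventually_elim (simp add: eq distrib_right)
  qed measurable
  also have "\<dots> = (LINT \<zeta>|circle_lebesgue. ln (norm (\<zeta> - a)) * radial_poisson r (dist \<xi> \<zeta>)) + 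
       (LINT \<zeta>|circle_lebesgue. ln (norm (poly R \<zeta>)) * radial_poisson r (dist \<xi> \<zeta>))"
    by (intro Bochner_Integration.integral_add int integrable_ln_norm_poly_mult nzR r)
  finally show ?case
    using Suc(1)[OF deg[symmetric] nzR] ln_norm_linear_factor_le[OF a \<xi> r] 
    by (simp add: eq[OF \<xi>] deg Suc(2)[symmetric] algebra_simps)
qed

section \<open>Almost everywhere summability\<close>

lemma integrable_mult_radial_poisson:
  fixes f :: "complex \<Rightarrow> real"
  assumes f: "integrable circle_lebesgue f" and r: "0 \<le> r" "r < 1"
  shows "integrable circle_lebesgue (\<lambda>\<zeta>. f \<zeta> * radial_poisson r (dist \<xi> \<zeta>))"
proof (rule Bochner_Integration.integrable_bound[of _ "\<lambda>\<zeta>. radial_poisson r 0 * f \<zeta>"])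
  note [measurable] = radial_poisson_meas[OF r] borel_measurable_integrable[OF f]
  show "(\<lambda>\<zeta>. f \<zeta> * radial_poisson r (dist \<xi> \<zeta>)) \<in> borel_measurable circle_lebesgue" by measurable
  show "AE \<zeta> in circle_lebesgue. norm (f \<zeta> * radial_poisson r (dist \<xi> \<zeta>)) \<le> norm (radial_poisson r 0 * f \<zeta>)"
    using radial_poisson_antimono[OF r, of 0] radial_poisson_pos[OF r]
    by (intro AE_I2) (auto simp: abs_mult mult.commute less_imp_le intro!: mult_left_mono)
qed (use f in auto)

lemma continuous_poly_bounded:
  fixes Q :: "complex poly"
  obtains B where "\<And>\<zeta>. norm \<zeta> \<le> 1 \<Longrightarrow> norm (poly Q \<zeta>) \<le> B"
proof -
  have "compact (poly Q ` cball 0 1)"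
    by (intro compact_continuous_image continuous_intros compact_cball)
  then obtain B where "\<And>y. y \<in> poly Q ` cball 0 1 \<Longrightarrow> norm y \<le> B"
    using compact_imp_bounded bounded_iff by metis
  then show thesis using that[of B] by auto
qed

lemma integrable_poly_weight:
  fixes w :: "complex \<Rightarrow> real"
  assumes w: "integrable circle_lebesgue w"
  shows "integrable circle_lebesgue (\<lambda>\<zeta>. (norm (poly Q \<zeta>))\<^sup>2 * w \<zeta>)"
proof -
  note [measurable] = borel_measurable_integrable[OF w]
  obtain B where B: "\<And>\<zeta>. norm \<zeta> \<le> 1 \<Longrightarrow> norm (poly Q \<zeta>) \<le> B" using continuous_poly_bounded[of Q] by blast
  show ?thesis
  proof (rule Bochner_Integration.integrable_bound[of _ "\<lambda>\<zeta>. B\<^sup>2 * w \<zeta>"])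
    show "AE \<zeta> in circle_lebesgue. norm ((norm (poly Q \<zeta>))\<^sup>2 * w \<zeta>) \<le> norm (B\<^sup>2 * w \<zeta>)"
      using AE_circle_lebesgue
      by eventually_elim (auto simp: abs_mult intro!: mult_right_mono power_mono B)
  qed (use w in auto)
qed

text \<open>Bernoulli gives (1 - 1/(2n))^n \<ge> 1/2. Hence at r = 1 - 1/n the losses of up to n
  linear factors add up to at most ln 2.\<close>

lemma dilation_power_le: 
  assumes "n \<ge> 1"
  shows "real n * ln (2 / (1 + (1 - 1 / real n))) \<le> ln 2"
proof -
  define y where "y = 1 + (- 1 / (2 * real n))"
  have y: "y > 0" using assms by (simp add: y_def field_simps)
  have "1 / 2 \<le> y ^ n"
    using Bernoulli_inequality[of "- 1 / (2 * real n)" n] assms by (simp add: y_def field_simps)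
  moreover have "2 / (1 + (1 - 1 / real n)) = inverse y"
    using assms by (simp add: y_def field_simps)
  ultimately have "(2 / (1 + (1 - 1 / real n))) ^ n \<le> 2"
    using le_imp_inverse_le[of "1 / 2" "y ^ n"] by (simp add: power_inverse)
  then have "ln ((2 / (1 + (1 - 1 / real n))) ^ n) \<le> ln 2"
    using y \<open>2 / (1 + (1 - 1 / real n)) = inverse y\<close> by (intro ln_mono) auto
  then show ?thesis using y \<open>2 / (1 + (1 - 1 / real n)) = inverse y\<close> by (simp add: ln_realpow)
qed

text \<open>Jensen for the probability density \<open>p\<close> is applied to log (|Q|^2 w);
  squaring the bound for |Q(\<xi>)| turns the loss ln 2 into the factor 4. The weight enters through
  |ln w| because its Poisson integral is then one of a positive measure.\<close>

lemma Szego_pointwise_bound: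
  fixes w :: "complex \<Rightarrow> real" and Q :: "complex poly"
  assumes w: "integrable circle_lebesgue w" and pos: "AE \<zeta> in circle_lebesgue. w \<zeta> > 0"
    and lnw: "integrable circle_lebesgue (\<lambda>\<zeta>. ln (w \<zeta>))"
    and nz: "\<And>\<zeta>. norm \<zeta> = 1 \<Longrightarrow> poly Q \<zeta> \<noteq> 0" and n: "n \<ge> 1" "degree Q \<le> n"
    and \<xi>: "norm \<xi> = 1" and r_def: "r = 1 - 1 / real n"
  shows "(norm (poly Q \<xi>))\<^sup>2 \<le> 4 * exp (LINT \<zeta>|circle_lebesgue. \<bar>ln (w \<zeta>)\<bar> * radial_poisson r (dist \<xi> \<zeta>)) *
     (LINT \<zeta>|circle_lebesgue. (norm (poly Q \<zeta>))\<^sup>2 * w \<zeta> * radial_poisson r (dist \<xi> \<zeta>))"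
proof -
  have r: "0 \<le> r" "r < 1" using n by (auto simp: r_def)
  define p where "p \<zeta> = radial_poisson r (dist \<xi> \<zeta>)" for \<zeta>
  define a where "a \<zeta> = ln (norm (poly Q \<zeta>))" for \<zeta>
  have p_pos: "p \<zeta> > 0" for \<zeta> unfolding p_def by (rule radial_poisson_pos[OF r])
  have p_int: "integrable circle_lebesgue p" "integral\<^sup>L circle_lebesgue p = 1"
    unfolding p_def[abs_def] using radial_poisson_integral[OF \<xi> r]
      radial_poisson_integrable[OF circle.finite_measure_axioms sets_circle_lebesgue r] by auto
  have a_int: "integrable circle_lebesgue (\<lambda>\<zeta>. a \<zeta> * p \<zeta>)"
    unfolding a_def p_def by (rule integrable_ln_norm_poly_mult[OF nz r])
  have l_int: "integrable circle_lebesgue (\<lambda>\<zeta>. ln (w \<zeta>) * p \<zeta>)"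
    unfolding p_def by (rule integrable_mult_radial_poisson[OF lnw r])
  have al_int: "integrable circle_lebesgue (\<lambda>\<zeta>. \<bar>ln (w \<zeta>)\<bar> * p \<zeta>)"
    unfolding p_def using lnw by (intro integrable_mult_radial_poisson r) auto
  have q_int: "integrable circle_lebesgue (\<lambda>\<zeta>. (norm (poly Q \<zeta>))\<^sup>2 * w \<zeta> * p \<zeta>)"
    unfolding p_def by (intro integrable_mult_radial_poisson integrable_poly_weight w r)
  define A where "A = (LINT \<zeta>|circle_lebesgue. a \<zeta> * p \<zeta>)"
  define W where "W = (LINT \<zeta>|circle_lebesgue. ln (w \<zeta>) * p \<zeta>)"
  define W' where "W' = (LINT \<zeta>|circle_lebesgue. \<bar>ln (w \<zeta>)\<bar> * p \<zeta>)"
  define L where "L = 2 * A + W"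
  have expL: "exp L \<le> (LINT \<zeta>|circle_lebesgue. (norm (poly Q \<zeta>))\<^sup>2 * w \<zeta> * p \<zeta>)"
  proof -
    \<comment> \<open>Jensen through the tangent of exp at L, the mean of x = 2 ln |Q| + ln w: the
      tangent exp L (1 + x - L) integrates to exp L.\<close>
    have "(LINT \<zeta>|circle_lebesgue. exp L * ((1 - L) * p \<zeta> + 2 * (a \<zeta> * p \<zeta>) + ln (w \<zeta>) * p \<zeta>)) = exp L"
      using p_int a_int l_int by (simp add: A_def[symmetric] W_def[symmetric] L_def)
    moreover have "(LINT \<zeta>|circle_lebesgue. exp L * ((1 - L) * p \<zeta> + 2 * (a \<zeta> * p \<zeta>) + ln (w \<zeta>) * p \<zeta>)) \<le>
        (LINT \<zeta>|circle_lebesgue. (norm (poly Q \<zeta>))\<^sup>2 * w \<zeta> * p \<zeta>)"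
    proof (rule integral_mono_AE)
      show "AE \<zeta> in circle_lebesgue. exp L * ((1 - L) * p \<zeta> + 2 * (a \<zeta> * p \<zeta>) + ln (w \<zeta>) * p \<zeta>) \<le>
         (norm (poly Q \<zeta>))\<^sup>2 * w \<zeta> * p \<zeta>"
        using AE_circle_lebesgue pos
      proof eventually_elim
        case (elim \<zeta>)
        define x where "x = 2 * a \<zeta> + ln (w \<zeta>)"
        have "exp x = (norm (poly Q \<zeta>))\<^sup>2 * w \<zeta>"
          using nz[of \<zeta>] elim by (simp add: x_def a_def exp_add exp_double)
        moreover have "exp L * (1 + (x - L)) \<le> exp x"
        proof -
          have "exp L * (1 + (x - L)) \<le> exp L * exp (x - L)"
            by (intro mult_left_mono exp_ge_add_one_self) auto
          then show ?thesis by (simp add: exp_diff)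
        qed
        ultimately have "exp L * (1 + (x - L)) * p \<zeta> \<le> (norm (poly Q \<zeta>))\<^sup>2 * w \<zeta> * p \<zeta>"
          using p_pos[of \<zeta>] by (intro mult_right_mono) auto
        then show ?case by (simp add: x_def algebra_simps)
      qed
    qed (use p_int a_int l_int q_int in auto)
    ultimately show ?thesis by simp
  qed
  have "ln (norm (poly Q \<xi>)) \<le> A + degree Q * ln (2 / (1 + r))"
    unfolding A_def a_def p_def by (rule ln_norm_poly_le[OF nz \<xi> r])
  also have "degree Q * ln (2 / (1 + r)) \<le> n * ln (2 / (1 + r))"
    using n r by (intro mult_right_mono) auto
  also have "\<dots> \<le> ln 2" unfolding r_def by (rule dilation_power_le[OF n(1)])
  finally have "exp (ln (norm (poly Q \<xi>))) \<le> exp (A + ln 2)" by simp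
  then have "norm (poly Q \<xi>) \<le> exp (A + ln 2)" using nz[OF \<xi>] by simp
  then have "norm (poly Q \<xi>) \<le> 2 * exp A" by (simp add: exp_add)
  then have "(norm (poly Q \<xi>))\<^sup>2 \<le> (2 * exp A)\<^sup>2" by (intro power_mono) auto
  also have "\<dots> = 4 * exp (- W) * exp L"
    by (simp add: power_mult_distrib L_def exp_add exp_minus exp_double)
  also have "\<dots> \<le> 4 * exp W' * exp L"
  proof -
    have "(LINT \<zeta>|circle_lebesgue. - (ln (w \<zeta>) * p \<zeta>)) \<le> W'"
      unfolding W'_def
    proof (rule integral_mono)
      show "- (ln (w \<zeta>) * p \<zeta>) \<le> \<bar>ln (w \<zeta>)\<bar> * p \<zeta>" for \<zeta>
        using mult_right_mono[OF abs_ge_minus_self less_imp_le[OF p_pos]] by simp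
    qed (use l_int al_int in auto)
    then have "- W \<le> W'" by (simp add: W_def)
    then show ?thesis by simp
  qed
  also have "\<dots> \<le> 4 * exp W' * (LINT \<zeta>|circle_lebesgue. (norm (poly Q \<zeta>))\<^sup>2 * w \<zeta> * p \<zeta>)"
    by (intro mult_left_mono expL) auto
  finally show ?thesis by (simp add: W'_def p_def)
qed

text \<open>Discs of radius \<rho> have Lebesgue measure at least \<rho>/8, so \<nu> is dominated on
  discs by 8 A times Lebesgue measure, whose Poisson integral is 1. Radii up to 3 suffice, as the
  disc of radius 3 about \<xi> contains the circle.\<close>

lemma radial_poisson_integral_le:
  fixes \<nu> :: "complex measure"
  assumes fin: "finite_measure \<nu>" and sets: "sets \<nu> = sets borel" and AE: "AE \<zeta> in \<nu>. \<zeta> \<in> sphere 0 1"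
    and A: "A > 0" "\<And>\<rho>. \<rho> > 0 \<Longrightarrow> measure \<nu> (ball \<xi> \<rho>) \<le> A * \<rho>" and \<xi>: "norm \<xi> = 1" and r: "0 \<le> r" "r < 1"
  shows "(LINT \<zeta>|\<nu>. radial_poisson r (dist \<xi> \<zeta>)) \<le> 8 * A"
proof -
  interpret finite_measure \<nu> by fact
  note pos = less_imp_le[OF radial_poisson_pos[OF r]]
  have "ennreal (LINT \<zeta>|\<nu>. radial_poisson r (dist \<xi> \<zeta>)) = (\<integral>\<^sup>+\<zeta>. ennreal (radial_poisson r (dist \<xi> \<zeta>)) \<partial>\<nu>)"
    by (rule nn_integral_eq_integral[symmetric]) (auto intro!: radial_poisson_integrable fin sets r pos)
  also have "\<dots> = (\<integral>\<^sup>+\<zeta>\<in>ball \<xi> 3. ennreal (radial_poisson r (dist \<xi> \<zeta>)) \<partial>\<nu>)"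
  proof (rule nn_integral_cong_AE)
    show "AE \<zeta> in \<nu>. ennreal (radial_poisson r (dist \<xi> \<zeta>)) = ennreal (radial_poisson r (dist \<xi> \<zeta>)) * indicator (ball \<xi> 3) \<zeta>"
      using AE
    proof eventually_elim
      case (elim \<zeta>)
      then show ?case using dist_circle_le_2[OF \<xi>, of \<zeta>] by simp
    qed
  qed
  also have "\<dots> \<le> ennreal (8 * A) * (\<integral>\<^sup>+\<zeta>\<in>ball \<xi> 3. ennreal (radial_poisson r (dist \<xi> \<zeta>)) \<partial>circle_lebesgue)"
  proof (rule radial_comparison[OF fin sets circle.finite_measure_axioms sets_circle_lebesgue])
    fix \<rho> :: real assume \<rho>: "0 < \<rho>" "\<rho> \<le> 3"
    have "emeasure \<nu> (ball \<xi> \<rho>) \<le> ennreal (A * \<rho>)"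
      using A(2)[OF \<rho>(1)] by (simp add: emeasure_eq_measure ennreal_leI)
    also have "\<dots> = ennreal (8 * A) * ennreal (\<rho> / 8)"
      using A(1) \<rho> by (simp flip: ennreal_mult)
    also have "\<dots> \<le> ennreal (8 * A) * emeasure circle_lebesgue (ball \<xi> \<rho>)"
      by (intro mult_left_mono circle_lebesgue_ball_ge \<xi> \<rho>) auto
    finally show "emeasure \<nu> (ball \<xi> \<rho>) \<le> ennreal (8 * A) * emeasure circle_lebesgue (ball \<xi> \<rho>)" .
  qed (use r in \<open>auto intro: continuous_radial_poisson radial_poisson_antimono\<close>)
  also have "\<dots> \<le> ennreal (8 * A) * (\<integral>\<^sup>+\<zeta>. ennreal (radial_poisson r (dist \<xi> \<zeta>)) \<partial>circle_lebesgue)"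
    by (intro mult_left_mono nn_integral_mono) (auto split: split_indicator)
  also have "(\<integral>\<^sup>+\<zeta>. ennreal (radial_poisson r (dist \<xi> \<zeta>)) \<partial>circle_lebesgue) = ennreal 1"
    using radial_poisson_integral[OF \<xi> r]
    by (subst nn_integral_eq_integral)
       (auto intro!: radial_poisson_integrable circle.finite_measure_axioms r pos)
  finally show ?thesis using A(1) by simp
qed

text \<open>Jensen on a disc: |ln w| has mean at most 8 A there, so the mean of w cannot be small.
  The resulting linear lower bound for \<mu> places \<xi> in the support and makes sublinear
  quantities negligible against the measure of the disc.\<close>

lemma density_ball_lower_bound:
  fixes w :: "complex \<Rightarrow> real"
  assumes w: "integrable circle_lebesgue w" and pos: "AE \<zeta> in circle_lebesgue. w \<zeta> > 0"
    and lnw: "integrable circle_lebesgue (\<lambda>\<zeta>. ln (w \<zeta>))"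
    and \<xi>: "norm \<xi> = 1" and \<rho>: "0 < \<rho>" "\<rho> \<le> 3"
    and A: "(LINT \<zeta>:ball \<xi> \<rho>|circle_lebesgue. \<bar>ln (w \<zeta>)\<bar>) \<le> A * \<rho>" "A > 0"
  shows "(LINT \<zeta>:ball \<xi> \<rho>|circle_lebesgue. w \<zeta>) \<ge> exp (- (8 * A)) / 8 * \<rho>"
proof -
  define L where "L = 8 * A"
  define \<iota> where "\<iota> \<zeta> = indicat_real (ball \<xi> \<rho>) \<zeta>" for \<zeta>
  have ball: "ball \<xi> \<rho> \<in> sets circle_lebesgue" by simp
  have int: "integrable circle_lebesgue (\<lambda>\<zeta>. \<iota> \<zeta> * g \<zeta>)" if "integrable circle_lebesgue g" for g :: "complex \<Rightarrow> real"
    using integrable_mult_indicator[OF ball that] by (simp add: \<iota>_def)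
  have i1: "integrable circle_lebesgue \<iota>" using int[of "\<lambda>_. 1"] by simp
  have m: "integral\<^sup>L circle_lebesgue \<iota> = measure circle_lebesgue (ball \<xi> \<rho>)"
    unfolding \<iota>_def by simp
  have m_ge: "integral\<^sup>L circle_lebesgue \<iota> \<ge> \<rho> / 8"
    unfolding m using circle_lebesgue_ball_ge[OF \<xi> \<rho>] by (simp add: circle.emeasure_eq_measure)
  have A': "(LINT \<zeta>|circle_lebesgue. \<iota> \<zeta> * \<bar>ln (w \<zeta>)\<bar>) \<le> A * \<rho>"
    using A(1) by (simp add: set_lebesgue_integral_def \<iota>_def)
  \<comment> \<open>The choice L = 8 A makes (1 + L) \<rho>/8 - A \<rho> equal to \<rho>/8; below,
    exp is replaced by its tangent at -L.\<close>
  have "exp (- L) * (\<rho> / 8) \<le> exp (- L) * ((1 + L) * (\<rho> / 8) - A * \<rho>)"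
    using \<rho> by (intro mult_left_mono) (auto simp: L_def algebra_simps)
  also have "\<dots> \<le> exp (- L) * ((1 + L) * integral\<^sup>L circle_lebesgue \<iota> - (LINT \<zeta>|circle_lebesgue. \<iota> \<zeta> * \<bar>ln (w \<zeta>)\<bar>))"
    using A(2) by (intro mult_left_mono diff_mono m_ge A') (auto simp: L_def)
  also have "\<dots> = (LINT \<zeta>|circle_lebesgue. exp (- L) * ((1 + L) * \<iota> \<zeta> - \<iota> \<zeta> * \<bar>ln (w \<zeta>)\<bar>))"
    using i1 int[of "\<lambda>\<zeta>. \<bar>ln (w \<zeta>)\<bar>"] lnw by simp
  also have "\<dots> \<le> (LINT \<zeta>|circle_lebesgue. \<iota> \<zeta> * w \<zeta>)"
  proof (rule integral_mono_AE)
    show "AE \<zeta> in circle_lebesgue. exp (- L) * ((1 + L) * \<iota> \<zeta> - \<iota> \<zeta> * \<bar>ln (w \<zeta>)\<bar>) \<le> \<iota> \<zeta> * w \<zeta>"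
      using pos
    proof eventually_elim
      case (elim \<zeta>)
      have "exp (- L) * ((1 + L) - \<bar>ln (w \<zeta>)\<bar>) \<le> exp (- L) * exp (ln (w \<zeta>) + L)"
        using exp_ge_add_one_self[of "ln (w \<zeta>) + L"] abs_ge_minus_self[of "ln (w \<zeta>)"]
        by (intro mult_left_mono) (linarith, simp)
      also have "\<dots> = w \<zeta>" using elim by (simp add: exp_add exp_minus)
      finally show ?case by (simp add: \<iota>_def split: split_indicator)
    qed
  qed (use i1 int[of "\<lambda>\<zeta>. \<bar>ln (w \<zeta>)\<bar>"] lnw int[OF w] in auto)
  finally show ?thesis by (simp add: set_lebesgue_integral_def \<iota>_def L_def)
qed

section \<open>From weighted polynomial estimates to the reproducing kernel\<close>

context cmv_measure
begin

lemma poly_sq_integrable: "integrable \<mu> (\<lambda>\<zeta>. (norm (poly Q \<zeta>))\<^sup>2)"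
proof -
  obtain B where B: "\<And>\<zeta>. norm \<zeta> \<le> 1 \<Longrightarrow> norm (poly Q \<zeta>) \<le> B" using continuous_poly_bounded[of Q] by blast
  have "L2_fun \<mu> (poly Q)"
  proof (rule L2_fun_bounded[OF prob_space_mu])
    show "AE x in \<mu>. norm (poly Q x) \<le> B" using AE_circle by eventually_elim (auto intro: B)
  qed measurable
  then show ?thesis by (simp add: L2_fun_def)
qed

text \<open>Integrals of nonnegative functions are monotone in the measure; a singular part of \<mu>
  can only increase the right side.\<close>

lemma poly_weight_integral_le:
  fixes w :: "complex \<Rightarrow> real"
  assumes w: "integrable circle_lebesgue w" and nonneg: "AE \<zeta> in circle_lebesgue. w \<zeta> \<ge> 0"
    and dom: "\<And>A. A \<in> sets borel \<Longrightarrow> emeasure (density circle_lebesgue (\<lambda>\<zeta>. ennreal (w \<zeta>))) A \<le> emeasure \<mu> A"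
  shows "(LINT \<zeta>|circle_lebesgue. (norm (poly Q \<zeta>))\<^sup>2 * w \<zeta>) \<le> (LINT \<zeta>|\<mu>. (norm (poly Q \<zeta>))\<^sup>2)"
proof -
  note [measurable] = borel_measurable_integrable[OF w]
  have "ennreal (LINT \<zeta>|circle_lebesgue. (norm (poly Q \<zeta>))\<^sup>2 * w \<zeta>) = 
      (\<integral>\<^sup>+\<zeta>. ennreal ((norm (poly Q \<zeta>))\<^sup>2 * w \<zeta>) \<partial>circle_lebesgue)"
    using nonneg by (intro nn_integral_eq_integral[symmetric] integrable_poly_weight w) auto
  also have "\<dots> = (\<integral>\<^sup>+\<zeta>. ennreal (w \<zeta>) * ennreal ((norm (poly Q \<zeta>))\<^sup>2) \<partial>circle_lebesgue)"
    by (intro nn_integral_cong) (simp add: ennreal_mult''[symmetric] mult.commute)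
  also have "\<dots> = (\<integral>\<^sup>+\<zeta>. ennreal ((norm (poly Q \<zeta>))\<^sup>2) \<partial>density circle_lebesgue (\<lambda>\<zeta>. ennreal (w \<zeta>)))"
    by (subst nn_integral_density) auto
  also have "\<dots> \<le> (\<integral>\<^sup>+\<zeta>. ennreal ((norm (poly Q \<zeta>))\<^sup>2) \<partial>\<mu>)"
    by (rule nn_integral_mono_measure) (use dom in \<open>auto simp: le_measure\<close>)
  also have "\<dots> = ennreal (LINT \<zeta>|\<mu>. (norm (poly Q \<zeta>))\<^sup>2)"
    by (intro nn_integral_eq_integral poly_sq_integrable) auto
  finally show ?thesis by (simp add: integral_nonneg)
qed

text \<open>The reproducing kernel at \<xi> is itself the test function: the corresponding
  polynomial has modulus S at \<xi> and squared norm S, so S^2 \<le> K S.\<close>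

lemma kernel_le_of_polys:
  assumes \<xi>: "norm \<xi> = 1" and K: "K \<ge> 0"
    and Q: "\<And>Q. degree Q \<le> n \<Longrightarrow> (norm (poly Q \<xi>))\<^sup>2 \<le> K * (LINT \<zeta>|\<mu>. (norm (poly Q \<zeta>))\<^sup>2)"
  shows "(\<Sum>k\<le>n. (norm (e k \<xi>))\<^sup>2) \<le> K"
proof -
  define S where "S = (\<Sum>k\<le>n. (norm (e k \<xi>))\<^sup>2)"
  obtain Q where Q': "degree Q \<le> n" "\<And>z. norm z = 1 \<Longrightarrow> norm (poly Q z) = norm (\<Sum>j\<le>n. cnj (e j \<xi>) * e j z)"
    using partial_sum_poly by metis
  have "(\<Sum>j\<le>n. cnj (e j \<xi>) * e j \<xi>) = of_real S"
    by (simp add: S_def complex_norm_square mult.commute flip: of_real_power)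
  then have "norm (poly Q \<xi>) = norm (complex_of_real S)" using Q'(2)[OF \<xi>] by (simp only:)
  moreover have S_nonneg: "S \<ge> 0" by (auto simp: S_def intro: sum_nonneg)
  ultimately have Q\<xi>: "norm (poly Q \<xi>) = S" by simp
  have "(LINT \<zeta>|\<mu>. (norm (poly Q \<zeta>))\<^sup>2) = (LINT \<zeta>|\<mu>. (norm (\<Sum>j<Suc n. cnj (e j \<xi>) * e j \<zeta>))\<^sup>2)"
  proof (rule integral_cong_AE)
    show "AE \<zeta> in \<mu>. (norm (poly Q \<zeta>))\<^sup>2 = (norm (\<Sum>j<Suc n. cnj (e j \<xi>) * e j \<zeta>))\<^sup>2"
      using AE_circle by eventually_elim (simp add: Q'(2) lessThan_Suc_atMost del: sum.lessThan_Suc)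
  qed auto
  also have "\<dots> = S" unfolding sq_norm_lincomb by (simp add: S_def lessThan_Suc_atMost del: sum.lessThan_Suc)
  finally have "S\<^sup>2 \<le> K * S" using Q[OF Q'(1)] Q\<xi> by simp
  then have "S * S \<le> K * S" by (simp add: power2_eq_square)
  then show ?thesis using K S_nonneg unfolding S_def[symmetric]
    by (cases "S = 0") (auto dest: mult_right_le_imp_le)
qed

text \<open>Zeros on the circle are removed by the dilation \<open>Q(sz)\<close>, \<open>s \<longrightarrow> 1\<close>.\<close>

lemma poly_bound_zeros_on_circle:
  assumes \<xi>: "norm \<xi> = 1"
    and Q: "\<And>Q. degree Q \<le> n \<Longrightarrow> (\<And>\<zeta>. norm \<zeta> = 1 \<Longrightarrow> poly Q \<zeta> \<noteq> 0) \<Longrightarrow> 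
        (norm (poly Q \<xi>))\<^sup>2 \<le> K * (LINT \<zeta>|\<mu>. (norm (poly Q \<zeta>))\<^sup>2)"
    and deg: "degree Q \<le> n" and K: "K \<ge> 0"
  shows "(norm (poly Q \<xi>))\<^sup>2 \<le> K * (LINT \<zeta>|\<mu>. (norm (poly Q \<zeta>))\<^sup>2)"
proof (cases "Q = 0")
  case True
  then show ?thesis by simp
next
  case False
  define s where "s k = 1 - 1 / real (k + 2)" for k
  have s: "0 < s k" "s k < 1" for k by (auto simp: s_def)
  have s_lim: "s \<longlonglongrightarrow> 1" unfolding s_def by real_asymp
  define R where "R k = Q \<circ>\<^sub>p [:0, complex_of_real (s k):]" for k
  have R: "poly (R k) z = poly Q (of_real (s k) * z)" for k z
    by (simp add: R_def poly_pcompose mult.commute)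
  have degR: "degree (R k) \<le> n" for k
    using deg degree_pcompose_le[of Q "[:0, complex_of_real (s k):]"] s[of k] by (simp add: R_def)
  \<comment> \<open>An injective sequence meets the finitely many moduli of zeros only finitely
    often.\<close>
  have inj: "inj s" by (auto simp: inj_def s_def)
  have "finite (norm ` {z. poly Q z = 0})" using poly_roots_finite[OF False] by simp
  then have "finite {k. s k \<in> norm ` {z. poly Q z = 0}}"
    using finite_vimageI[OF _ inj] by (simp add: vimage_def)
  then have ev: "\<forall>\<^sub>F k in sequentially. s k \<notin> norm ` {z. poly Q z = 0}"
    by (simp add: cofinite_eq_sequentially[symmetric] eventually_cofinite)
  have bound: "\<forall>\<^sub>F k in sequentially. (norm (poly (R k) \<xi>))\<^sup>2 \<le> K * (LINT \<zeta>|\<mu>. (norm (poly (R k) \<zeta>))\<^sup>2)"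
    using ev
  proof eventually_elim
    case (elim k)
    have "poly (R k) \<zeta> \<noteq> 0" if \<zeta>: "norm \<zeta> = 1" for \<zeta>
    proof
      assume "poly (R k) \<zeta> = 0"
      then have "norm (of_real (s k) * \<zeta>) \<in> norm ` {z. poly Q z = 0}" by (auto simp: R)
      moreover have "norm (of_real (s k) * \<zeta>) = s k" using \<zeta> s[of k] by (simp add: norm_mult)
      ultimately show False using elim by simp
    qed
    then show ?case by (intro Q degR)
  qed
  have conv: "(\<lambda>k. (norm (poly (R k) z))\<^sup>2) \<longlonglongrightarrow> (norm (poly Q z))\<^sup>2" for z
  proof -
    have "(\<lambda>k. of_real (s k) * z) \<longlonglongrightarrow> of_real 1 * z"
      by (intro tendsto_intros s_lim)
    then have "(\<lambda>k. poly Q (of_real (s k) * z)) \<longlonglongrightarrow> poly Q (of_real 1 * z)"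
      by (intro isCont_tendsto_compose[OF poly_isCont])
    then show ?thesis unfolding R by (auto intro!: tendsto_intros)
  qed
  obtain B where B: "\<And>\<zeta>. norm \<zeta> \<le> 1 \<Longrightarrow> norm (poly Q \<zeta>) \<le> B" using continuous_poly_bounded[of Q] by blast
  have "(\<lambda>k. LINT \<zeta>|\<mu>. (norm (poly (R k) \<zeta>))\<^sup>2) \<longlonglongrightarrow> (LINT \<zeta>|\<mu>. (norm (poly Q \<zeta>))\<^sup>2)"
  proof (rule integral_dominated_convergence[where w = "\<lambda>_. B\<^sup>2"])
    show "AE \<zeta> in \<mu>. norm ((norm (poly (R k) \<zeta>))\<^sup>2) \<le> B\<^sup>2" for k
      using AE_circle
    proof eventually_elim
      case (elim \<zeta>)
      have "norm (of_real (s k) * \<zeta>) \<le> 1" using elim s[of k] by (simp add: norm_mult)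
      from power_mono[OF B[OF this], of 2] show ?case by (simp add: R)
    qed
  qed (use conv in auto)
  then have lim: "(\<lambda>k. K * (LINT \<zeta>|\<mu>. (norm (poly (R k) \<zeta>))\<^sup>2)) \<longlonglongrightarrow> K * (LINT \<zeta>|\<mu>. (norm (poly Q \<zeta>))\<^sup>2)"
    by (intro tendsto_intros)
  show ?thesis
    by (rule tendsto_le[OF _ lim conv bound]) simp
qed

text \<open>The factor 8 n is 4 from the pointwise bound times 2 n, the bound for the Poisson kernel
  that removes it from the integral of |Q|^2 w.\<close>

lemma kernel_bound:
  fixes w :: "complex \<Rightarrow> real"
  assumes w: "integrable circle_lebesgue w" and pos: "AE \<zeta> in circle_lebesgue. w \<zeta> > 0"
    and lnw: "integrable circle_lebesgue (\<lambda>\<zeta>. ln (w \<zeta>))"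
    and dom: "\<And>A. A \<in> sets borel \<Longrightarrow> emeasure (density circle_lebesgue (\<lambda>\<zeta>. ennreal (w \<zeta>))) A \<le> emeasure \<mu> A"
    and \<xi>: "norm \<xi> = 1" and n: "n \<ge> 1"
    and C: "(LINT \<zeta>|circle_lebesgue. \<bar>ln (w \<zeta>)\<bar> * radial_poisson (1 - 1 / real n) (dist \<xi> \<zeta>)) \<le> C"
  shows "(\<Sum>k\<le>n. (norm (e k \<xi>))\<^sup>2) \<le> 8 * real n * exp C"
proof (rule kernel_le_of_polys[OF \<xi>], simp, rule poly_bound_zeros_on_circle[OF \<xi>])
  have nonneg: "AE \<zeta> in circle_lebesgue. w \<zeta> \<ge> 0" using pos by eventually_elim simp
  define r where "r = 1 - 1 / real n"
  have r: "0 \<le> r" "r < 1" using n by (auto simp: r_def)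
  fix Q :: "complex poly"
  assume deg: "degree Q \<le> n" and nz: "\<And>\<zeta>. norm \<zeta> = 1 \<Longrightarrow> poly Q \<zeta> \<noteq> 0"
  have "(norm (poly Q \<xi>))\<^sup>2 \<le> 4 * exp (LINT \<zeta>|circle_lebesgue. \<bar>ln (w \<zeta>)\<bar> * radial_poisson r (dist \<xi> \<zeta>)) *
     (LINT \<zeta>|circle_lebesgue. (norm (poly Q \<zeta>))\<^sup>2 * w \<zeta> * radial_poisson r (dist \<xi> \<zeta>))"
    by (rule Szego_pointwise_bound[OF w pos lnw nz n deg \<xi> r_def])
  also have "\<dots> \<le> 4 * exp C * (2 * real n * (LINT \<zeta>|\<mu>. (norm (poly Q \<zeta>))\<^sup>2))"
  proof (intro mult_mono mult_left_mono)
    have "(LINT \<zeta>|circle_lebesgue. (norm (poly Q \<zeta>))\<^sup>2 * w \<zeta> * radial_poisson r (dist \<xi> \<zeta>)) \<le>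
      (LINT \<zeta>|circle_lebesgue. (norm (poly Q \<zeta>))\<^sup>2 * w \<zeta> * (2 * real n))"
    proof (rule integral_mono_AE)
      show "AE \<zeta> in circle_lebesgue. (norm (poly Q \<zeta>))\<^sup>2 * w \<zeta> * radial_poisson r (dist \<xi> \<zeta>) \<le>
         (norm (poly Q \<zeta>))\<^sup>2 * w \<zeta> * (2 * real n)"
        using nonneg
        by eventually_elim (auto simp: r_def intro!: mult_left_mono radial_poisson_le n)
    qed (auto intro!: integrable_mult_radial_poisson integrable_poly_weight w r integrable_mult_left)
    also have "\<dots> = 2 * real n * (LINT \<zeta>|circle_lebesgue. (norm (poly Q \<zeta>))\<^sup>2 * w \<zeta>)"
      by simp
    also have "\<dots> \<le> 2 * real n * (LINT \<zeta>|\<mu>. (norm (poly Q \<zeta>))\<^sup>2)"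
      by (intro mult_left_mono poly_weight_integral_le w nonneg dom) auto
    finally show "(LINT \<zeta>|circle_lebesgue. (norm (poly Q \<zeta>))\<^sup>2 * w \<zeta> * radial_poisson r (dist \<xi> \<zeta>)) \<le>
      2 * real n * (LINT \<zeta>|\<mu>. (norm (poly Q \<zeta>))\<^sup>2)" .
    show "0 \<le> (LINT \<zeta>|circle_lebesgue. (norm (poly Q \<zeta>))\<^sup>2 * w \<zeta> * radial_poisson r (dist \<xi> \<zeta>))"
      by (rule integral_nonneg_AE)
         (use nonneg in \<open>eventually_elim, auto intro!: mult_nonneg_nonneg less_imp_le[OF radial_poisson_pos[OF r]]\<close>)
  qed (use C in \<open>auto simp: r_def\<close>)
  finally show "(norm (poly Q \<xi>))\<^sup>2 \<le> 8 * real n * exp C * (LINT \<zeta>|\<mu>. (norm (poly Q \<zeta>))\<^sup>2)"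
    by (simp add: mult_ac)
qed auto

text \<open>Where \<open>f\<close> is within \<open>1/(k+1)\<close> of a rational point \<open>q\<close>, the measure \<open>|f - q|\<^sup>2 \<mu>\<close> restricted to
  the complement of that set is negligible on small discs.\<close>

lemma AE_lebesgue_point:
  assumes f: "L2_fun \<mu> f"
    and low: "AE \<xi> in circle_lebesgue. \<exists>\<delta>>0. \<forall>\<rho>. 0 < \<rho> \<longrightarrow> \<rho> \<le> 1 \<longrightarrow> \<delta> * \<rho> \<le> measure \<mu> (ball \<xi> \<rho>)"
  shows "AE \<xi> in circle_lebesgue. lebesgue_point_value \<mu> f \<xi> (f \<xi>)"
proof -
  have [measurable]: "f \<in> borel_measurable borel"
    using f by (auto simp: L2_fun_def cong: measurable_cong_sets)
  \<comment> \<open>Countably many centres and radii allow a single null set for all pairs (x,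
    k).\<close>
  define q where "q x = Complex (of_rat (fst x)) (of_rat (snd x))" for x :: "rat \<times> rat"
  define A where "A x k = {z. norm (f z - q x) < 1 / real (Suc k)}" for x k
  have A [measurable]: "A x k \<in> sets borel" for x k unfolding A_def by measurable
  define \<nu> where "\<nu> x k = density \<mu> (\<lambda>z. ennreal (indicator (- A x k) z * (norm (f z - q x))\<^sup>2))" for x k
  have sets_\<nu>: "sets (\<nu> x k) = sets borel" for x k by (simp add: \<nu>_def)
  have q_int: "integrable \<mu> (\<lambda>z. (norm (f z - c))\<^sup>2)" for c
  proof -
    have "L2_fun \<mu> (\<lambda>z. f z - c)" by (intro L2_fun_diff f) (auto simp: L2_fun_def)
    then show ?thesis by (simp add: L2_fun_def)
  qed
  have ind_int: "integrable \<mu> (\<lambda>z. indicat_real S z * (norm (f z - c))\<^sup>2)" if "S \<in> sets borel" for S c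
    using integrable_mult_indicator[OF _ q_int, of S c] that by simp
  have em_\<nu>: "emeasure (\<nu> x k) S = ennreal (LINT z|\<mu>. indicator (S \<inter> - A x k) z * (norm (f z - q x))\<^sup>2)"
    if [measurable]: "S \<in> sets borel" for S x k
  proof -
    have "emeasure (\<nu> x k) S = (\<integral>\<^sup>+z. ennreal (indicator (S \<inter> - A x k) z * (norm (f z - q x))\<^sup>2) \<partial>\<mu>)"
      unfolding \<nu>_def by (subst emeasure_density) (auto intro!: nn_integral_cong split: split_indicator)
    also have "\<dots> = ennreal (LINT z|\<mu>. indicator (S \<inter> - A x k) z * (norm (f z - q x))\<^sup>2)"
      by (intro nn_integral_eq_integral ind_int) auto
    finally show ?thesis .
  qed
  have fin: "finite_measure (\<nu> x k)" for x k
    by (rule finite_measureI) (use em_\<nu>[of UNIV x k] in \<open>simp add: \<nu>_def\<close>)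
  have null: "emeasure (\<nu> x k) (A x k) = 0" for x k
    unfolding em_\<nu>[OF A] by simp
  have "AE \<xi> in circle_lebesgue. \<forall>x k. \<xi> \<in> A x k \<longrightarrow> (\<forall>\<kappa>>0. \<exists>\<epsilon>>0. \<forall>\<rho>. 0 < \<rho> \<longrightarrow> \<rho> \<le> \<epsilon> \<longrightarrow> measure (\<nu> x k) (ball \<xi> \<rho>) \<le> \<kappa> * \<rho>)"
    unfolding AE_all_countable by (intro allI AE_ball_measure_sublinear fin sets_\<nu> A null)
  then show ?thesis using low
  proof eventually_elim
    case (elim \<xi>)
    then obtain \<delta> where \<delta>: "\<delta> > 0" "\<And>\<rho>. 0 < \<rho> \<Longrightarrow> \<rho> \<le> 1 \<Longrightarrow> \<delta> * \<rho> \<le> measure \<mu> (ball \<xi> \<rho>)" by blast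
    have "\<xi> \<in> msupport \<mu>" unfolding msupport_def
    proof (intro CollectI allI impI)
      fix \<epsilon> :: real assume "\<epsilon> > 0"
      then have "0 < \<delta> * min \<epsilon> 1" using \<delta> by simp
      also have "\<dots> \<le> measure \<mu> (ball \<xi> (min \<epsilon> 1))" using \<open>\<epsilon> > 0\<close> by (intro \<delta>) auto
      also have "\<dots> \<le> measure \<mu> (ball \<xi> \<epsilon>)" by (intro finite_measure_mono subset_ball) auto
      finally show "emeasure \<mu> (ball \<xi> \<epsilon>) > 0" by (simp add: emeasure_eq_measure)
    qed
    moreover have "((\<lambda>\<epsilon>. (LINT z:ball \<xi> \<epsilon>|\<mu>. (norm (f z - f \<xi>))\<^sup>2) / measure \<mu> (ball \<xi> \<epsilon>)) \<longlongrightarrow> 0) (at_right 0)"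
    proof (rule tendstoI)
      fix \<eta> :: real assume \<eta>: "\<eta> > 0"
      \<comment> \<open>The two requirements t < 1 and t < \<eta>/8 on t = 1/(k+1) give 4 t^2 <
        \<eta>/2.\<close>
      obtain k where k: "1 / real (Suc k) < min 1 (\<eta> / 8)" 
        using nat_approx_posE[of "min 1 (\<eta> / 8)"] \<eta> by auto
      define t where "t = 1 / real (Suc k)"
      have t: "0 < t" "t < 1" "t < \<eta> / 8" using k by (auto simp: t_def)
      then have "t * t \<le> t * 1" by (intro mult_left_mono) auto
      then have t2: "4 * t\<^sup>2 < \<eta> / 2" using t(3) by (simp only: power2_eq_square)
      obtain x where x: "norm (f \<xi> - q x) < t"
      proof -
        have "Re (f \<xi>) - t / 2 < Re (f \<xi>)" using t by simp
        then obtain a where a: "Re (f \<xi>) - t / 2 < of_rat a" "of_rat a < Re (f \<xi>)"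
          using of_rat_dense by blast
        have "Im (f \<xi>) - t / 2 < Im (f \<xi>)" using t by simp
        then obtain b where b: "Im (f \<xi>) - t / 2 < of_rat b" "of_rat b < Im (f \<xi>)"
          using of_rat_dense by blast
        have "norm (f \<xi> - q (a, b)) \<le> \<bar>Re (f \<xi> - q (a, b))\<bar> + \<bar>Im (f \<xi> - q (a, b))\<bar>" by (rule cmod_le)
        also have "\<dots> < t" using a b by (simp add: q_def abs_if)
        finally show thesis by (rule that)
      qed
      \<comment> \<open>Then 2 \<kappa> \<rho> = (\<eta>/4) \<delta> \<rho> is at most \<eta>/4
        times the \<mu>-measure of the disc.\<close>
      define \<kappa> where "\<kappa> = \<delta> * \<eta> / 8"
      have "\<xi> \<in> A x k" "\<kappa> > 0" using x \<eta> \<delta> by (auto simp: A_def t_def \<kappa>_def)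
      then obtain \<epsilon> where \<epsilon>: "\<epsilon> > 0" "\<And>\<rho>. 0 < \<rho> \<Longrightarrow> \<rho> \<le> \<epsilon> \<Longrightarrow> measure (\<nu> x k) (ball \<xi> \<rho>) \<le> \<kappa> * \<rho>"
        using elim(1) by blast
      have "dist ((LINT z:ball \<xi> \<rho>|\<mu>. (norm (f z - f \<xi>))\<^sup>2) / measure \<mu> (ball \<xi> \<rho>)) 0 < \<eta>"
        if \<rho>: "0 < \<rho>" "\<rho> < min \<epsilon> 1" for \<rho>
      proof -
        define m where "m = measure \<mu> (ball \<xi> \<rho>)"
        have m: "\<delta> * \<rho> \<le> m" unfolding m_def using \<rho> by (intro \<delta>) auto
        have m_pos: "m > 0" using m \<delta> \<rho> by (meson less_le_trans mult_pos_pos)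
        have ball: "ball \<xi> \<rho> \<in> sets \<mu>" by simp
        have i1: "integrable \<mu> (\<lambda>z. indicator (ball \<xi> \<rho> \<inter> - A x k) z * (norm (f z - q x))\<^sup>2)"
          by (rule ind_int) auto
        have \<nu>_eq: "measure (\<nu> x k) (ball \<xi> \<rho>) = (LINT z|\<mu>. indicator (ball \<xi> \<rho> \<inter> - A x k) z * (norm (f z - q x))\<^sup>2)"
          using em_\<nu>[of "ball \<xi> \<rho>" x k] by (simp add: measure_def Bochner_Integration.integral_nonneg)
        have "(LINT z:ball \<xi> \<rho>|\<mu>. (norm (f z - f \<xi>))\<^sup>2) = (LINT z|\<mu>. indicator (ball \<xi> \<rho>) z * (norm (f z - f \<xi>))\<^sup>2)"
          by (simp add: set_lebesgue_integral_def)
        \<comment> \<open>On A both f z and f \<xi> are within t of q, which gives 4 t^2; off A the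
          excess is twice the density of \<open>\<nu> x k\<close>.\<close>
        also have "\<dots> \<le> (LINT z|\<mu>. 2 * (indicator (ball \<xi> \<rho> \<inter> - A x k) z * (norm (f z - q x))\<^sup>2) + 4 * t\<^sup>2 * indicator (ball \<xi> \<rho>) z)"
        proof (rule integral_mono)
          fix z
          show "indicator (ball \<xi> \<rho>) z * (norm (f z - f \<xi>))\<^sup>2 \<le> 
            2 * (indicator (ball \<xi> \<rho> \<inter> - A x k) z * (norm (f z - q x))\<^sup>2) + 4 * t\<^sup>2 * indicator (ball \<xi> \<rho>) z"
          proof (cases "z \<in> ball \<xi> \<rho>")
            case True
            have "(norm (f z - f \<xi>))\<^sup>2 \<le> 2 * (norm (f z - q x))\<^sup>2 + 2 * (norm (q x - f \<xi>))\<^sup>2"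
              using norm_add_sq_le[of "f z - q x" "q x - f \<xi>"] by simp
            also have "(norm (q x - f \<xi>))\<^sup>2 \<le> t\<^sup>2"
              using x by (intro power_mono) (auto simp: norm_minus_commute)
            finally have 1: "(norm (f z - f \<xi>))\<^sup>2 \<le> 2 * (norm (f z - q x))\<^sup>2 + 2 * t\<^sup>2" by simp
            show ?thesis
            proof (cases "z \<in> A x k")
              case True
              then have "(norm (f z - q x))\<^sup>2 \<le> t\<^sup>2" by (intro power_mono) (auto simp: A_def t_def)
              with 1 \<open>z \<in> ball \<xi> \<rho>\<close> True show ?thesis by (simp add: indicator_def)
            next
              case False
              have "(norm (f z - f \<xi>))\<^sup>2 \<le> 2 * (norm (f z - q x))\<^sup>2 + 4 * t\<^sup>2"
                using 1 zero_le_power2[of t] by linarith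
              with False \<open>z \<in> ball \<xi> \<rho>\<close> show ?thesis by (simp add: indicator_def)
            qed
          qed simp
        qed (use ind_int[of "ball \<xi> \<rho>" "f \<xi>"] i1 in \<open>auto simp: emeasure_eq_measure\<close>)
        also have "\<dots> = 2 * measure (\<nu> x k) (ball \<xi> \<rho>) + 4 * t\<^sup>2 * m"
          using i1 by (subst Bochner_Integration.integral_add) (auto simp: \<nu>_eq m_def emeasure_eq_measure)
        also have "\<dots> \<le> 2 * (\<kappa> * \<rho>) + 4 * t\<^sup>2 * m"
          using \<rho> by (intro add_right_mono mult_left_mono \<epsilon>) auto
        also have "2 * (\<kappa> * \<rho>) = \<eta> / 4 * (\<delta> * \<rho>)" by (simp add: \<kappa>_def)
        also have "\<dots> \<le> \<eta> / 4 * m" using m \<eta> by (intro mult_left_mono) auto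
        also have "\<eta> / 4 * m + 4 * t\<^sup>2 * m < \<eta> / 4 * m + \<eta> / 2 * m"
          using t2 m_pos by (intro add_strict_left_mono mult_strict_right_mono)
        also have "\<dots> \<le> \<eta> * m" using \<eta> m_pos by simp
        finally have "(LINT z:ball \<xi> \<rho>|\<mu>. (norm (f z - f \<xi>))\<^sup>2) / m < \<eta>"
          using m_pos by (simp add: field_simps)
        moreover have "(LINT z:ball \<xi> \<rho>|\<mu>. (norm (f z - f \<xi>))\<^sup>2) / m \<ge> 0"
          using m_pos unfolding set_lebesgue_integral_def
          by (intro divide_nonneg_pos Bochner_Integration.integral_nonneg) auto
        ultimately show ?thesis by (simp add: m_def)
      qed
      then show "\<forall>\<^sub>F \<rho> in at_right 0. dist ((LINT z:ball \<xi> \<rho>|\<mu>. (norm (f z - f \<xi>))\<^sup>2) / measure \<mu> (ball \<xi> \<rho>)) 0 < \<eta>"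
        using \<epsilon>(1) unfolding eventually_at_right_field by (intro exI[of _ "min \<epsilon> 1"]) auto
    qed
    ultimately show ?case unfolding lebesgue_point_value_def using f by auto
  qed
qed

text \<open>At almost every \<xi> the discs of |ln w| dm and of \<mu> grow at most linearly. The
  first fact bounds the kernel sum by a multiple of n, the second bounds the Poisson extension from
  above; together they give the kernel hypothesis with a constant depending on \<xi>.\<close>

theorem AE_strong_cesaro:
  fixes w :: "complex \<Rightarrow> real"
  assumes w: "integrable circle_lebesgue w" and pos: "AE \<zeta> in circle_lebesgue. w \<zeta> > 0"
    and lnw: "integrable circle_lebesgue (\<lambda>\<zeta>. ln (w \<zeta>))"
    and dom: "\<And>A. A \<in> sets borel \<Longrightarrow> emeasure (density circle_lebesgue (\<lambda>\<zeta>. ennreal (w \<zeta>))) A \<le> emeasure \<mu> A"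
    and f: "L2_fun \<mu> f"
  shows "AE \<xi> in circle_lebesgue. strong_cesaro_at \<mu> f \<xi> (f \<xi>)"
proof -
  note [measurable] = borel_measurable_integrable[OF w] borel_measurable_integrable[OF lnw]
  define \<nu> where "\<nu> = density circle_lebesgue (\<lambda>\<zeta>. ennreal \<bar>ln (w \<zeta>)\<bar>)"
  have sets_\<nu>: "sets \<nu> = sets borel" by (simp add: \<nu>_def)
  have aln: "integrable circle_lebesgue (\<lambda>\<zeta>. \<bar>ln (w \<zeta>)\<bar>)" using lnw by simp
  have fin: "finite_measure \<nu>"
  proof (rule finite_measureI)
    have "emeasure \<nu> (space \<nu>) = (\<integral>\<^sup>+\<zeta>. ennreal \<bar>ln (w \<zeta>)\<bar> \<partial>circle_lebesgue)"
      by (simp add: \<nu>_def emeasure_density)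
    also have "\<dots> = ennreal (LINT \<zeta>|circle_lebesgue. \<bar>ln (w \<zeta>)\<bar>)"
      by (intro nn_integral_eq_integral aln) auto
    finally show "emeasure \<nu> (space \<nu>) \<noteq> \<infinity>" by simp
  qed
  interpret \<nu>: finite_measure \<nu> by (rule fin)
  have AE_\<nu>: "AE \<zeta> in \<nu>. \<zeta> \<in> sphere 0 1"
    unfolding \<nu>_def by (subst AE_density) (use AE_circle_lebesgue in auto)
  have \<nu>_ball: "measure \<nu> (ball \<xi> \<rho>) = (LINT \<zeta>:ball \<xi> \<rho>|circle_lebesgue. \<bar>ln (w \<zeta>)\<bar>)" for \<xi> \<rho>
  proof -
    have "emeasure \<nu> (ball \<xi> \<rho>) = (\<integral>\<^sup>+\<zeta>. ennreal (indicator (ball \<xi> \<rho>) \<zeta> * \<bar>ln (w \<zeta>)\<bar>) \<partial>circle_lebesgue)"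
      unfolding \<nu>_def by (subst emeasure_density) (auto intro!: nn_integral_cong split: split_indicator)
    also have "\<dots> = ennreal (LINT \<zeta>:ball \<xi> \<rho>|circle_lebesgue. \<bar>ln (w \<zeta>)\<bar>)"
      using integrable_mult_indicator[OF _ aln, of "ball \<xi> \<rho>"]
      by (subst nn_integral_eq_integral) (auto simp: set_lebesgue_integral_def)
    finally show ?thesis
      by (simp add: measure_def set_lebesgue_integral_def Bochner_Integration.integral_nonneg)
  qed
  have \<mu>_ball: "(LINT \<zeta>:ball \<xi> \<rho>|circle_lebesgue. w \<zeta>) \<le> measure \<mu> (ball \<xi> \<rho>)" for \<xi> \<rho>
  proof -
    have int: "integrable circle_lebesgue (\<lambda>\<zeta>. indicator (ball \<xi> \<rho>) \<zeta> * w \<zeta>)"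
      using integrable_mult_indicator[OF _ w, of "ball \<xi> \<rho>"] by simp
    have "ennreal (LINT \<zeta>:ball \<xi> \<rho>|circle_lebesgue. w \<zeta>) = 
        (\<integral>\<^sup>+\<zeta>. ennreal (indicator (ball \<xi> \<rho>) \<zeta> * w \<zeta>) \<partial>circle_lebesgue)"
      unfolding set_lebesgue_integral_def real_scaleR_def
      by (rule nn_integral_eq_integral[symmetric, OF int]) (use pos in \<open>eventually_elim, auto\<close>)
    also have "\<dots> = emeasure (density circle_lebesgue (\<lambda>\<zeta>. ennreal (w \<zeta>))) (ball \<xi> \<rho>)"
      by (subst emeasure_density) (auto intro!: nn_integral_cong split: split_indicator)
    also have "\<dots> \<le> ennreal (measure \<mu> (ball \<xi> \<rho>))"
      unfolding emeasure_eq_measure[symmetric] by (rule dom) simp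
    finally show ?thesis by simp
  qed
  have low: "AE \<xi> in circle_lebesgue. \<exists>\<delta>>0. \<forall>\<rho>. 0 < \<rho> \<longrightarrow> \<rho> \<le> 1 \<longrightarrow> \<delta> * \<rho> \<le> measure \<mu> (ball \<xi> \<rho>)"
    using AE_circle_lebesgue AE_ball_measure_linear_bound[OF fin sets_\<nu>]
  proof eventually_elim
    case (elim \<xi>)
    then obtain A where A: "A > 0" "\<And>\<rho>. \<rho> > 0 \<Longrightarrow> measure \<nu> (ball \<xi> \<rho>) \<le> A * \<rho>" by blast
    have "exp (- (8 * A)) / 8 * \<rho> \<le> measure \<mu> (ball \<xi> \<rho>)" if "0 < \<rho>" "\<rho> \<le> 1" for \<rho>
    proof -
      have "exp (- (8 * A)) / 8 * \<rho> \<le> (LINT \<zeta>:ball \<xi> \<rho>|circle_lebesgue. w \<zeta>)"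
        using elim that A(2)[OF that(1)] A(1)
        by (intro density_ball_lower_bound w pos lnw) (auto simp: \<nu>_ball)
      also have "\<dots> \<le> measure \<mu> (ball \<xi> \<rho>)" by (rule \<mu>_ball)
      finally show ?thesis .
    qed
    then show ?case by (intro exI[of _ "exp (- (8 * A)) / 8"]) auto
  qed
  show ?thesis
    using AE_circle_lebesgue AE_ball_measure_linear_bound[OF fin sets_\<nu>] 
      AE_ball_measure_linear_bound[OF finite_measure_axioms sets_mu] AE_lebesgue_point[OF f low]
  proof eventually_elim
    case (elim \<xi>)
    have \<xi>: "norm \<xi> = 1" using elim(1) by simp
    obtain A where A: "A > 0" "\<And>\<rho>. \<rho> > 0 \<Longrightarrow> measure \<nu> (ball \<xi> \<rho>) \<le> A * \<rho>" using elim(2) by blast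
    obtain A' where A': "A' > 0" "\<And>\<rho>. \<rho> > 0 \<Longrightarrow> measure \<mu> (ball \<xi> \<rho>) \<le> A' * \<rho>" using elim(3) by blast
    show ?case
    proof (rule strong_cesaro_at_lebesgue_point[OF \<xi> _ f elim(4)])
      fix n :: nat assume n: "n \<ge> 1"
      define r where "r = 1 - 1 / real n"
      have r: "0 \<le> r" "r < 1" using n by (auto simp: r_def)
      note [measurable] = radial_poisson_meas[OF r]
      have "(LINT \<zeta>|circle_lebesgue. \<bar>ln (w \<zeta>)\<bar> * radial_poisson r (dist \<xi> \<zeta>)) = (LINT \<zeta>|\<nu>. radial_poisson r (dist \<xi> \<zeta>))"
        unfolding \<nu>_def by (subst integral_density) auto
      also have "\<dots> \<le> 8 * A" by (rule radial_poisson_integral_le[OF fin sets_\<nu> AE_\<nu> A \<xi> r])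
      finally have "(\<Sum>k\<le>n. (norm (e k \<xi>))\<^sup>2) \<le> 8 * real n * exp (8 * A)"
        unfolding r_def by (rule kernel_bound[OF w pos lnw _ \<xi> n, rotated]) (rule dom)
      then have "(1 / real n) * (\<Sum>k\<le>n. (norm (e k \<xi>))\<^sup>2) \<le> 8 * exp (8 * A)"
        using n by (simp add: field_simps)
      \<comment> \<open>The factor 8 A' dominates the Poisson extension, so multiplying by it and
        dividing by the extension only enlarges the bound.\<close>
      also have "\<dots> \<le> 8 * exp (8 * A) * (8 * A') / poisson_ext \<mu> (of_real (1 - 1 / real n) * \<xi>)"
      proof -
        have "poisson_ext \<mu> (of_real r * \<xi>) \<le> 8 * A'"
          unfolding poisson_ext_radial[OF sets_mu AE_circle \<xi> r]
          by (rule radial_poisson_integral_le[OF finite_measure_axioms sets_mu AE_circle A' \<xi> r])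
        moreover have "poisson_ext \<mu> (of_real r * \<xi>) > 0"
          unfolding r_def by (rule less_le_trans[OF _ poisson_ext_ge[OF \<xi> n]]) (use n in auto)
        ultimately show ?thesis unfolding r_def by (simp add: le_divide_eq)
      qed
      finally show "(1 / real n) * (\<Sum>k\<le>n. (norm (e k \<xi>))\<^sup>2) \<le> 
        8 * exp (8 * A) * (8 * A') / poisson_ext \<mu> (of_real (1 - 1 / real n) * \<xi>)" .
    qed
  qed
qed

end

theorem theorem2:
  fixes \<mu> :: "complex measure"
  assumes "circle_prob \<mu>" and "infinite (msupport \<mu>)"
  shows
    "(\<forall>(\<xi>\<^sub>0::complex) (c::real) (f::complex \<Rightarrow> complex) (v::complex).
        norm \<xi>\<^sub>0 = 1 \<longrightarrow>
        (\<forall>n::nat. n \<ge> 1 \<longrightarrow>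
           (1 / real n) * (\<Sum>k\<le>n. (norm (cmv_basis \<mu> k \<xi>\<^sub>0))\<^sup>2)
             \<le> c / poisson_ext \<mu> (of_real (1 - 1 / real n) * \<xi>\<^sub>0)) \<longrightarrow>
        L2_fun \<mu> f \<longrightarrow> lebesgue_point_value \<mu> f \<xi>\<^sub>0 v \<longrightarrow>
        strong_cesaro_at \<mu> f \<xi>\<^sub>0 v)
     \<and>
     (\<forall>(w::complex \<Rightarrow> real) (\<mu>\<^sub>s::complex measure).
        lebesgue_decomp \<mu> w \<mu>\<^sub>s \<longrightarrow> log_integrable w \<longrightarrow>
        (\<forall>f::complex \<Rightarrow> complex. L2_fun \<mu> f \<longrightarrow>
           (AE \<xi> in circle_lebesgue. strong_cesaro_at \<mu> f \<xi> (f \<xi>))))"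
proof -
  interpret cmv_measure \<mu> by standard (fact assms)+
  show ?thesis
  proof (intro conjI allI impI)
    fix \<xi> c f v
    assume "norm \<xi> = 1" "L2_fun \<mu> f" "lebesgue_point_value \<mu> f \<xi> v"
      "\<forall>n::nat. n \<ge> 1 \<longrightarrow> (1 / real n) * (\<Sum>k\<le>n. (norm (e k \<xi>))\<^sup>2)
             \<le> c / poisson_ext \<mu> (of_real (1 - 1 / real n) * \<xi>)"
    then show "strong_cesaro_at \<mu> f \<xi> v"
      by (intro strong_cesaro_at_lebesgue_point) auto
  next
    fix w :: "complex \<Rightarrow> real" and \<mu>\<^sub>s f
    assume "lebesgue_decomp \<mu> w \<mu>\<^sub>s" "log_integrable w" "L2_fun \<mu> f"
    \<comment> \<open>The mass of the singular part is nonnegative, so the decomposition gives the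
      domination of w dm by \<mu>.\<close>
    then show "AE \<xi> in circle_lebesgue. strong_cesaro_at \<mu> f \<xi> (f \<xi>)"
      by (intro AE_strong_cesaro[of w]) (auto simp: lebesgue_decomp_def log_integrable_def)
  qed
qed

end
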